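(* Let $v\in\mu_{q-1}$ and set $u=v^{1-p}$. Then $\mathcal{E}_{u,2}(v)$ is a Kummer generator of $L_u/K'$ (that is, $\mathcal{E}_{u,2}(v)^p\in K'$ and $L_u=K'(\mathcal{E}_{u,2}(v))$, with $[L_u:K']=p$); further, the extension $L_u/K$ is cyclic of degree $p(p-1)$.
   Context: $p$ is an odd prime, $K\subset\bar{\mathbb{Q}}_p$ an unramified extension of $\mathbb{Q}_p$ of degree $d$, $q=p^d$, $\mu_n$ the $n$th roots of unity in $\bar{\mathbb{Q}}_p$. Let $\gamma$ be a root of $X^{p-1}+p$ and $K'=K(\gamma)$. For $u\in\mu_{q-1}$ let $f_u(X)=X^p+upX$, let $\omega_u$ be a root of $f_u(X)-\gamma$, let $L_u=K'(\omega_u)$, and let $$\mathcal{E}_{u,2}(X)=\exp\left(\omega_uX-u\omega_uX^p+\frac{\gamma X^p-\gamma X^{p^2}}{p}\right),$$ a power series converging on the closed unit disc of $\bar{\mathbb{Q}}_p$. *)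

theory Defs
  imports "HOL-Analysis.Analysis" "HOL-Algebra.Bij" "HOL-Algebra.Elementary_Groups"
    "HOL-Algebra.Generated_Fields" "HOL-Algebra.Algebraic_Closure_Type"
begin

section \<open>The algebraic closure of the p-adic numbers\<close>

text \<open>
  The algebraic closure of the field of p-adic numbers is modelled by a type carrying a field
  structure and a metric, the absolute value of \<open>x\<close> being its distance from
  \<open>0\<close>. (The library's \<open>norm\<close> is reserved for real vector spaces.)
  Limits, completeness, \<open>summable\<close> and \<open>suminf\<close> are those of the metric. The field of
  p-adic numbers is the topological closure of the rationals: being complete, it is the completion
  of the rationals for the p-adic absolute value. Together with algebraicity and the class
  \<open>alg_closed_field\<close> this determines the valued field up to isometric isomorphism.
\<close>

definition Qp :: "'a::{field_char_0, metric_space} set" where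
  "Qp = closure \<rat>"

abbreviation absval :: "'a::{zero, metric_space} \<Rightarrow> real" where
  "absval x \<equiv> dist x 0"

definition padic_algebraic_closure ::
  "nat \<Rightarrow> 'a::{alg_closed_field, field_char_0, metric_space} itself \<Rightarrow> bool" where
  "padic_algebraic_closure p _ \<longleftrightarrow>
     (\<forall>x y :: 'a. dist x y = absval (x - y)) \<and>
     (\<forall>x y :: 'a. absval (x * y) = absval x * absval y) \<and>
     (\<forall>x y :: 'a. absval (x + y) \<le> max (absval x) (absval y)) \<and>
     absval (of_nat p :: 'a) = 1 / real p \<and>
     complete (Qp :: 'a set) \<and>
     (\<forall>x :: 'a. \<exists>f. f \<noteq> 0 \<and> (\<forall>i. Polynomial.coeff f i \<in> Qp) \<and> poly f x = 0)"

section \<open>Subfields and their extensions\<close>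

abbreviation ambient :: "'a::field ring" where
  "ambient \<equiv> ring_of_type_algebra"

abbreviation has_degree :: "'a::field set \<Rightarrow> 'a set \<Rightarrow> nat \<Rightarrow> bool" where
  "has_degree L K n \<equiv> ring.dimension ambient n K L"

definition adjoin :: "'a::field set \<Rightarrow> 'a \<Rightarrow> 'a set" where
  "adjoin K a = generate_field ambient (insert a K)"

text \<open>
  Ramification index one: the value groups coincide. The residue fields are finite, so there is
  no separability condition.
\<close>

definition unramified_over_Qp ::
  "'a::{field_char_0, metric_space} set \<Rightarrow> bool" where
  "unramified_over_Qp K \<longleftrightarrow> absval ` (K - {0}) = absval ` ((Qp :: 'a set) - {0})"

text \<open>Automorphisms are extended by \<open>undefined\<close> outside \<open>L\<close>, as in \<open>BijGroup\<close>.\<close>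

definition galois_group :: "'a::field set \<Rightarrow> 'a set \<Rightarrow> ('a \<Rightarrow> 'a) monoid" where
  "galois_group L K = BijGroup L
     \<lparr>carrier := {\<sigma> \<in> Bij L. \<sigma> \<in> ring_hom (ambient\<lparr>carrier := L\<rparr>) (ambient\<lparr>carrier := L\<rparr>)
                           \<and> (\<forall>x\<in>K. \<sigma> x = x)}\<rparr>"

definition finite_galois_extension :: "'a::field set \<Rightarrow> 'a set \<Rightarrow> bool" where
  "finite_galois_extension L K \<longleftrightarrow>
     subfield K ambient \<and> subfield L ambient \<and> K \<subseteq> L \<and> (\<exists>n. has_degree L K n) \<and>
     {x \<in> L. \<forall>\<sigma> \<in> carrier (galois_group L K). \<sigma> x = x} = K"

definition cyclic_extension :: "'a::field set \<Rightarrow> 'a set \<Rightarrow> bool" where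
  "cyclic_extension L K \<longleftrightarrow>
     finite_galois_extension L K \<and> cyclic_group (galois_group L K)"

definition kummer_generator :: "nat \<Rightarrow> 'a::field \<Rightarrow> 'a set \<Rightarrow> 'a set \<Rightarrow> bool" where
  "kummer_generator p a L F \<longleftrightarrow> a ^ p \<in> F \<and> L = adjoin F a \<and> has_degree L F p"

section \<open>The power series\<close>

definition f_poly :: "nat \<Rightarrow> 'a::field \<Rightarrow> 'a poly" where
  "f_poly p u = Polynomial.monom 1 p + Polynomial.monom (u * of_nat p) 1"

text \<open>
  The exponential is composed as a formal power series. Its argument has no constant term, so
  \<open>fps_compose\<close> is the actual substitution. The terms of the argument must not be
  exponentiated separately: the individual exponentials need not converge on the unit disc.
\<close>

definition E2_series :: "nat \<Rightarrow> 'a::field_char_0 \<Rightarrow> 'a \<Rightarrow> 'a \<Rightarrow> 'a fps" where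
  "E2_series p u \<gamma> \<omega> = fps_exp 1 oo
     (fps_const \<omega> * fps_X - fps_const (u * \<omega>) * fps_X ^ p
      + fps_const (1 / of_nat p) *
          (fps_const \<gamma> * fps_X ^ p - fps_const \<gamma> * fps_X ^ (p ^ 2)))"

text \<open>
  The library's \<open>eval_fps\<close> requires a real Banach algebra. As for
  \<open>suminf\<close>, the value is meaningful only where the series converges.
\<close>

definition fps_converges_at ::
  "'a::{field_char_0, metric_space} fps \<Rightarrow> 'a \<Rightarrow> bool" where
  "fps_converges_at F x \<longleftrightarrow> summable (\<lambda>n. fps_nth F n * x ^ n)"

definition fps_value :: "'a::{field_char_0, metric_space} fps \<Rightarrow> 'a \<Rightarrow> 'a" where
  "fps_value F x = (\<Sum>n. fps_nth F n * x ^ n)"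

end

theory Submission
  imports Defs "HOL-Number_Theory.Residue_Primitive_Roots"
begin

text \<open>
  Counting residue classes shows that \<open>K\<close> contains the \<open>(q - 1)\<close>-th roots of unity, in particular \<open>v\<close>.
  The absolute values of \<open>\<gamma>\<close> and \<open>\<omega>\<close> are the powers of \<open>p\<close> with exponents \<open>-1/(p - 1)\<close> and
  \<open>-1/(p(p - 1))\<close>, so the degrees of \<open>K'\<close> and \<open>L\<close> are forced by ramification.
  The series factors at \<open>v\<close> as the Artin--Hasse series at \<open>\<omega> v\<close> times the exponential of a small
  series; hence it converges to some \<open>e \<in> L\<close> with \<open>absval (e - 1) = absval \<omega>\<close>, and again by
  ramification \<open>e\<close> generates \<open>L\<close>. Its \<open>p\<close>-th power is the value of a series over \<open>K'\<close>.

  Finally \<open>L = K(\<omega>)\<close> contains, by a fixed point argument, a second root \<open>\<omega>'\<close> of the polynomial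
  \<open>X^p + u p X - \<gamma>\<close> close to \<open>\<omega> + \<gamma>/v\<close>. For a primitive \<open>(p - 1)\<close>-th root of unity \<open>\<eta>\<close> the automorphism
  \<open>\<omega> \<mapsto> \<eta> \<omega>'\<close> preserves absolute values and has order \<open>p(p - 1)\<close>, the degree of \<open>L\<close>.
\<close>


section \<open>Ultrametric fields\<close>

text \<open>An algebraic closure of \<open>Qp\<close> is not complete, so limits and fixed points
  are sought inside finite-dimensional spaces over \<open>Qp\<close>, which are complete. The
  exponential of \<omega> X alone diverges at |X| = 1, since |\<omega>| exceeds the radius
  p^(-1/(p-1)); only the combined exponent can be handled. The choice u = v^(1-p) gives u v^p = v,
  which makes \<omega> v a root of Y^p + p Y = \<gamma> v^p, and there the Artin--Hasse logarithm
  becomes visible. Degrees come from values instead of an irreducibility criterion: if the sizes of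
  1, x, ..., x^(M-1) are distinct modulo the values of F, these powers are independent with maximum
  norm, and this norm does not change when x is replaced by a conjugate of the same size. The second
  root is of Artin--Schreier type: at Z = (\<gamma>/v) t the polynomial Z^p + u p Z becomes
  (\<gamma>/v)^p (t^p - t), which is almost invariant under t -> t + 1. The factor \<eta> lets the
  automorphism move \<gamma> as well.\<close>

locale ultrametric_field =
  fixes type :: "'a::{field_char_0, metric_space} itself"
  assumes dist_absval: "\<And>x y :: 'a. dist x y = absval (x - y)"
    and absval_mult: "\<And>x y :: 'a. absval (x * y) = absval x * absval y"
    and absval_add_le: "\<And>x y :: 'a. absval (x + y) \<le> max (absval x) (absval y)"
begin

lemma absval_1 [simp]: "absval (1::'a) = 1"
proof -
  have "absval (1::'a) * absval (1::'a) = absval (1::'a)"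
    using absval_mult[of 1 1] by simp
  then show ?thesis by simp
qed

lemma absval_minus [simp]: "absval (- x :: 'a) = absval x"
  using dist_absval[of 0 x] by (simp add: dist_commute)

lemma absval_diff_commute: "absval (x - y :: 'a) = absval (y - x)"
  by (metis absval_minus minus_diff_eq)

lemma absval_power [simp]: "absval (x ^ n :: 'a) = absval x ^ n"
  by (induction n) (simp_all add: absval_mult)

lemma absval_inverse [simp]: "absval (inverse x :: 'a) = inverse (absval x)"
proof (cases "x = 0")
  case False
  then have "absval x * absval (inverse x) = 1"
    by (metis absval_1 absval_mult right_inverse)
  then show ?thesis by (metis inverse_unique)
qed simp

lemma absval_divide: "absval (x / y :: 'a) = absval x / absval y"
  by (simp add: divide_inverse absval_mult)

lemma absval_prod: "absval (prod f A :: 'a) = (\<Prod>i\<in>A. absval (f i))"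
  by (induction A rule: infinite_finite_induct) (simp_all add: absval_mult)

lemma absval_diff_le: "absval (x - y :: 'a) \<le> max (absval x) (absval y)"
  using absval_add_le[of x "- y"] by simp

lemma absval_add_leI: "absval x \<le> c \<Longrightarrow> absval y \<le> c \<Longrightarrow> absval (x + y :: 'a) \<le> c"
  using absval_add_le[of x y] by simp

lemma absval_add_lessI: "absval x < c \<Longrightarrow> absval y < c \<Longrightarrow> absval (x + y :: 'a) < c"
  using absval_add_le[of x y] by simp

lemma absval_diff_leI: "absval x \<le> c \<Longrightarrow> absval y \<le> c \<Longrightarrow> absval (x - y :: 'a) \<le> c"
  using absval_diff_le[of x y] by simp

lemma absval_diff_lessI: "absval x < c \<Longrightarrow> absval y < c \<Longrightarrow> absval (x - y :: 'a) < c"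
  using absval_diff_le[of x y] by simp

lemma absval_diff_trans_le:
  "absval (x - y) \<le> c \<Longrightarrow> absval (y - z) \<le> c \<Longrightarrow> absval (x - z :: 'a) \<le> c"
  using absval_add_leI[of "x - y" c "y - z"] by simp

lemma absval_diff_trans_less:
  "absval (x - y) < c \<Longrightarrow> absval (y - z) < c \<Longrightarrow> absval (x - z :: 'a) < c"
  using absval_add_lessI[of "x - y" c "y - z"] by simp

lemma absval_add_eq_left: "absval y < absval x \<Longrightarrow> absval (x + y :: 'a) = absval x"
  using absval_add_le[of x y] absval_diff_le[of "x + y" y] by auto

lemma absval_eq_of_near: "absval (x - y) < absval y \<Longrightarrow> absval (x :: 'a) = absval y"
  using absval_add_eq_left[of "x - y" y] by simp

lemma absval_sum_le:
  fixes f :: "'b \<Rightarrow> 'a"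
  assumes "\<And>i. i \<in> A \<Longrightarrow> absval (f i) \<le> c" "0 \<le> c"
  shows "absval (sum f A) \<le> c"
  using assms(1)
  by (induction A rule: infinite_finite_induct) (simp_all add: assms(2) absval_add_leI)

lemma absval_sum_less:
  fixes f :: "'b \<Rightarrow> 'a"
  assumes "\<And>i. i \<in> A \<Longrightarrow> absval (f i) < c" "0 < c"
  shows "absval (sum f A) < c"
  using assms(1)
  by (induction A rule: infinite_finite_induct) (simp_all add: assms(2) absval_add_lessI)

lemma absval_of_nat_le_1: "absval (of_nat n :: 'a) \<le> 1"
  by (induction n) (auto intro: absval_add_leI)

lemma absval_of_int_le_1: "absval (of_int n :: 'a) \<le> 1"
  by (cases n rule: int_cases2) (simp_all add: absval_of_nat_le_1)

lemma absval_sum_dominant: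
  fixes f :: "'b \<Rightarrow> 'a"
  assumes "finite A" "i \<in> A" "\<And>j. j \<in> A \<Longrightarrow> j \<noteq> i \<Longrightarrow> absval (f j) < absval (f i)"
  shows "absval (sum f A) = absval (f i)"
proof (cases "f i = 0")
  case True
  then have "A = {i}" using assms by (auto simp: not_less[symmetric])
  then show ?thesis by simp
next
  case False
  have "absval (sum f (A - {i})) < absval (f i)"
    by (rule absval_sum_less) (use assms False in auto)
  then show ?thesis
    by (simp add: sum.remove[OF assms(1,2)] absval_add_eq_left)
qed

text \<open>Only nonzero terms have to differ in size, so vanishing coefficients may repeat. A
  nonzero largest term is then unique and dominates.\<close>

lemma absval_sum_distinct:
  fixes f :: "'b \<Rightarrow> 'a"
  assumes "finite A" "A \<noteq> {}"
    and "\<And>i j. i \<in> A \<Longrightarrow> j \<in> A \<Longrightarrow> i \<noteq> j \<Longrightarrow> f i \<noteq> 0 \<Longrightarrow> absval (f i) \<noteq> absval (f j)"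
  shows "absval (sum f A) = (MAX i\<in>A. absval (f i))"
proof -
  define m where "m = (MAX i\<in>A. absval (f i))"
  have "m \<in> (\<lambda>i. absval (f i)) ` A"
    unfolding m_def using assms(1,2) by (intro Max_in) auto
  then obtain i where i: "i \<in> A" "m = absval (f i)" by auto
  have le: "absval (f j) \<le> m" if "j \<in> A" for j
    unfolding m_def using assms(1) that by (intro Max_ge) auto
  show ?thesis
  proof (cases "f i = 0")
    case True
    then have "f j = 0" if "j \<in> A" for j using le[OF that] i by simp
    then have "sum f A = 0" by simp
    then show ?thesis using i True m_def by simp
  next
    case False
    then have "absval (sum f A) = absval (f i)"
      using assms i le by (intro absval_sum_dominant) (metis order_le_less)+
    then show ?thesis using i m_def by simp
  qed
qed

text \<open>Congruences modulo the maximal ideal multiply, by telescoping one factor at a time;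
  constant families give congruences between powers.\<close>

lemma absval_prod_diff_less:
  fixes f g :: "'b \<Rightarrow> 'a"
  assumes "\<And>i. i \<in> A \<Longrightarrow> absval (f i) \<le> 1" "\<And>i. i \<in> A \<Longrightarrow> absval (g i) \<le> 1"
    "\<And>i. i \<in> A \<Longrightarrow> absval (f i - g i) < 1"
  shows "absval (prod f A - prod g A) < 1"
  using assms
proof (induction A rule: infinite_finite_induct)
  case (insert i A)
  have "absval (prod g A) \<le> 1"
    using insert.prems(2) by (auto simp: absval_prod intro!: prod_le_1)
  then have "absval ((f i - g i) * prod g A) < 1"
    using insert.prems(3)[of i] mult_right_le_one_le[of "absval (f i - g i)" "absval (prod g A)"]
    by (auto simp: absval_mult)
  moreover have "absval (prod f A - prod g A) < 1"
    using insert by auto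
  then have "absval (f i * (prod f A - prod g A)) < 1"
    using insert.prems(1)[of i] mult_left_le_one_le[of "absval (prod f A - prod g A)" "absval (f i)"]
    by (auto simp: absval_mult)
  ultimately have "absval (f i * (prod f A - prod g A) + (f i - g i) * prod g A) < 1"
    by (intro absval_add_lessI)
  then show ?case using insert(1,2) by (simp add: algebra_simps)
qed auto

section \<open>Limits and convergent series\<close>

lemma tendsto_iff_absval: "(f \<longlongrightarrow> (a::'a)) F \<longleftrightarrow> ((\<lambda>n. absval (f n - a)) \<longlongrightarrow> 0) F"
  by (simp only: tendsto_dist_iff[of f a F] dist_absval[of _ a])

lemma tendsto_add_ultra:
  assumes "(f \<longlongrightarrow> (a::'a)) F" "(g \<longlongrightarrow> b) F"
  shows "((\<lambda>n. f n + g n) \<longlongrightarrow> a + b) F"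
proof -
  have "((\<lambda>n. max (absval (f n - a)) (absval (g n - b))) \<longlongrightarrow> max 0 0) F"
    using assms[unfolded tendsto_iff_absval] by (rule tendsto_max)
  then have lim: "((\<lambda>n. max (absval (f n - a)) (absval (g n - b))) \<longlongrightarrow> 0) F"
    by simp
  have le: "absval (f n + g n - (a + b)) \<le> max (absval (f n - a)) (absval (g n - b))" for n
    using absval_add_le[of "f n - a" "g n - b"] by (simp add: algebra_simps)
  show ?thesis
    unfolding tendsto_iff_absval[of "\<lambda>n. f n + g n"]
    by (rule tendsto_sandwich[OF always_eventually always_eventually tendsto_const lim])
      (simp_all only: le zero_le_dist simp_thms)
qed

lemma tendsto_absval: "(f \<longlongrightarrow> (a::'a)) F \<Longrightarrow> ((\<lambda>n. absval (f n)) \<longlongrightarrow> absval a) F"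
  by (intro tendsto_intros)

lemma tendsto_mult_ultra:
  assumes "(f \<longlongrightarrow> (a::'a)) F" "(g \<longlongrightarrow> b) F"
  shows "((\<lambda>n. f n * g n) \<longlongrightarrow> a * b) F"
proof -
  have 1: "((\<lambda>n. absval (f n) * absval (g n - b)) \<longlongrightarrow> absval a * 0) F"
    using assms(1) assms(2)[unfolded tendsto_iff_absval] by (intro tendsto_mult tendsto_absval)
  have 2: "((\<lambda>n. absval (f n - a) * absval b) \<longlongrightarrow> 0 * absval b) F"
    using assms(1)[unfolded tendsto_iff_absval] by (intro tendsto_mult tendsto_const)
  have 3: "((\<lambda>n. f n * (g n - b)) \<longlongrightarrow> 0) F" "((\<lambda>n. (f n - a) * b) \<longlongrightarrow> 0) F"
    using 1 2 by (simp_all add: tendsto_iff_absval[of _ 0] absval_mult)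
  have "((\<lambda>n. f n * (g n - b) + (f n - a) * b + a * b) \<longlongrightarrow> 0 + 0 + a * b) F"
    by (intro tendsto_add_ultra 3 tendsto_const)
  then show ?thesis by (simp add: algebra_simps)
qed

lemma Cauchy_absval_iff:
  "Cauchy (f :: nat \<Rightarrow> 'a) \<longleftrightarrow> (\<forall>e>0. \<exists>M. \<forall>m\<ge>M. \<forall>n\<ge>M. absval (f m - f n) < e)"
  by (simp only: Cauchy_def dist_absval[of "f _" "f _"])

text \<open>In an ultrametric, terms tending to 0 suffice, as a block of the series is no larger
  than its largest term. The limit is sought in \<open>V\<close> because the whole field is not
  assumed complete.\<close>

lemma summable_in_complete:
  fixes f :: "nat \<Rightarrow> 'a"
  assumes "complete V" "0 \<in> V" "\<And>x y. x \<in> V \<Longrightarrow> y \<in> V \<Longrightarrow> x + y \<in> V" "\<And>n. f n \<in> V"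
    "f \<longlonglongrightarrow> 0"
  shows "\<exists>s\<in>V. f sums s"
proof -
  have mem: "sum f {..<n} \<in> V" for n
    by (induction n) (auto simp: assms)
  have "Cauchy (\<lambda>n. sum f {..<n})"
    unfolding Cauchy_absval_iff
  proof (intro allI impI)
    fix e :: real assume "e > 0"
    then obtain M where M: "\<And>n. n \<ge> M \<Longrightarrow> absval (f n) < e"
      using assms(5) by (auto simp: lim_sequentially)
    have *: "absval (sum f {..<m} - sum f {..<n}) < e" if "n \<ge> M" "n \<le> m" for m n
    proof -
      have "sum f {..<m} - sum f {..<n} = sum f {n..<m}"
        using that by (simp add: lessThan_atLeast0 sum_diff_nat_ivl)
      then show ?thesis
        using M \<open>e > 0\<close> that by (auto intro!: absval_sum_less)
    qed
    show "\<exists>M. \<forall>m\<ge>M. \<forall>n\<ge>M. absval (sum f {..<m} - sum f {..<n}) < e"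
    proof (intro exI allI impI)
      fix m n assume "m \<ge> M" "n \<ge> M"
      then show "absval (sum f {..<m} - sum f {..<n}) < e"
        using *[of n m] *[of m n] absval_diff_commute[of "sum f {..<m}"] by (cases "n \<le> m") auto
    qed
  qed
  then show ?thesis
    using assms(1)[unfolded complete_def, rule_format, of "\<lambda>n. sum f {..<n}"] mem
    unfolding sums_def by blast
qed

end

section \<open>Subfields and finite-dimensional subspaces\<close>

lemma ambient_field: "Ring.field (ambient :: 'a::Fields.field ring)"
  by (rule field_from_type_algebra)

interpretation amb: Ring.cring "ambient :: 'a::Fields.field ring"
  by (rule cring_from_type_algebra)

lemma ambient_simps [simp]:
  "carrier ambient = (UNIV :: 'a::Fields.field set)"
  "x \<otimes>\<^bsub>ambient\<^esub> y = x * (y::'a)"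
  "x \<oplus>\<^bsub>ambient\<^esub> y = x + (y::'a)"
  "\<one>\<^bsub>ambient\<^esub> = (1::'a)"
  "\<zero>\<^bsub>ambient\<^esub> = (0::'a)"
  by (simp_all add: ring_of_type_algebra_def)

lemma ambient_a_inv [simp]: "\<ominus>\<^bsub>ambient\<^esub> x = - (x::'a::Fields.field)"
  using amb.minus_equality[of "- x" x] by simp

lemma ambient_m_inv [simp]: "x \<noteq> 0 \<Longrightarrow> inv\<^bsub>ambient\<^esub> x = inverse (x::'a::Fields.field)"
  using amb.comm_inv_char[of x "inverse x"] by simp

lemma subfield_ambientI:
  fixes F :: "'a::Fields.field set"
  assumes "1 \<in> F" "\<And>x y. x \<in> F \<Longrightarrow> y \<in> F \<Longrightarrow> x + y \<in> F" "\<And>x. x \<in> F \<Longrightarrow> - x \<in> F"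
    "\<And>x y. x \<in> F \<Longrightarrow> y \<in> F \<Longrightarrow> x * y \<in> F" "\<And>x. x \<in> F \<Longrightarrow> x \<noteq> 0 \<Longrightarrow> inverse x \<in> F"
  shows "subfield F ambient"
proof (rule field.subfieldI'[OF ambient_field])
  show "subring F ambient"
    by (rule amb.subringI) (use assms in auto)
qed (use assms in auto)

context
  fixes F :: "'a::Fields.field set"
  assumes F: "subfield F ambient"
begin

lemma subfield_0: "0 \<in> F" and subfield_1: "1 \<in> F"
  using subringE(2,3)[OF subfieldE(1)[OF F]] by simp_all

lemma subfield_add: "x \<in> F \<Longrightarrow> y \<in> F \<Longrightarrow> x + y \<in> F"
  and subfield_mult: "x \<in> F \<Longrightarrow> y \<in> F \<Longrightarrow> x * y \<in> F"
  and subfield_minus: "x \<in> F \<Longrightarrow> - x \<in> F"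
  using subringE(5,6,7)[OF subfieldE(1)[OF F]] by simp_all

lemma subfield_diff: "x \<in> F \<Longrightarrow> y \<in> F \<Longrightarrow> x - y \<in> F"
  using subfield_add[of x "- y"] subfield_minus by simp

lemma subfield_inverse: "x \<in> F \<Longrightarrow> inverse x \<in> F"
  using amb.subfield_m_inv(1)[OF F, of x] by (cases "x = 0") (simp_all add: subfield_0)

lemma subfield_divide: "x \<in> F \<Longrightarrow> y \<in> F \<Longrightarrow> x / y \<in> F"
  by (simp add: divide_inverse subfield_mult subfield_inverse)

lemma subfield_power: "x \<in> F \<Longrightarrow> x ^ n \<in> F"
  by (induction n) (simp_all add: subfield_1 subfield_mult)

lemma subfield_sum: "(\<And>i. i \<in> A \<Longrightarrow> f i \<in> F) \<Longrightarrow> sum f A \<in> F"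
  by (induction A rule: infinite_finite_induct) (simp_all add: subfield_0 subfield_add)

lemma subfield_of_nat: "of_nat n \<in> F"
  by (induction n) (simp_all add: subfield_0 subfield_1 subfield_add)

lemmas subfield_closed = subfield_0 subfield_1 subfield_add subfield_mult subfield_minus
  subfield_diff subfield_inverse subfield_divide subfield_power subfield_sum subfield_of_nat

end

lemma adjoin_subfield: "subfield (adjoin F x) ambient"
  unfolding adjoin_def by (rule field.generate_field_is_subfield[OF ambient_field]) simp

lemma adjoin_generator: "x \<in> adjoin F x"
  and adjoin_base: "F \<subseteq> adjoin F x"
  unfolding adjoin_def by (auto intro: generate_field.incl)

lemma adjoin_minimal: "subfield E ambient \<Longrightarrow> F \<subseteq> E \<Longrightarrow> x \<in> E \<Longrightarrow> adjoin F x \<subseteq> E"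
  unfolding adjoin_def by (rule field.generate_field_min_subfield1[OF ambient_field]) auto

lemma line_extension_ambient:
  "amb.line_extension K a E = {k * a + v | k v. k \<in> K \<and> v \<in> E}"
  unfolding set_eq_iff mem_Collect_eq amb.line_extension_mem_iff by (simp, blast)

text \<open>The inductive definition treats the base field as an index; this rule holds it
  fixed.\<close>

lemma dimension_induct [consumes 1, case_names zero Suc]:
  assumes "has_degree V F n"
    and "P 0 {0}"
    and "\<And>n E v. has_degree E F n \<Longrightarrow> P n E \<Longrightarrow> v \<notin> E \<Longrightarrow> P (Suc n) (amb.line_extension F v E)"
  shows "P n (V :: 'a::Fields.field set)"
proof -
  have "F = F' \<Longrightarrow> P n V" if "has_degree V F' n" for F'
    using that
  proof (induction rule: amb.dimension.induct)
    case (zero_dim K)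
    then show ?case using assms(2) by simp
  next
    case (Suc_dim v E n K)
    then show ?case using assms(3)[of n E v] by simp
  qed
  then show ?thesis using assms(1) by blast
qed

text \<open>Multiplication by \<open>y\<close> carries a flag over \<open>F\<close> to a flag.
  Together with \<open>dimension_subset_eq\<close> this provides the inverses in
  \<open>subfield_E\<close>.\<close>

lemma dimension_scale:
  fixes V :: "'a::Fields.field set"
  assumes "has_degree V F n" "y \<noteq> 0"
  shows "has_degree ((*) y ` V) F n"
  using assms(1)
proof (induction rule: dimension_induct)
  case zero
  then show ?case using amb.zero_dim[of F] by simp
next
  case (Suc n E v)
  have "y * v \<notin> (*) y ` E"
    using Suc.hyps(2) assms(2) by auto
  then have "has_degree (amb.line_extension F (y * v) ((*) y ` E)) F (Suc n)"
    using Suc by (intro amb.Suc_dim) auto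
  also have "amb.line_extension F (y * v) ((*) y ` E) = (*) y ` amb.line_extension F v E"
    unfolding line_extension_ambient
  proof (intro equalityI subsetI)
    fix z assume "z \<in> {k * (y * v) + w |k w. k \<in> F \<and> w \<in> (*) y ` E}"
    then obtain k w where "z = k * (y * v) + y * w" "k \<in> F" "w \<in> E" by auto
    then show "z \<in> (*) y ` {k * v + w |k w. k \<in> F \<and> w \<in> E}"
      by (intro image_eqI[of _ _ "k * v + w"]) (auto simp: algebra_simps)
  next
    fix z assume "z \<in> (*) y ` {k * v + w |k w. k \<in> F \<and> w \<in> E}"
    then obtain k w where "z = y * (k * v + w)" "k \<in> F" "w \<in> E" by auto
    then have "z = k * (y * v) + y * w" "k \<in> F" "y * w \<in> (*) y ` E"
      by (auto simp: algebra_simps)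
    then show "z \<in> {k * (y * v) + w |k w. k \<in> F \<and> w \<in> (*) y ` E}"
      by blast
  qed
  finally show ?case .
qed

lemma dimension_subset_eq:
  fixes V :: "'a::Fields.field set"
  assumes F: "subfield F ambient" and V: "has_degree V F n" and W: "has_degree W F n" "V \<subseteq> W"
  shows "V = W"
proof -
  obtain Vs :: "'a list" where Vs: "amb.independent F Vs" "length Vs = n" "amb.Span F Vs = V"
    using amb.exists_base[OF F V] by blast
  have "set Vs \<subseteq> V"
    using amb.Span_base_incl[OF F, of Vs] Vs(3) by simp
  then show ?thesis
    using amb.independent_length_eq_dimension[OF F W(1) Vs(1)] Vs W(2) by auto
qed

lemma dimension_closed:
  fixes V :: "'a::Fields.field set"
  assumes F: "subfield F ambient" and V: "has_degree V F n"
  shows "0 \<in> V" "x \<in> V \<Longrightarrow> y \<in> V \<Longrightarrow> x + y \<in> V" "x \<in> V \<Longrightarrow> - x \<in> V"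
    "k \<in> F \<Longrightarrow> x \<in> V \<Longrightarrow> k * x \<in> V" "x \<in> V \<Longrightarrow> y \<in> V \<Longrightarrow> x - y \<in> V"
  using amb.space_subgroup_props(2-5)[OF F V, simplified] by (auto simp: diff_conv_add_uminus simp del: add_uminus_conv_diff)

context ultrametric_field
begin

text \<open>A vector outside the complete space \<open>E\<close> has positive distance from it,
  which bounds the new coordinate by the size of the whole vector; so both components of a Cauchy
  sequence are Cauchy.\<close>

lemma complete_of_dimension:
  assumes F: "subfield F (ambient :: 'a ring)" "complete F" and V: "has_degree V F n"
  shows "complete V"
  using V
proof (induction rule: dimension_induct)
  case zero
  then show ?case by (simp add: compact_imp_complete)
next
  case (Suc n E x)
  note E = dimension_closed[OF F(1) Suc.hyps(1)]
  have "open (- E)"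
    using Suc.IH complete_imp_closed by blast
  then obtain \<delta> where \<delta>: "\<delta> > 0" "ball x \<delta> \<subseteq> - E"
    using Suc.hyps(2) open_contains_ball by (metis ComplI)
  \<comment> \<open>Division by \<open>k\<close> turns the vector into \<open>x\<close> minus an
    element of \<open>E\<close>, whose size is at least \<open>\<delta>\<close>.\<close>
  have ge: "\<delta> * absval k \<le> absval (k * x + w)" if "k \<in> F" "w \<in> E" for k w
  proof (cases "k = 0")
    case False
    have "(- inverse k) * w \<in> E"
      using that E(4)[of "- inverse k" w] subfield_minus[OF F(1)] subfield_inverse[OF F(1)] by blast
    then have "(- inverse k) * w \<notin> ball x \<delta>"
      using \<delta>(2) by auto
    then have "\<delta> \<le> absval (x - (- inverse k) * w)"
      unfolding mem_ball not_less dist_absval[of x] .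
    then have "absval k * \<delta> \<le> absval k * absval (x - (- inverse k) * w)"
      by (simp add: mult_left_mono)
    also have "\<dots> = absval (k * x + w)"
      using False by (simp add: absval_mult[symmetric] distrib_left mult.assoc[symmetric])
    finally show ?thesis by (simp add: mult.commute)
  qed simp
  show ?case
    unfolding complete_def
  proof (intro allI impI, elim conjE)
    fix z :: "nat \<Rightarrow> 'a" assume "\<forall>n. z n \<in> amb.line_extension F x E" and z: "Cauchy z"
    then have "\<forall>n. \<exists>k w. k \<in> F \<and> w \<in> E \<and> z n = k * x + w"
      by (auto simp: line_extension_ambient)
    then obtain k w where kw: "\<And>n. k n \<in> F" "\<And>n. w n \<in> E" "\<And>n. z n = k n * x + w n"
      by metis
    have "Cauchy k"
      unfolding Cauchy_absval_iff
    proof (intro allI impI)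
      fix e :: real assume "e > 0"
      then have "\<delta> * e > 0" using \<delta>(1) by simp
      then obtain M where M: "\<And>m n. m \<ge> M \<Longrightarrow> n \<ge> M \<Longrightarrow> absval (z m - z n) < \<delta> * e"
        using z unfolding Cauchy_absval_iff by blast
      have "absval (k m - k n) < e" if "m \<ge> M" "n \<ge> M" for m n
      proof -
        have "\<delta> * absval (k m - k n) \<le> absval ((k m - k n) * x + (w m - w n))"
          by (intro ge subfield_diff[OF F(1)] E kw)
        also have "\<dots> = absval (z m - z n)"
          by (simp add: kw(3) algebra_simps)
        also have "\<dots> < \<delta> * e" using M that by simp
        finally show ?thesis using \<delta>(1) by simp
      qed
      then show "\<exists>M. \<forall>m\<ge>M. \<forall>n\<ge>M. absval (k m - k n) < e" by blast
    qed
    then obtain l where l: "l \<in> F" "k \<longlonglongrightarrow> l"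
      using F(2) kw(1) unfolding complete_def by blast
    have "Cauchy (\<lambda>n. k n * x)"
      using tendsto_mult_ultra[OF l(2) tendsto_const] by (rule LIMSEQ_imp_Cauchy)
    have "Cauchy w"
      unfolding Cauchy_absval_iff
    proof (intro allI impI)
      fix e :: real assume "e > 0"
      obtain M where M: "\<And>m n. m \<ge> M \<Longrightarrow> n \<ge> M \<Longrightarrow> absval (z m - z n) < e"
        using z \<open>e > 0\<close> unfolding Cauchy_absval_iff by blast
      obtain N where N: "\<And>m n. m \<ge> N \<Longrightarrow> n \<ge> N \<Longrightarrow> absval (k m * x - k n * x) < e"
        using \<open>Cauchy (\<lambda>n. k n * x)\<close>[unfolded Cauchy_absval_iff, rule_format, OF \<open>e > 0\<close>] by blast
      have "absval (w m - w n) < e" if "m \<ge> max M N" "n \<ge> max M N" for m n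
      proof -
        have "w m - w n = (z m - z n) - (k m * x - k n * x)" by (simp add: kw(3))
        then show ?thesis using M[of m n] N[of m n] that by (simp add: absval_diff_lessI)
      qed
      then show "\<exists>M. \<forall>m\<ge>M. \<forall>n\<ge>M. absval (w m - w n) < e" by blast
    qed
    then obtain w' where w': "w' \<in> E" "w \<longlonglongrightarrow> w'"
      using Suc.IH kw(2) unfolding complete_def by blast
    have "z \<longlonglongrightarrow> l * x + w'"
      unfolding ext[of z "\<lambda>n. k n * x + w n", OF kw(3)]
      by (rule tendsto_add_ultra[OF tendsto_mult_ultra[OF l(2) tendsto_const] w'(2)])
    moreover have "l * x + w' \<in> amb.line_extension F x E"
      using l(1) w'(1) unfolding line_extension_ambient by auto
    ultimately show "\<exists>l\<in>amb.line_extension F x E. z \<longlonglongrightarrow> l" ..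
  qed
qed

end

section \<open>Roots of unity in unramified fields\<close>

locale padic_closed_field = ultrametric_field type
  for type :: "'a::{alg_closed_field, field_char_0, metric_space} itself" +
  fixes p :: nat
  assumes prime_p: "Factorial_Ring.prime p" and odd_p: "odd p"
    and absval_p: "absval (of_nat p :: 'a) = 1 / real p"
    and complete_Qp: "complete (Qp :: 'a set)"
begin

lemma p_ge_3: "3 \<le> p"
  using prime_p odd_p prime_ge_2_nat[of p] by (cases "p = 2") auto

lemma p_gt_1: "1 < p" and p_pos: "0 < p" and real_p_gt_1: "1 < real p"
  using p_ge_3 by simp_all

text \<open>Bezout: in a n + b p = 1 the second summand is smaller than 1, so the first cannot
  be.\<close>

lemma absval_of_int_eq_1:
  assumes "\<not> int p dvd n"
  shows "absval (of_int n :: 'a) = 1"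
proof -
  have "coprime (int p) n"
    using assms prime_p by (intro prime_imp_coprime) auto
  then obtain a b where ab: "a * n + b * int p = 1"
    by (metis coprime_commute coprime_iff_gcd_eq_1 bezout_int)
  have "absval (of_int b * of_nat p :: 'a) < 1"
    using absval_of_int_le_1[of b] real_p_gt_1
    by (simp add: absval_mult absval_p divide_simps)
  moreover have "(1::'a) = of_int a * of_int n + of_int b * of_nat p"
    using arg_cong[OF ab, of "of_int :: int \<Rightarrow> 'a"] by simp
  ultimately have "\<not> absval (of_int a * of_int n :: 'a) < 1"
    using absval_add_lessI by fastforce
  then have "1 \<le> absval (of_int a :: 'a) * absval (of_int n :: 'a)"
    by (simp add: absval_mult)
  also have "\<dots> \<le> 1 * absval (of_int n :: 'a)"
    by (intro mult_right_mono absval_of_int_le_1) simp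
  finally show ?thesis
    using absval_of_int_le_1[of n] by simp
qed

lemma absval_of_int_less_1_iff: "absval (of_int n :: 'a) < 1 \<longleftrightarrow> int p dvd n"
proof
  assume "int p dvd n"
  then obtain m where "n = int p * m" ..
  then show "absval (of_int n :: 'a) < 1"
    using absval_of_int_le_1[of m] real_p_gt_1
    by (simp add: absval_mult absval_p divide_simps)
qed (use absval_of_int_eq_1 in fastforce)

lemma absval_of_nat_dvd_le:
  assumes "p dvd n"
  shows "absval (of_nat n :: 'a) \<le> 1 / real p"
proof -
  obtain m where "n = p * m" using assms ..
  then show ?thesis
    using absval_of_nat_le_1[of m] real_p_gt_1
    by (simp add: absval_mult absval_p divide_simps)
qed

lemma absval_of_nat_less_p_eq_1: "0 < n \<Longrightarrow> n < p \<Longrightarrow> absval (of_nat n :: 'a) = 1"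
  using absval_of_int_eq_1[of "int n"] nat_dvd_not_less[of n p] by simp

lemma absval_p_powi: "absval (of_nat p powi k :: 'a) = real p powi (- k)"
  by (cases k rule: int_cases2)
    (simp_all add: power_int_minus absval_p power_one_over absval_divide divide_inverse power_inverse)

lemma rat_absval:
  assumes "r \<in> \<rat>" "r \<noteq> 0"
  shows "\<exists>k::int. absval (r::'a) = real p powi k"
proof -
  have int: "\<exists>k::int. absval (of_int a :: 'a) = real p powi k" if "a \<noteq> 0" for a
  proof -
    obtain m b where mb: "a = int p ^ m * b" "\<not> int p dvd b"
      by (rule multiplicity_decompose'[of a "int p"]) (use \<open>a \<noteq> 0\<close> p_gt_1 in auto)
    then have "absval (of_int a :: 'a) = (1 / real p) ^ m"
      by (simp add: absval_mult absval_p absval_of_int_eq_1)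
    also have "\<dots> = real p powi (- int m)"
      by (simp add: power_int_minus power_one_over field_simps)
    finally show ?thesis ..
  qed
  obtain a b where ab: "b > 0" "r = of_int a / of_int b"
    using assms(1) by (cases rule: Rats_cases') auto
  then have "a \<noteq> 0" using assms(2) by auto
  then obtain k l where "absval (of_int a :: 'a) = real p powi k" "absval (of_int b :: 'a) = real p powi l"
    using int[of a] int[of b] ab(1) by auto
  then have "absval r = real p powi (k - l)"
    using p_pos by (simp add: ab(2) absval_divide power_int_diff)
  then show ?thesis ..
qed

lemma Qp_approx:
  assumes "x \<in> Qp" "e > 0"
  obtains r where "r \<in> \<rat>" "absval (x - r :: 'a) < e"
proof -
  obtain r where "r \<in> \<rat>" "dist r x < e"
    using assms by (auto simp: Qp_def closure_approachable)
  then show ?thesis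
    using that[of r] by (metis dist_absval dist_commute)
qed

text \<open>A rational closer to \<open>x\<close> than the size of \<open>x\<close> has the same
  absolute value, so the closure adds no new values.\<close>

lemma Qp_absval:
  assumes "x \<in> Qp" "x \<noteq> 0"
  shows "\<exists>k::int. absval (x::'a) = real p powi k"
proof -
  obtain r where r: "r \<in> \<rat>" "absval (x - r) < absval x"
    using Qp_approx[OF assms(1), of "absval x"] assms(2) by auto
  then have "absval r = absval x"
    by (intro absval_eq_of_near) (simp add: absval_diff_commute)
  then show ?thesis
    using rat_absval[OF r(1)] assms(2) by (metis dist_eq_0_iff)
qed

lemma subfield_Qp: "subfield (Qp :: 'a set) ambient"
proof (rule subfield_ambientI)
  have inc: "r \<in> Qp" if "r \<in> \<rat>" for r :: 'a
    using that closure_subset unfolding Qp_def by blast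
  have seq: "\<exists>f. (\<forall>n. f n \<in> \<rat>) \<and> f \<longlonglongrightarrow> x" if "x \<in> Qp" for x :: 'a
    using that unfolding Qp_def closure_sequential .
  have seqI: "x \<in> Qp" if "\<And>n. f n \<in> \<rat>" "f \<longlonglongrightarrow> x" for x :: 'a and f
    using that unfolding Qp_def closure_sequential by blast
  show "(1::'a) \<in> Qp" by (rule inc) simp
  fix x :: 'a assume x: "x \<in> Qp"
  obtain f where f: "\<And>n. f n \<in> \<rat>" "f \<longlonglongrightarrow> x" using seq[OF x] by blast
  have "(\<lambda>n. (- 1) * f n) \<longlonglongrightarrow> (- 1) * x"
    by (rule tendsto_mult_ultra[OF tendsto_const f(2)])
  then show "- x \<in> Qp"
    using f(1) by (intro seqI[of "\<lambda>n. (- 1) * f n"]) auto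
  {
    fix y :: 'a assume y: "y \<in> Qp"
    obtain g where g: "\<And>n. g n \<in> \<rat>" "g \<longlonglongrightarrow> y" using seq[OF y] by blast
    show "x + y \<in> Qp"
      using f(1) g(1) tendsto_add_ultra[OF f(2) g(2)] by (intro seqI[of "\<lambda>n. f n + g n"]) auto
    show "x * y \<in> Qp"
      using f(1) g(1) tendsto_mult_ultra[OF f(2) g(2)] by (intro seqI[of "\<lambda>n. f n * g n"]) auto
  }
  assume x0: "x \<noteq> 0"
  show "inverse x \<in> Qp"
    unfolding Qp_def closure_approachable
  proof (intro allI impI)
    fix e :: real assume e: "e > 0"
    \<comment> \<open>The first bound gives \<open>r\<close> the size of \<open>x\<close>; the
      second absorbs the denominator \<open>r * x\<close> of the difference of the inverses.\<close>
    obtain r where r: "r \<in> \<rat>" "absval (x - r) < min (absval x) (e * absval x * absval x)"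
      using Qp_approx[OF x, of "min (absval x) (e * absval x * absval x)"] e x0 by auto
    then have rx: "absval r = absval x"
      by (intro absval_eq_of_near) (simp add: absval_diff_commute)
    then have r0: "r \<noteq> 0" using x0 by auto
    have "inverse r - inverse x = (x - r) / (r * x)"
      using r0 x0 by (simp add: field_simps)
    then have "absval (inverse r - inverse x) = absval (x - r) / (absval x * absval x)"
      by (simp add: absval_divide absval_mult rx)
    also have "\<dots> < e"
      using r(2) x0 by (simp add: divide_simps mult.assoc)
    finally show "\<exists>y\<in>\<rat>. dist y (inverse x) < e"
      using r(1) by (intro bexI[of _ "inverse r"]) (simp_all only: dist_absval[of "inverse r"] Rats_inverse)
  qed
qed

text \<open>The residue field is the prime field: a rational approximation in lowest terms has
  denominator prime to \<open>p\<close>, and \<open>k\<close> is the numerator times the inverse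
  denominator modulo \<open>p\<close>.\<close>

lemma Qp_residue:
  assumes "x \<in> Qp" "absval (x::'a) \<le> 1"
  shows "\<exists>k<p. absval (x - of_nat k) < 1"
proof -
  obtain r where r: "r \<in> \<rat>" "absval (x - r) < 1"
    using Qp_approx[OF assms(1), of 1] by auto
  have r1: "absval r \<le> 1"
    using absval_diff_leI[OF assms(2), of "x - r"] r(2) by simp
  obtain a b where ab: "b > 0" "coprime a b" "r = of_int a / of_int b"
    using r(1) by (cases rule: Rats_cases') auto
  have "\<not> int p dvd b"
  proof
    assume b: "int p dvd b"
    then have "\<not> int p dvd a"
      using ab(2) prime_p by (meson coprime_common_divisor not_prime_unit prime_nat_int_transfer)
    then have "absval r = 1 / absval (of_int b :: 'a)"
      by (simp add: ab(3) absval_divide absval_of_int_eq_1)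
    moreover have "absval (of_int b :: 'a) < 1" "0 < absval (of_int b :: 'a)"
      using b ab(1) absval_of_int_less_1_iff by simp_all
    then have "1 < 1 / absval (of_int b :: 'a)"
      by (simp add: less_divide_eq_1)
    ultimately show False using r1 by simp
  qed
  then have "coprime b (int p)"
    using prime_p by (metis coprime_commute prime_imp_coprime prime_nat_int_transfer)
  then obtain c where c: "[b * c = 1] (mod int p)"
    using cong_solve_coprime_int by blast
  define k where "k = nat ((a * c) mod int p)"
  have k: "int k = (a * c) mod int p" "k < p"
    using p_pos by (simp_all add: k_def nat_less_iff)
  have "[b * int k = b * (a * c)] (mod int p)"
    by (simp add: k(1) cong_def mod_mult_right_eq)
  also have "[b * (a * c) = a] (mod int p)"
    using cong_scalar_left[OF c, of a] by (simp add: ac_simps)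
  finally have "int p dvd (a - b * int k)"
    by (simp add: cong_iff_dvd_diff dvd_diff_commute)
  then have "absval (of_int (a - b * int k) :: 'a) < 1"
    by (simp only: absval_of_int_less_1_iff)
  moreover have "r - of_nat k = of_int (a - b * int k) / of_int b"
    using ab(1) by (simp add: ab(3) field_simps)
  ultimately have "absval (r - of_nat k) < 1"
    using absval_of_int_eq_1[OF \<open>\<not> int p dvd b\<close>] by (simp only: absval_divide)
  then show ?thesis
    using absval_diff_trans_less[OF r(2)] k(2) by blast
qed

text \<open>Gram--Schmidt step: as the distances are discrete, one of them is minimal.\<close>

lemma best_approximation:
  assumes "complete E" "E \<noteq> {}" "x \<notin> E"
    and vals: "\<And>w. w \<in> E \<Longrightarrow> \<exists>k::int. absval (x - w :: 'a) = real p powi k"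
  shows "\<exists>w\<^sub>0\<in>E. \<forall>w\<in>E. absval (x - w\<^sub>0) \<le> absval (x - w)"
proof -
  define I where "I = infdist x E"
  have I: "I > 0"
    unfolding I_def using assms complete_imp_closed by (intro infdist_pos_not_in_closed) auto
  \<comment> \<open>A point within the factor \<open>p\<close> of the infimum is already optimal: a
    smaller distance would be smaller by at least that factor and fall below the infimum.\<close>
  have "(INF w\<in>E. dist x w) < real p * I"
    using I real_p_gt_1 assms(2) by (simp add: I_def infdist_notempty)
  then obtain w\<^sub>0 where w\<^sub>0: "w\<^sub>0 \<in> E" "dist x w\<^sub>0 < real p * I"
    using assms(2) by (auto simp: cInf_less_iff)
  have "absval (x - w\<^sub>0) \<le> absval (x - w)" if w: "w \<in> E" for w
  proof (rule ccontr)
    assume "\<not> ?thesis"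
    moreover obtain k l where kl: "absval (x - w\<^sub>0) = real p powi k" "absval (x - w) = real p powi l"
      using vals w w\<^sub>0(1) by meson
    ultimately have "l < k"
      using real_p_gt_1 power_int_increasing[of k l "real p"] by (force simp: not_le)
    then have "real p powi (l + 1) \<le> real p powi k"
      using real_p_gt_1 by (intro power_int_increasing) auto
    then have "absval (x - w) * real p \<le> absval (x - w\<^sub>0)"
      using p_pos by (simp add: kl power_int_add)
    moreover have "I \<le> absval (x - w)"
      using infdist_le[OF w, of x] by (simp add: I_def dist_absval[of x])
    then have "I * real p \<le> absval (x - w) * real p"
      by (intro mult_right_mono) auto
    ultimately show False
      using w\<^sub>0(2) by (simp add: dist_absval[of x] mult.commute)
  qed
  then show ?thesis using w\<^sub>0(1) by blast
qed

text \<open>Representatives of the closed unit ball of \<open>V\<close> modulo the open one. For a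
  field this is the residue field; allowing subspaces makes induction on the dimension
  possible.\<close>

definition residue_system :: "'a set \<Rightarrow> 'a set \<Rightarrow> bool" where
  "residue_system V S \<longleftrightarrow> S \<subseteq> V \<and> finite S \<and> (\<forall>s\<in>S. absval s \<le> 1) \<and>
    (\<forall>s\<in>S. \<forall>t\<in>S. s \<noteq> t \<longrightarrow> 1 \<le> absval (s - t)) \<and>
    (\<forall>x\<in>V. absval x \<le> 1 \<longrightarrow> (\<exists>s\<in>S. absval (x - s) < 1))"

text \<open>Each dimension contributes a factor \<open>p\<close>. As all values are powers of
  \<open>p\<close>, the part of the new vector orthogonal to \<open>E\<close> can be scaled to size
  1 by a scalar from \<open>Qp\<close>; its coefficient and the remainder then have independent
  residues.\<close>

lemma residue_system_exists:
  assumes "has_degree V Qp n" "\<And>x. x \<in> V \<Longrightarrow> x \<noteq> 0 \<Longrightarrow> \<exists>k::int. absval (x::'a) = real p powi k"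
  shows "\<exists>S. residue_system V S \<and> card S = p ^ n"
  using assms
proof (induction rule: dimension_induct)
  case zero
  show ?case by (intro exI[of _ "{0}"]) (auto simp: residue_system_def)
next
  case (Suc n E x)
  note E = dimension_closed[OF subfield_Qp Suc.hyps(1)]
  define V where "V = amb.line_extension Qp x E"
  have memV: "z \<in> V \<longleftrightarrow> (\<exists>c\<in>Qp. \<exists>w\<in>E. z = c * x + w)" for z
    unfolding V_def line_extension_ambient by blast
  have EV: "w \<in> V" if "w \<in> E" for w
    unfolding memV using that subfield_0[OF subfield_Qp] by (metis add_0 mult_zero_left)
  obtain S where "residue_system E S" and card_S: "card S = p ^ n"
    using Suc.IH Suc.prems EV unfolding V_def by blast
  then have S: "S \<subseteq> E" "finite S" "\<And>s. s \<in> S \<Longrightarrow> absval s \<le> 1"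
      "\<And>s t. s \<in> S \<Longrightarrow> t \<in> S \<Longrightarrow> s \<noteq> t \<Longrightarrow> 1 \<le> absval (s - t)"
      "\<And>x. x \<in> E \<Longrightarrow> absval x \<le> 1 \<Longrightarrow> \<exists>s\<in>S. absval (x - s) < 1"
    by (simp_all add: residue_system_def)
  have xw: "x - w \<in> V" "x - w \<noteq> 0" if "w \<in> E" for w
  proof -
    have "x - w = 1 * x + (- w)" by simp
    then show "x - w \<in> V"
      unfolding memV using that E(3) subfield_1[OF subfield_Qp] by blast
    show "x - w \<noteq> 0" using that Suc.hyps(2) by auto
  qed
  have "complete E"
    by (rule complete_of_dimension[OF subfield_Qp complete_Qp Suc.hyps(1)])
  then obtain w\<^sub>0 where w\<^sub>0: "w\<^sub>0 \<in> E" "\<And>w. w \<in> E \<Longrightarrow> absval (x - w\<^sub>0) \<le> absval (x - w)"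
    using best_approximation[of E x] E(1) Suc.hyps(2) Suc.prems xw unfolding V_def by blast
  obtain k :: int where k: "absval (x - w\<^sub>0) = real p powi k"
    using Suc.prems xw[OF w\<^sub>0(1)] unfolding V_def by blast
  define \<pi> :: 'a where "\<pi> = of_nat p powi k"
  have \<pi>: "\<pi> \<noteq> 0" "absval \<pi> = inverse (real p powi k)" "\<pi> \<in> Qp"
  proof -
    show "\<pi> \<noteq> 0" using p_pos by (simp add: \<pi>_def)
    show "absval \<pi> = inverse (real p powi k)"
      unfolding \<pi>_def absval_p_powi by (simp add: power_int_minus)
    show "\<pi> \<in> Qp"
      unfolding \<pi>_def by (cases k rule: int_cases2)
        (auto simp: power_int_minus intro!: subfield_inverse[OF subfield_Qp]
          subfield_power[OF subfield_Qp] subfield_of_nat[OF subfield_Qp])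
  qed
  define e where "e = \<pi> * (x - w\<^sub>0)"
  have "real p powi k \<noteq> 0" using p_pos by simp
  then have e1: "absval e = 1"
    unfolding e_def absval_mult \<pi>(2) k by (rule left_inverse)
  \<comment> \<open>Orthogonality: \<open>c * e + w\<close> is a multiple of \<open>x\<close> minus
    some element of \<open>E\<close>, and no such difference is shorter than
    \<open>x - w\<^sub>0\<close>.\<close>
  have e_ge: "absval c \<le> absval (c * e + w)" if "c \<in> Qp" "w \<in> E" for c w
  proof (cases "c = 0")
    case False
    have "c * \<pi> \<in> Qp" by (rule subfield_mult[OF subfield_Qp that(1) \<pi>(3)])
    then have "inverse (c * \<pi>) * w \<in> E"
      using that(2) by (intro E(4) subfield_inverse[OF subfield_Qp])
    then have "w\<^sub>0 - inverse (c * \<pi>) * w \<in> E"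
      by (intro E(5) w\<^sub>0(1))
    then have "absval (x - w\<^sub>0) \<le> absval (x - (w\<^sub>0 - inverse (c * \<pi>) * w))"
      by (rule w\<^sub>0(2))
    then have "absval (c * \<pi>) * absval (x - w\<^sub>0) \<le> absval (c * \<pi>) * absval (x - (w\<^sub>0 - inverse (c * \<pi>) * w))"
      by (intro mult_left_mono) auto
    also have "\<dots> = absval ((c * \<pi>) * (x - w\<^sub>0) + (c * \<pi>) * (inverse (c * \<pi>) * w))"
      by (simp only: absval_mult[symmetric] diff_diff_eq2 right_diff_distrib distrib_left)
        (simp only: add_diff_eq diff_add_eq)
    also have "(c * \<pi>) * (inverse (c * \<pi>) * w) = w"
      unfolding mult.assoc[symmetric, of "c * \<pi>"]
      using False \<pi>(1) right_inverse[of "c * \<pi>"] by (simp only: mult_eq_0_iff) simp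
    also have "(c * \<pi>) * (x - w\<^sub>0) = c * e"
      by (simp add: e_def mult.assoc)
    also have "absval (c * \<pi>) * absval (x - w\<^sub>0) = absval c"
      using e1 by (simp add: e_def absval_mult mult.assoc)
    finally show ?thesis .
  qed simp
  define g where "g = (\<lambda>(i, s). of_nat i * e + s :: 'a)"
  have g_sep: "1 \<le> absval (g a - g b)" if mem: "a \<in> {..<p} \<times> S" "b \<in> {..<p} \<times> S" "a \<noteq> b" for a b
  proof -
    obtain i s j t where ab: "a = (i, s)" "b = (j, t)" "i < p" "j < p" "s \<in> S" "t \<in> S"
      using mem by (cases a, cases b) auto
    have eq: "g a - g b = (of_int (int i - int j)) * e + (s - t)"
      by (simp add: g_def ab algebra_simps)
    show ?thesis
    proof (cases "i = j")
      case True
      then have "1 \<le> absval (s - t)" using S(4) ab mem(3) by blast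
      then show ?thesis unfolding eq using True by simp
    next
      case False
      have "\<not> int p dvd (int i - int j)"
        using False ab(3,4) zdvd_not_zless[of "\<bar>int i - int j\<bar>" "int p"] by fastforce
      then have "1 = absval (of_int (int i - int j) :: 'a)"
        by (rule absval_of_int_eq_1[symmetric])
      also have "\<dots> \<le> absval (g a - g b)"
        unfolding eq
      proof (rule e_ge)
        show "of_int (int i - int j) \<in> (Qp :: 'a set)"
          using subfield_of_nat[OF subfield_Qp] subfield_diff[OF subfield_Qp] by simp
        show "s - t \<in> E"
          using ab(5,6) S(1) by (intro E(5)) blast+
      qed
      finally show ?thesis .
    qed
  qed
  have inj: "inj_on g ({..<p} \<times> S)"
  proof (rule inj_onI, rule ccontr)
    fix a b assume "a \<in> {..<p} \<times> S" "b \<in> {..<p} \<times> S" "g a = g b" "a \<noteq> b"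
    then show False using g_sep[of a b] by simp
  qed
  have gV: "c * e + w \<in> V" if "c \<in> Qp" "w \<in> E" for c w
  proof -
    have "c * e + w = (c * \<pi>) * x + (w - (c * \<pi>) * w\<^sub>0)"
      by (simp add: e_def algebra_simps)
    moreover have "c * \<pi> \<in> Qp" by (rule subfield_mult[OF subfield_Qp that(1) \<pi>(3)])
    moreover from this have "w - (c * \<pi>) * w\<^sub>0 \<in> E"
      by (intro E(5) E(4) that w\<^sub>0(1))
    ultimately show ?thesis unfolding memV by blast
  qed
  show ?case
    unfolding residue_system_def
  proof (intro exI[of _ "g ` ({..<p} \<times> S)"] conjI ballI impI)
    show "g ` ({..<p} \<times> S) \<subseteq> amb.line_extension Qp x E"
      unfolding V_def[symmetric] using S(1) gV subfield_of_nat[OF subfield_Qp] by (auto simp: g_def)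
    show "finite (g ` ({..<p} \<times> S))" using S(2) by simp
    show "card (g ` ({..<p} \<times> S)) = p ^ Suc n"
      using card_image[OF inj] card_S by (simp add: card_cartesian_product)
  next
    fix z assume "z \<in> g ` ({..<p} \<times> S)"
    then show "absval z \<le> 1"
      using S(3) by (auto simp: g_def absval_mult e1 absval_of_nat_le_1 intro!: absval_add_leI)
  next
    fix y z assume "y \<in> g ` ({..<p} \<times> S)" "z \<in> g ` ({..<p} \<times> S)" "y \<noteq> z"
    then show "1 \<le> absval (y - z)" using g_sep by fastforce
  next
    fix z assume "z \<in> amb.line_extension Qp x E" "absval z \<le> 1"
    then obtain c' w' where c': "c' \<in> Qp" "w' \<in> E" "z = c' * x + w'"
      using memV unfolding V_def by blast
    define c w where "c = c' / \<pi>" and "w = w' + c' * w\<^sub>0"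
    have cw: "c \<in> Qp" "w \<in> E" "z = c * e + w"
      using c' \<pi> w\<^sub>0(1) E subfield_divide[OF subfield_Qp]
      by (auto simp: c_def w_def e_def algebra_simps)
    have c1: "absval c \<le> 1"
      using e_ge[OF cw(1,2)] \<open>absval z \<le> 1\<close> cw(3) by simp
    have "absval (z - c * e) \<le> 1"
      using c1 \<open>absval z \<le> 1\<close> by (intro absval_diff_leI) (simp_all add: absval_mult e1)
    then have "absval w \<le> 1" by (simp add: cw(3))
    then obtain s where s: "s \<in> S" "absval (w - s) < 1" using S(5) cw(2) by blast
    obtain i where i: "i < p" "absval (c - of_nat i) < 1" using Qp_residue[OF cw(1) c1] by blast
    have "z - g (i, s) = (c - of_nat i) * e + (w - s)"
      by (simp add: cw(3) g_def algebra_simps)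
    then have "absval (z - g (i, s)) < 1"
      using s i by (simp add: absval_add_lessI absval_mult e1)
    then show "\<exists>s\<in>g ` ({..<p} \<times> S). absval (z - s) < 1"
      using s(1) i(1) by blast
  qed
qed

end

section \<open>The p-th power map and roots near a given point\<close>

lemma freshman_sum:
  fixes a b :: "'r::comm_ring_1"
  assumes "0 < n"
  shows "(a + b) ^ n - a ^ n - b ^ n = (\<Sum>k=1..<n. of_nat (n choose k) * a ^ k * b ^ (n - k))"
proof -
  have *: "{..n} = insert 0 (insert n {1..<n})"
    using assms by auto
  have "(a + b) ^ n = (\<Sum>k\<le>n. of_nat (n choose k) * a ^ k * b ^ (n - k))"
    by (rule binomial_ring)
  also have "\<dots> = b ^ n + (a ^ n + (\<Sum>k=1..<n. of_nat (n choose k) * a ^ k * b ^ (n - k)))"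
    using assms unfolding * by (subst sum.insert; simp)+
  finally show ?thesis by (simp add: algebra_simps)
qed

context padic_closed_field
begin

lemma absval_p_choose: "1 \<le> k \<Longrightarrow> k < p \<Longrightarrow> absval (of_nat (p choose k) :: 'a) \<le> 1 / real p"
  using prime_p by (intro absval_of_nat_dvd_le dvd_choose_prime) auto

text \<open>Each mixed term carries a binomial coefficient divisible by \<open>p\<close> and a
  factor \<open>h\<close>; its other p - 1 factors are at most as large as \<open>a\<close>.\<close>

lemma absval_freshman_le:
  assumes "absval h \<le> absval (a::'a)"
  shows "absval ((a + h) ^ p - a ^ p - h ^ p) \<le> absval a ^ (p - 1) * absval h / real p"
  unfolding freshman_sum[OF p_pos]
proof (rule absval_sum_le)
  fix k assume k: "k \<in> {1..<p}"
  have "absval h ^ (p - k) = absval h ^ (p - k - 1) * absval h"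
    using k by (metis atLeastLessThan_iff power_eq_if power_commutes zero_less_diff not_less0)
  also have "\<dots> \<le> absval a ^ (p - k - 1) * absval h"
    by (intro mult_right_mono power_mono assms) auto
  finally have "absval a ^ k * absval h ^ (p - k) \<le> absval a ^ k * (absval a ^ (p - k - 1) * absval h)"
    by (intro mult_left_mono) auto
  also have "\<dots> = absval a ^ (p - 1) * absval h"
    using k by (simp add: power_add[symmetric] mult.assoc[symmetric])
  finally have "absval (of_nat (p choose k) :: 'a) * (absval a ^ k * absval h ^ (p - k))
      \<le> (1 / real p) * (absval a ^ (p - 1) * absval h)"
    using k by (rule_tac mult_mono[OF absval_p_choose]) auto
  then show "absval (of_nat (p choose k) * a ^ k * h ^ (p - k)) \<le> absval a ^ (p - 1) * absval h / real p"
    by (simp add: absval_mult mult.assoc)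
qed simp

text \<open>The value at \<open>x\<close> is the product of the differences from the roots; if all
  of these had size at least 1, so would the product.\<close>

lemma near_root:
  assumes P: "Polynomial.coeff P (Polynomial.degree P) = 1" and x: "absval (poly P x :: 'a) < 1"
  shows "\<exists>\<xi>. poly P \<xi> = 0 \<and> absval (x - \<xi>) < 1"
proof (rule ccontr)
  assume neg: "\<not> ?thesis"
  obtain A where A: "P = Polynomial.smult (Polynomial.coeff P (Polynomial.degree P)) (\<Prod>x\<in>#A. [:-x, 1:])"
    using alg_closed_imp_factorization[of P] P by force
  have root: "poly P \<xi> = 0" if "\<xi> \<in># A" for \<xi>
    using that by (subst A) (auto simp: poly_prod_mset prod_mset_zero_iff)
  have "1 \<le> absval (\<Prod>\<xi>\<in>#B. x - \<xi>)" if "\<And>\<xi>. \<xi> \<in># B \<Longrightarrow> poly P \<xi> = 0" for B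
    using that
  proof (induction B)
    case (add b B)
    then have "1 \<le> absval (x - b)" using neg by force
    moreover have "1 \<le> absval (\<Prod>\<xi>\<in>#B. x - \<xi>)" using add by auto
    ultimately have "1 * 1 \<le> absval (x - b) * absval (\<Prod>\<xi>\<in>#B. x - \<xi>)"
      by (intro mult_mono) auto
    then show ?case by (simp add: absval_mult)
  qed simp
  from this[of A] root have "1 \<le> absval (\<Prod>\<xi>\<in>#A. x - \<xi>)" by blast
  also have "(\<Prod>\<xi>\<in>#A. x - \<xi>) = poly P x"
    using P by (subst A) (simp add: poly_prod_mset)
  finally show False using x by simp
qed

lemma near_root_of_unity:
  assumes "absval (x ^ n - 1 :: 'a) < 1" "0 < n"
  shows "\<exists>\<xi>. \<xi> ^ n = 1 \<and> absval (x - \<xi>) < 1"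
proof -
  have "Polynomial.degree (Polynomial.monom 1 n - 1 :: 'a poly) = n" "Polynomial.coeff (Polynomial.monom 1 n - 1 :: 'a poly) n = 1"
  proof -
    have "Polynomial.degree (Polynomial.monom 1 n + (- 1) :: 'a poly) = Polynomial.degree (Polynomial.monom 1 n :: 'a poly)"
      using assms(2) by (intro degree_add_eq_left) (simp add: degree_monom_eq)
    then show "Polynomial.degree (Polynomial.monom 1 n - 1 :: 'a poly) = n"
      by (simp add: degree_monom_eq)
    then show "Polynomial.coeff (Polynomial.monom 1 n - 1 :: 'a poly) n = 1"
      using assms(2) by simp
  qed
  then show ?thesis
    using near_root[of "Polynomial.monom 1 n - 1" x] assms(1) by (auto simp: poly_monom)
qed

lemma absval_root_of_unity:
  assumes "(x::'a) ^ n = 1" "0 < n"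
  shows "absval x = 1"
  using arg_cong[OF assms(1), of absval] assms(2) power_eq_imp_eq_base[of "absval x" n 1] by simp

text \<open>Lift a primitive root \<open>g\<close> modulo \<open>p\<close>: a relation
  \<open>\<eta> ^ k = 1\<close> reduces to one for \<open>g\<close>, so the order cannot
  drop.\<close>

lemma primitive_root_of_unity: "\<exists>\<eta>::'a. \<eta> ^ (p - 1) = 1 \<and> (\<forall>k. \<eta> ^ k = 1 \<longrightarrow> (p - 1) dvd k)"
proof -
  obtain g where g: "residue_primroot p g"
    using residue_primroot_odd_prime_power_exists[OF prime_p odd_p]
    by (metis le_numeral_extra(4) power_one_right zero_less_one)
  have ord: "ord p g = p - 1" "coprime p g"
    using g prime_p by (auto simp: residue_primroot_def totient_prime)
  have lift: "absval (of_nat g ^ k - 1 :: 'a) < 1 \<longleftrightarrow> (p - 1) dvd k" for k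
  proof -
    have "absval (of_nat g ^ k - 1 :: 'a) < 1 \<longleftrightarrow> int p dvd (int g ^ k - 1)"
      using absval_of_int_less_1_iff[of "int g ^ k - 1"] by simp
    also have "\<dots> \<longleftrightarrow> [g ^ k = 1] (mod p)"
      by (metis cong_iff_dvd_diff cong_int_iff of_nat_1 of_nat_power)
    finally show ?thesis by (simp add: ord_divides' ord)
  qed
  obtain \<eta> :: 'a where \<eta>: "\<eta> ^ (p - 1) = 1" "absval (of_nat g - \<eta>) < 1"
    using near_root_of_unity[of "of_nat g" "p - 1"] lift[of "p - 1"] p_gt_1 by auto
  have \<eta>1: "absval \<eta> = 1"
    using absval_root_of_unity[OF \<eta>(1)] p_gt_1 by simp
  have "absval (of_nat g ^ k - \<eta> ^ k) < 1" for k
    using absval_prod_diff_less[of "{..<k}" "\<lambda>_. of_nat g" "\<lambda>_. \<eta>"] \<eta>(2) \<eta>1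
    by (simp add: absval_of_nat_le_1)
  then have "(p - 1) dvd k" if "\<eta> ^ k = 1" for k
    using that lift[of k] by metis
  then show ?thesis using \<eta>(1) by blast
qed

text \<open>The Teichmueller lift of a residue class of \<open>K\<close> is the limit of the iterated
  \<open>q\<close>-th powers of a representative.\<close>

lemma teichmueller_mem:
  assumes K: "subfield K (ambient :: 'a ring)" "complete K" and s: "s \<in> K"
    and \<xi>: "\<xi> ^ (p ^ d - 1) = 1" "0 < d" "absval (s - \<xi>) < 1"
  shows "\<xi> \<in> K"
proof -
  have q1: "0 < p ^ d - 1"
    using one_less_power[OF p_gt_1 \<open>0 < d\<close>] by simp
  have "absval \<xi> = 1"
    by (rule absval_root_of_unity[OF \<xi>(1) q1])
  \<comment> \<open>The contraction factor: mixed terms of a p-th power bring 1/p, the pure power of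
    the difference brings the initial distance.\<close>
  define r where "r = max (1 / real p) (absval (s - \<xi>))"
  have r: "0 \<le> r" "r < 1" using \<xi>(3) real_p_gt_1 by (auto simp: r_def le_max_iff_disj)
  have pth: "absval (x ^ p - y ^ p) \<le> r * absval (x - y)"
    if "absval (y::'a) = 1" "absval (x - y) \<le> r" for x y
  proof -
    have "absval ((y + (x - y)) ^ p - y ^ p - (x - y) ^ p) \<le> absval (x - y) / real p"
      using absval_freshman_le[of "x - y" y] that r by simp
    also have "\<dots> = 1 / real p * absval (x - y)"
      by simp
    also have "\<dots> \<le> r * absval (x - y)"
      by (intro mult_right_mono) (auto simp: r_def)
    finally have 1: "absval (x ^ p - y ^ p - (x - y) ^ p) \<le> r * absval (x - y)" by simp
    have "absval (x - y) ^ p = absval (x - y) ^ (p - 1) * absval (x - y)"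
      using p_pos by (metis power_minus_mult)
    also have "\<dots> \<le> absval (x - y) ^ 1 * absval (x - y)"
      using p_gt_1 that(2) r by (intro mult_right_mono power_decreasing) auto
    also have "\<dots> \<le> r * absval (x - y)"
      using that(2) by (simp add: mult_right_mono)
    finally have "absval ((x - y) ^ p) \<le> r * absval (x - y)" by simp
    from absval_add_leI[OF 1 this] show ?thesis by simp
  qed
  have pow: "absval (s ^ p ^ n - \<xi> ^ p ^ n) \<le> r ^ Suc n" for n
  proof (induction n)
    case 0
    then show ?case by (simp add: r_def)
  next
    case (Suc n)
    have "r ^ Suc n \<le> r" using r power_decreasing[of 1 "Suc n" r] by simp
    have "absval ((s ^ p ^ n) ^ p - (\<xi> ^ p ^ n) ^ p) \<le> r * absval (s ^ p ^ n - \<xi> ^ p ^ n)"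
      using Suc \<open>r ^ Suc n \<le> r\<close> \<open>absval \<xi> = 1\<close> by (intro pth) auto
    also have "\<dots> \<le> r * r ^ Suc n"
      using Suc r by (intro mult_left_mono) auto
    finally show ?case by (simp add: power_mult[symmetric] mult.commute)
  qed
  have fix_q: "\<xi> ^ p ^ d = \<xi>"
  proof -
    have "\<xi> ^ p ^ d = \<xi> ^ (p ^ d - 1) * \<xi>"
      using p_pos by (metis power_minus_mult zero_less_power)
    then show ?thesis using \<xi>(1) by simp
  qed
  have fix_qn: "\<xi> ^ p ^ (d * n) = \<xi>" for n
    by (induction n) (simp_all add: power_add power_mult fix_q)
  have "absval (s ^ p ^ (d * n) - \<xi>) \<le> r ^ n" for n
  proof -
    have "absval (s ^ p ^ (d * n) - \<xi>) \<le> r ^ Suc (d * n)"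
      using pow[of "d * n"] by (simp only: fix_qn)
    also have "\<dots> \<le> r ^ n"
      using r \<open>0 < d\<close> by (intro power_decreasing) (auto simp: le_Suc_eq)
    finally show ?thesis .
  qed
  then have "(\<lambda>n. absval (s ^ p ^ (d * n) - \<xi>)) \<longlonglongrightarrow> 0"
    using r by (intro tendsto_sandwich[OF _ _ tendsto_const LIMSEQ_realpow_zero[of r]] always_eventually) auto
  then have lim: "(\<lambda>n. s ^ p ^ (d * n)) \<longlonglongrightarrow> \<xi>"
    unfolding tendsto_iff_absval[of "\<lambda>n. s ^ p ^ (d * n)"] .
  show "\<xi> \<in> K"
    using closed_sequentially[OF complete_imp_closed[OF K(2)] _ lim] subfield_power[OF K(1) s] by blast
qed

lemma residue_system_cover:
  "residue_system V S \<Longrightarrow> x \<in> V \<Longrightarrow> absval x \<le> 1 \<Longrightarrow> \<exists>s\<in>S. absval (x - s) < 1"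
  by (simp add: residue_system_def)

text \<open>Fermat's argument: multiplication by \<open>s\<close> permutes the nonzero residue
  classes, so it changes the product of their representatives only by a small error.\<close>

lemma residue_power_eq_1:
  assumes K: "subfield K (ambient :: 'a ring)" and S: "residue_system K S"
    and s: "s \<in> K" "absval s = 1"
  shows "absval (s ^ (card S - 1) - 1) < 1"
proof -
  obtain s\<^sub>0 where s\<^sub>0: "s\<^sub>0 \<in> S" "absval (0 - s\<^sub>0) < 1"
    using residue_system_cover[OF S subfield_0[OF K]] by auto
  \<comment> \<open>Distinct representatives are at distance at least 1, so after removing the class
    of 0 all of them have size 1.\<close>
  define T where "T = S - {s\<^sub>0}"
  have T: "finite T" "card T = card S - 1" "T \<subseteq> K"
    using S s\<^sub>0 by (auto simp: T_def residue_system_def)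
  have T1: "absval t = 1" if "t \<in> T" for t
  proof -
    have "1 \<le> absval (t - s\<^sub>0)" "absval t \<le> 1"
      using that s\<^sub>0(1) S by (auto simp: T_def residue_system_def)
    moreover have "absval (t - s\<^sub>0) < 1" if "absval t < 1"
      using absval_diff_lessI[OF that] s\<^sub>0(2) by simp
    ultimately show ?thesis by fastforce
  qed
  have "\<exists>t'\<in>T. absval (s * t - t') < 1" if "t \<in> T" for t
  proof -
    have st: "absval (s * t) = 1" using T1[OF that] s by (simp add: absval_mult)
    then obtain t' where t': "t' \<in> S" "absval (s * t - t') < 1"
      using residue_system_cover[OF S subfield_mult[OF K s(1)]] \<open>t \<in> T\<close> T(3) by (metis order_refl subsetD)
    have "t' \<noteq> s\<^sub>0"
    proof
      assume "t' = s\<^sub>0"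
      then have "absval (s * t) < 1"
        using absval_diff_trans_less[OF t'(2), of 0] s\<^sub>0(2) by simp
      then show False using st by simp
    qed
    then show ?thesis using t' by (auto simp: T_def)
  qed
  then obtain \<pi> where \<pi>: "\<And>t. t \<in> T \<Longrightarrow> \<pi> t \<in> T" "\<And>t. t \<in> T \<Longrightarrow> absval (s * t - \<pi> t) < 1"
    by metis
  have "inj_on \<pi> T"
  proof (rule inj_onI, rule ccontr)
    fix t t' assume t: "t \<in> T" "t' \<in> T" "\<pi> t = \<pi> t'" "t \<noteq> t'"
    have "absval (s * t - s * t') < 1"
      using absval_diff_trans_less[OF \<pi>(2)[OF t(1)]] \<pi>(2)[OF t(2)] t(3)
      by (simp add: absval_diff_commute)
    then have "absval (t - t') < 1"
      by (simp add: right_diff_distrib[symmetric] absval_mult s(2))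
    moreover have "1 \<le> absval (t - t')" using S t by (auto simp: T_def residue_system_def)
    ultimately show False by simp
  qed
  then have "bij_betw \<pi> T T"
    using \<pi>(1) T(1) by (auto simp: bij_betw_def endo_inj_surj image_subset_iff)
  then have prod: "prod \<pi> T = \<Prod>T"
    using prod.reindex_bij_betw[of \<pi> T T "\<lambda>x. x"] by simp
  have "absval ((\<Prod>t\<in>T. s * t) - prod \<pi> T) < 1"
    using T1 \<pi> s(2) by (intro absval_prod_diff_less) (auto simp: absval_mult)
  also have "(\<Prod>t\<in>T. s * t) - prod \<pi> T = (s ^ (card S - 1) - 1) * \<Prod>T"
    by (simp add: prod prod.distrib T(2) algebra_simps)
  also have "absval \<dots> = absval (s ^ (card S - 1) - 1)"
    using T1 by (simp add: absval_mult absval_prod)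
  finally show ?thesis .
qed

text \<open>Every nonzero residue class contains a root of unity from \<open>K\<close>, and counting shows
  that this exhausts the \<open>q - 1\<close> roots of unity.\<close>

lemma roots_of_unity_unramified:
  assumes K: "subfield K (ambient :: 'a ring)" "has_degree K Qp d"
    and vals: "\<And>x. x \<in> K \<Longrightarrow> x \<noteq> 0 \<Longrightarrow> \<exists>k::int. absval x = real p powi k"
    and v: "v ^ (p ^ d - 1) = 1"
  shows "v \<in> K"
proof -
  have "d \<noteq> 0"
  proof
    assume "d = 0"
    then have "K = {0}" using amb.dimension_zero[OF subfield_Qp] K(2) by simp
    then show False using subfield_1[OF K(1)] by simp
  qed
  then have q1: "0 < p ^ d - 1"
    using one_less_power[OF p_gt_1, of d] by simp
  have "complete K"
    by (rule complete_of_dimension[OF subfield_Qp complete_Qp K(2)])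
  obtain S where S: "residue_system K S" "card S = p ^ d"
    using residue_system_exists[OF K(2) vals] by blast
  obtain s\<^sub>0 where s\<^sub>0: "s\<^sub>0 \<in> S" "absval (0 - s\<^sub>0) < 1"
    using residue_system_cover[OF S(1) subfield_0[OF K(1)]] by auto
  define T where "T = S - {s\<^sub>0}"
  have T: "finite T" "card T = p ^ d - 1" "T \<subseteq> K"
    using S s\<^sub>0 by (auto simp: T_def residue_system_def)
  have "\<exists>\<xi>. \<xi> ^ (p ^ d - 1) = 1 \<and> absval (t - \<xi>) < 1" if "t \<in> T" for t
  proof -
    have "1 \<le> absval (t - s\<^sub>0)" "absval t \<le> 1"
      using that s\<^sub>0(1) S by (auto simp: T_def residue_system_def)
    moreover have "absval (t - s\<^sub>0) < 1" if "absval t < 1"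
      using absval_diff_lessI[OF that] s\<^sub>0(2) by simp
    ultimately have "absval t = 1" by fastforce
    then show ?thesis
      using residue_power_eq_1[OF K(1) S(1), of t] that T(3) S(2) q1 near_root_of_unity by auto
  qed
  then obtain \<xi> where \<xi>: "\<And>t. t \<in> T \<Longrightarrow> \<xi> t ^ (p ^ d - 1) = 1" "\<And>t. t \<in> T \<Longrightarrow> absval (t - \<xi> t) < 1"
    by metis
  define U where "U = {x::'a. x ^ (p ^ d - 1) = 1}"
  have "inj_on \<xi> T"
  proof (rule inj_onI, rule ccontr)
    fix t t' assume t: "t \<in> T" "t' \<in> T" "\<xi> t = \<xi> t'" "t \<noteq> t'"
    have "absval (t - t') < 1"
      using absval_diff_trans_less[OF \<xi>(2)[OF t(1)]] \<xi>(2)[OF t(2)] t(3)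
      by (simp add: absval_diff_commute)
    moreover have "1 \<le> absval (t - t')" using S t by (auto simp: T_def residue_system_def)
    ultimately show False by simp
  qed
  then have "card (\<xi> ` T) = p ^ d - 1"
    using T(2) by (simp add: card_image)
  moreover define P :: "'a poly" where "P = Polynomial.monom 1 (p ^ d - 1) - 1"
  have U: "U = {x. poly P x = 0}"
    by (simp add: U_def P_def poly_monom)
  have "Polynomial.coeff P (p ^ d - 1) = 1"
    unfolding P_def using q1 by simp
  then have "P \<noteq> 0" by force
  moreover have "Polynomial.degree P \<le> p ^ d - 1"
    unfolding P_def by (intro degree_diff_le) (auto simp: degree_monom_le)
  ultimately have "finite U" "card U \<le> card (\<xi> ` T)"
    unfolding U using poly_roots_finite[of P] card_poly_roots_bound[of P] by linarith+
  moreover have "\<xi> ` T \<subseteq> U" using \<xi>(1) by (auto simp: U_def)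
  \<comment> \<open>The lifts are p^d - 1 distinct roots of a polynomial of that degree, hence all
    of them.\<close>
  ultimately have "\<xi> ` T = U" by (simp add: card_seteq)
  then obtain t where t: "t \<in> T" "v = \<xi> t" using v by (auto simp: U_def)
  then show ?thesis
    using teichmueller_mem[OF K(1) \<open>complete K\<close> _ v] \<xi>(2) T(3) \<open>d \<noteq> 0\<close> by blast
qed

end

section \<open>Totally ramified simple extensions\<close>

definition poly_in :: "'b::zero set \<Rightarrow> 'b poly \<Rightarrow> bool" where
  "poly_in F Q \<longleftrightarrow> (\<forall>i. Polynomial.coeff Q i \<in> F)"

text \<open>Vanishing coefficients instead of a degree bound leave no exception for the zero
  polynomial and keep \<open>n = 0\<close> meaningful.\<close>

definition poly_below :: "'b::zero set \<Rightarrow> nat \<Rightarrow> 'b poly set" where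
  "poly_below F n = {Q. poly_in F Q \<and> (\<forall>i\<ge>n. Polynomial.coeff Q i = 0)}"

context
  fixes F :: "'a::Fields.field set"
  assumes F: "subfield F ambient"
begin

lemma poly_in_add: "poly_in F P \<Longrightarrow> poly_in F Q \<Longrightarrow> poly_in F (P + Q)"
  by (simp add: poly_in_def subfield_add[OF F])

lemma poly_in_diff: "poly_in F P \<Longrightarrow> poly_in F Q \<Longrightarrow> poly_in F (P - Q)"
  by (simp add: poly_in_def subfield_diff[OF F])

lemma poly_in_mult: "poly_in F P \<Longrightarrow> poly_in F Q \<Longrightarrow> poly_in F (P * Q)"
  by (simp add: poly_in_def coeff_mult subfield_sum[OF F] subfield_mult[OF F])

lemma poly_in_monom: "a \<in> F \<Longrightarrow> poly_in F (Polynomial.monom a n)"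
  by (simp add: poly_in_def subfield_0[OF F])

lemma poly_in_const: "a \<in> F \<Longrightarrow> poly_in F [:a:]"
  by (metis monom_0 poly_in_monom)

lemma poly_in_1: "poly_in F 1"
  using poly_in_const[OF subfield_1[OF F]] by (simp add: one_pCons)

lemma poly_in_power: "poly_in F P \<Longrightarrow> poly_in F (P ^ n)"
  by (induction n) (simp_all add: poly_in_1 poly_in_mult)

lemma poly_in_mem: "poly_in F Q \<Longrightarrow> a \<in> F \<Longrightarrow> poly Q a \<in> F"
  unfolding poly_altdef poly_in_def
  by (intro subfield_sum[OF F] subfield_mult[OF F] subfield_power[OF F]) auto

text \<open>Division by a monic polynomial stays over \<open>F\<close>. One remainder serves all
  roots of \<open>P\<close> at once, which later makes conjugation independent of the polynomial
  chosen.\<close>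

lemma poly_below_reduce:
  assumes P: "poly_in F P" "Polynomial.degree P = n" "Polynomial.coeff P n = 1"
    and Q: "poly_in F Q"
  shows "\<exists>R\<in>poly_below F n. \<forall>z. poly P z = 0 \<longrightarrow> poly R z = poly Q z"
proof -
  have "\<exists>R\<in>poly_below F n. \<forall>z. poly P z = 0 \<longrightarrow> poly R z = poly Q z" if "Q \<in> poly_below F m" for m Q
    using that
  proof (induction m arbitrary: Q)
    case 0
    then have "Q \<in> poly_below F n" by (simp add: poly_below_def)
    then show ?case by blast
  next
    case (Suc m)
    show ?case
    proof (cases "n \<le> m")
      case False
      with Suc.prems have "Q \<in> poly_below F n" by (auto simp: poly_below_def)
      then show ?thesis by blast
    next
      case True
      define T where "T = Polynomial.monom (Polynomial.coeff Q m) (m - n) * P"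
      have coeffT: "Polynomial.coeff T i = (if i < m - n then 0 else Polynomial.coeff Q m * Polynomial.coeff P (i - (m - n)))" for i
        by (simp add: T_def coeff_monom_mult)
      have "poly_in F T"
        unfolding T_def using Suc.prems P(1)
        by (intro poly_in_mult poly_in_monom) (auto simp: poly_below_def poly_in_def)
      moreover have "Polynomial.coeff (Q - T) i = 0" if "i \<ge> m" for i
      proof (cases "i = m")
        case True
        then show ?thesis using \<open>n \<le> m\<close> P(3) by (simp add: coeffT)
      next
        case False
        then have "Polynomial.coeff P (i - (m - n)) = 0"
          using that \<open>n \<le> m\<close> by (intro coeff_eq_0) (simp add: P(2))
        then show ?thesis using that False Suc.prems by (simp add: coeffT poly_below_def)
      qed
      ultimately have "Q - T \<in> poly_below F m"
        using Suc.prems poly_in_diff[of Q T] by (simp add: poly_below_def)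
      then obtain R where "R \<in> poly_below F n" "\<forall>z. poly P z = 0 \<longrightarrow> poly R z = poly (Q - T) z"
        using Suc.IH by blast
      then show ?thesis by (auto simp: T_def)
    qed
  qed
  moreover have "Q \<in> poly_below F (Suc (Polynomial.degree Q))"
    using Q by (auto simp: poly_below_def intro: coeff_eq_0)
  ultimately show ?thesis by blast
qed

text \<open>The assumption keeps each power outside the span of the lower ones, so every power adds
  one dimension.\<close>

lemma dimension_poly_below:
  assumes "\<And>k Q. k < n \<Longrightarrow> Q \<in> poly_below F k \<Longrightarrow> poly Q x \<noteq> x ^ k"
  shows "has_degree ((\<lambda>Q. poly Q x) ` poly_below F n) F n"
  using assms
proof (induction n)
  case 0
  have "poly_below F 0 = {0}"
    by (auto simp: poly_below_def poly_in_def poly_eq_iff subfield_0[OF F])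
  then show ?case using amb.zero_dim[of F] by simp
next
  case (Suc n)
  let ?E = "\<lambda>n. (\<lambda>Q. poly Q x) ` poly_below F n"
  have "has_degree (amb.line_extension F (x ^ n) (?E n)) F (Suc n)"
  proof (intro amb.Suc_dim Suc.IH)
    show "x ^ n \<notin> ?E n"
      using Suc.prems[of n] by (auto dest: sym)
    show "poly Q x \<noteq> x ^ k" if "k < n" "Q \<in> poly_below F k" for k Q
      using Suc.prems[of k] that by simp
  qed simp
  also have "amb.line_extension F (x ^ n) (?E n) = ?E (Suc n)"
    unfolding line_extension_ambient
  proof (intro equalityI subsetI)
    fix z assume "z \<in> {k * x ^ n + v |k v. k \<in> F \<and> v \<in> ?E n}"
    then obtain k Q where *: "z = k * x ^ n + poly Q x" "k \<in> F" "Q \<in> poly_below F n" by auto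
    then have "Polynomial.monom k n + Q \<in> poly_below F (Suc n)"
      using poly_in_add[OF poly_in_monom] by (auto simp: poly_below_def)
    moreover have "z = poly (Polynomial.monom k n + Q) x"
      using * by (simp add: poly_monom)
    ultimately show "z \<in> ?E (Suc n)" by blast
  next
    fix z assume "z \<in> ?E (Suc n)"
    then obtain Q where *: "z = poly Q x" "Q \<in> poly_below F (Suc n)" by auto
    define k where "k = Polynomial.coeff Q n"
    have k: "k \<in> F" using * by (simp add: k_def poly_below_def poly_in_def)
    have "poly_in F (Q - Polynomial.monom k n)"
      using * poly_in_monom[OF k] by (intro poly_in_diff) (auto simp: poly_below_def)
    moreover have "Polynomial.coeff (Q - Polynomial.monom k n) i = 0" if "i \<ge> n" for i
      using that * by (cases "i = n") (auto simp: poly_below_def k_def)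
    ultimately have "Q - Polynomial.monom k n \<in> poly_below F n"
      by (simp add: poly_below_def)
    moreover have "z = k * x ^ n + poly (Q - Polynomial.monom k n) x"
      by (simp add: * poly_monom)
    ultimately show "z \<in> {k * x ^ n + v |k v. k \<in> F \<and> v \<in> ?E n}"
      using k by blast
  qed
  finally show ?case .
qed

end

lemma poly_below_sum:
  assumes "Q \<in> poly_below F n"
  shows "poly Q (x::'b::comm_ring_1) = (\<Sum>i<n. Polynomial.coeff Q i * x ^ i)"
proof -
  have "(\<Sum>i<n. Polynomial.coeff Q i * x ^ i) = (\<Sum>i\<in>{..<n} \<inter> {..Polynomial.degree Q}. Polynomial.coeff Q i * x ^ i)"
    by (rule sum.mono_neutral_right) (auto intro: le_degree)
  also have "\<dots> = (\<Sum>i\<le>Polynomial.degree Q. Polynomial.coeff Q i * x ^ i)"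
    using assms by (intro sum.mono_neutral_left) (auto simp: poly_below_def, metis linorder_not_le mult_zero_left)
  finally show ?thesis by (simp add: poly_altdef)
qed

context padic_closed_field
begin

text \<open>The values of \<open>F\<close> are powers of p^(1/N); raising to the power
  \<open>N\<close> keeps the exponents integral.\<close>

definition values_in :: "nat \<Rightarrow> 'a set \<Rightarrow> bool" where
  "values_in N F \<longleftrightarrow> (\<forall>a\<in>F. a \<noteq> 0 \<longrightarrow> (\<exists>k::int. absval a ^ N = real p powi k))"

end

text \<open>
  The exponents force the terms \<open>a\<^sub>i x^i\<close> with \<open>a\<^sub>i \<in> F\<close> and \<open>i < M\<close> to have pairwise
  different absolute values: this gives linear independence and a maximum norm at one stroke.
\<close>

locale ramified_extension = padic_closed_field type p
  for type :: "'a::{alg_closed_field, field_char_0, metric_space} itself" and p +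
  fixes F :: "'a set" and x :: 'a and N M :: nat and P :: "'a poly"
  assumes F: "subfield F ambient" and values_F: "values_in N F" and N: "0 < N" and M: "0 < M"
    and absval_x: "absval x ^ (M * N) = 1 / real p"
    and P: "poly_in F P" "Polynomial.degree P = M" "Polynomial.coeff P M = 1" "poly P x = 0"
begin

lemma powi_p_inj: "real p powi k = real p powi l \<Longrightarrow> k = l"
  using power_int_strict_increasing[of k l "real p"] power_int_strict_increasing[of l k "real p"] real_p_gt_1
  by (metis less_irrefl linorder_less_linear)

lemma absval_x_pos: "absval x > 0"
  using absval_x p_pos M N by (cases "x = 0") (auto simp: power_0_left)

text \<open>In units of p^(1/(M N)) the coefficient contributes a multiple of \<open>M\<close> and
  the power contributes -i, so the size reveals \<open>i\<close> modulo \<open>M\<close>. The point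
  \<open>z\<close> is left free in order to cover conjugates of \<open>x\<close>.\<close>

lemma term_value:
  assumes "a \<in> F" "a \<noteq> 0" "absval z = absval x"
  shows "\<exists>k::int. absval (a * z ^ i) ^ (M * N) = real p powi (k * int M - int i)"
proof -
  obtain k :: int where k: "absval a ^ N = real p powi k"
    using values_F assms(1,2) by (auto simp: values_in_def)
  have "absval (a * z ^ i) ^ (M * N) = (absval a ^ N) ^ M * (absval x ^ (M * N)) ^ i"
    by (simp add: absval_mult assms(3) power_mult_distrib power_mult[symmetric] mult.commute mult.left_commute)
  also have "(absval a ^ N) ^ M = real p powi (k * int M)"
    by (simp add: k power_int_mult)
  also have "(absval x ^ (M * N)) ^ i = real p powi (- int i)"
    by (simp add: absval_x power_int_minus power_one_over divide_inverse power_inverse)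
  also have "real p powi (k * int M) * real p powi (- int i) = real p powi (k * int M - int i)"
    using p_pos by (simp add: power_int_add[symmetric])
  finally show ?thesis ..
qed

lemma terms_distinct:
  assumes "a \<in> F" "b \<in> F" "absval z = absval x" "i < M" "j < M" "i \<noteq> j" "a * z ^ i \<noteq> 0"
  shows "absval (a * z ^ i) \<noteq> absval (b * z ^ j)"
proof
  assume eq: "absval (a * z ^ i) = absval (b * z ^ j)"
  have "z \<noteq> 0" using assms(3) absval_x_pos by auto
  then have "a \<noteq> 0" "b \<noteq> 0" using assms(7) eq by (auto simp: absval_mult)
  then obtain k l where "absval (a * z ^ i) ^ (M * N) = real p powi (k * int M - int i)"
      "absval (b * z ^ j) ^ (M * N) = real p powi (l * int M - int j)"
    using term_value assms(1-3) by metis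
  then have "k * int M - int i = l * int M - int j"
    using eq by (intro powi_p_inj) simp
  then have "int i - int j = (k - l) * int M"
    by (simp add: algebra_simps)
  then have "int M dvd int i - int j" by simp
  then have "int i mod int M = int j mod int M" by (simp add: mod_eq_dvd_iff)
  then show False using assms(4-6) by simp
qed

text \<open>The right-hand side sees \<open>z\<close> only through its size. At \<open>x\<close>
  this yields independence of the powers, at a conjugate it yields invariance of the absolute
  value.\<close>

lemma absval_poly:
  assumes "Q \<in> poly_below F M" "absval z = absval x"
  shows "absval (poly Q z) = (MAX i\<in>{..<M}. absval (Polynomial.coeff Q i) * absval x ^ i)"
proof -
  have "absval (\<Sum>i<M. Polynomial.coeff Q i * z ^ i) = (MAX i\<in>{..<M}. absval (Polynomial.coeff Q i * z ^ i))"
  proof (rule absval_sum_distinct)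
    fix i j assume "i \<in> {..<M}" "j \<in> {..<M}" "i \<noteq> j" "Polynomial.coeff Q i * z ^ i \<noteq> 0"
    then show "absval (Polynomial.coeff Q i * z ^ i) \<noteq> absval (Polynomial.coeff Q j * z ^ j)"
      using assms by (intro terms_distinct) (auto simp: poly_below_def poly_in_def)
  qed (use M in auto)
  then show ?thesis
    by (simp add: poly_below_sum[OF assms(1)] absval_mult assms(2))
qed

lemma poly_below_eq_0:
  assumes "Q \<in> poly_below F M" "poly Q x = 0"
  shows "Q = 0"
proof -
  have "Polynomial.coeff Q i = 0" if "i < M" for i
  proof -
    have "absval (Polynomial.coeff Q i) * absval x ^ i \<le> absval (poly Q x)"
      unfolding absval_poly[OF assms(1) refl] using that by (intro Max_ge) auto
    then have "absval (Polynomial.coeff Q i) * absval x ^ i \<le> 0" using assms(2) by simp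
    moreover have "absval x ^ i > 0" using absval_x_pos by simp
    ultimately show ?thesis by (simp add: mult_le_0_iff)
  qed
  moreover have "Polynomial.coeff Q i = 0" if "i \<ge> M" for i
    using assms(1) that by (simp add: poly_below_def)
  ultimately show ?thesis by (metis leI coeff_0 poly_eqI)
qed

definition E :: "'a set" where "E = (\<lambda>Q. poly Q x) ` poly_below F M"

lemma degree_E: "has_degree E F M"
  unfolding E_def
proof (rule dimension_poly_below[OF F])
  fix k Q assume k: "k < M" "Q \<in> poly_below F k"
  show "poly Q x \<noteq> x ^ k"
  proof
    assume "poly Q x = x ^ k"
    then have "poly (Polynomial.monom 1 k - Q) x = 0" by (simp add: poly_monom)
    moreover have "Polynomial.monom 1 k - Q \<in> poly_below F M"
      using k poly_in_diff[OF F poly_in_monom[OF F subfield_1[OF F]]] by (auto simp: poly_below_def)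
    ultimately have "Polynomial.monom 1 k - Q = 0" by (rule poly_below_eq_0[rotated])
    then have "Polynomial.coeff Q k = 1" by (metis coeff_monom eq_iff_diff_eq_0)
    then show False using k(2) by (simp add: poly_below_def)
  qed
qed

lemma poly_in_E:
  assumes "poly_in F Q"
  shows "poly Q x \<in> E"
proof -
  obtain R where "R \<in> poly_below F M" "poly R x = poly Q x"
    using poly_below_reduce[OF F P(1-3) assms] P(4) by blast
  then show ?thesis unfolding E_def by (metis imageI)
qed

lemma E_mult: "y \<in> E \<Longrightarrow> z \<in> E \<Longrightarrow> y * z \<in> E"
proof -
  assume "y \<in> E" "z \<in> E"
  then obtain Q R where "poly_in F Q" "poly_in F R" "y = poly Q x" "z = poly R x"
    by (auto simp: E_def poly_below_def)
  then show ?thesis using poly_in_E[OF poly_in_mult[OF F]] by (metis poly_mult)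
qed

lemma F_sub_E: "F \<subseteq> E"
  using poly_in_E[OF poly_in_const[OF F]] by force

text \<open>Inversion is the only issue: multiplication by \<open>y\<close> maps \<open>E\<close>
  injectively into itself, so by dimension its image contains 1.\<close>

lemma subfield_E: "subfield E ambient"
proof (rule subfield_ambientI)
  note cl = dimension_closed[OF F degree_E]
  show "1 \<in> E" using F_sub_E subfield_1[OF F] by blast
  fix y assume y: "y \<in> E"
  show "- y \<in> E" using y cl(3) by blast
  show "y * z \<in> E" if "z \<in> E" for z by (rule E_mult[OF y that])
  show "y + z \<in> E" if "z \<in> E" for z by (rule cl(2)[OF y that])
  assume "y \<noteq> 0"
  have "(*) y ` E = E"
    using E_mult[OF y] by (intro dimension_subset_eq[OF F dimension_scale[OF degree_E \<open>y \<noteq> 0\<close>] degree_E]) auto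
  then obtain z where "z \<in> E" "1 = y * z" using \<open>1 \<in> E\<close> by blast
  then show "inverse y \<in> E" by (metis inverse_unique)
qed

lemma adjoin_eq_E: "adjoin F x = E"
proof
  have "poly_in F (Polynomial.monom 1 1)" by (rule poly_in_monom[OF F subfield_1[OF F]])
  then have "x \<in> E" using poly_in_E[of "Polynomial.monom 1 1"] by (simp add: poly_monom)
  then show "adjoin F x \<subseteq> E" by (intro adjoin_minimal subfield_E F_sub_E)
  show "E \<subseteq> adjoin F x"
  proof
    fix y assume "y \<in> E"
    then obtain Q where Q: "Q \<in> poly_below F M" "y = poly Q x" by (auto simp: E_def)
    then have "poly_in (adjoin F x) Q" using adjoin_base[of F x] by (auto simp: poly_below_def poly_in_def)
    then show "y \<in> adjoin F x"
      unfolding Q(2) by (intro poly_in_mem adjoin_subfield adjoin_generator)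
  qed
qed

lemmas degree_adjoin = degree_E[folded adjoin_eq_E]

lemma adjoin_poly:
  assumes "y \<in> adjoin F x"
  obtains Q where "Q \<in> poly_below F M" "y = poly Q x"
  using assms unfolding adjoin_eq_E E_def by blast

lemma values_adjoin: "values_in (M * N) (adjoin F x)"
  unfolding values_in_def
proof (intro ballI impI)
  fix y assume "y \<in> adjoin F x" "y \<noteq> 0"
  then obtain Q where Q: "Q \<in> poly_below F M" "y = poly Q x" by (auto elim: adjoin_poly)
  have "absval y \<in> (\<lambda>i. absval (Polynomial.coeff Q i) * absval x ^ i) ` {..<M}"
    unfolding Q(2) absval_poly[OF Q(1) refl] using M by (intro Max_in) auto
  then obtain i where i: "absval y = absval (Polynomial.coeff Q i * x ^ i)"
    by (auto simp: absval_mult)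
  then have "Polynomial.coeff Q i \<noteq> 0" using \<open>y \<noteq> 0\<close> by auto
  moreover have "Polynomial.coeff Q i \<in> F" using Q(1) by (simp add: poly_below_def poly_in_def)
  ultimately show "\<exists>k::int. absval y ^ (M * N) = real p powi k"
    using term_value[of "Polynomial.coeff Q i" x i] i by auto
qed

text \<open>The \<open>F\<close>-algebra map on F(x) that sends \<open>x\<close> to a root
  \<open>z\<close> of \<open>P\<close>. The representing polynomial is unique by
  \<open>poly_below_eq_0\<close>.\<close>

definition conjugate :: "'a \<Rightarrow> 'a \<Rightarrow> 'a" where
  "conjugate z y = poly (THE Q. Q \<in> poly_below F M \<and> poly Q x = y) z"

text \<open>Reduction modulo \<open>P\<close> changes the value neither at \<open>x\<close> nor at
  \<open>z\<close>, so any representing polynomial will do; additivity and multiplicativity follow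
  at once.\<close>

lemma conjugate_poly:
  assumes "poly_in F Q" "poly P z = 0"
  shows "conjugate z (poly Q x) = poly Q z"
proof -
  obtain R where R: "R \<in> poly_below F M" "\<And>z. poly P z = 0 \<Longrightarrow> poly R z = poly Q z"
    using poly_below_reduce[OF F P(1-3) assms(1)] by blast
  have "(THE R. R \<in> poly_below F M \<and> poly R x = poly Q x) = R"
  proof (rule the_equality)
    show "R \<in> poly_below F M \<and> poly R x = poly Q x" using R P(4) by blast
    fix S assume "S \<in> poly_below F M \<and> poly S x = poly Q x"
    then have "S - R \<in> poly_below F M" "poly (S - R) x = 0"
      using R P(4) poly_in_diff[OF F] by (auto simp: poly_below_def)
    then show "S = R" using poly_below_eq_0 by fastforce
  qed
  then show ?thesis using R(2) assms(2) by (simp add: conjugate_def)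
qed

lemma adjoin_poly_in:
  assumes "y \<in> adjoin F x"
  obtains Q where "poly_in F Q" "y = poly Q x"
  using adjoin_poly[OF assms] by (auto simp: poly_below_def)

lemma conjugate_add:
  "poly P z = 0 \<Longrightarrow> y \<in> adjoin F x \<Longrightarrow> w \<in> adjoin F x \<Longrightarrow> conjugate z (y + w) = conjugate z y + conjugate z w"
  by (elim adjoin_poly_in) (metis conjugate_poly poly_add poly_in_add[OF F])

lemma conjugate_mult:
  "poly P z = 0 \<Longrightarrow> y \<in> adjoin F x \<Longrightarrow> w \<in> adjoin F x \<Longrightarrow> conjugate z (y * w) = conjugate z y * conjugate z w"
  by (elim adjoin_poly_in) (metis conjugate_poly poly_mult poly_in_mult[OF F])

lemma conjugate_base: "poly P z = 0 \<Longrightarrow> a \<in> F \<Longrightarrow> conjugate z a = a"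
  using conjugate_poly[OF poly_in_const[OF F], of a z] by simp

lemma conjugate_generator: "poly P z = 0 \<Longrightarrow> conjugate z x = z"
  using conjugate_poly[OF poly_in_monom[OF F subfield_1[OF F]], of z 1] by (simp add: poly_monom)

lemma absval_conjugate:
  assumes "poly P z = 0" "absval z = absval x" "y \<in> adjoin F x"
  shows "absval (conjugate z y) = absval y"
proof -
  obtain Q where Q: "Q \<in> poly_below F M" "y = poly Q x" by (rule adjoin_poly[OF assms(3)])
  then have "conjugate z y = poly Q z" using conjugate_poly assms(1) by (simp add: poly_below_def)
  then show ?thesis using absval_poly[OF Q(1)] assms(2) Q(2) by simp
qed

lemma conjugate_mem:
  assumes "poly P z = 0" "z \<in> adjoin F x" "y \<in> adjoin F x"
  shows "conjugate z y \<in> adjoin F x"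
proof -
  obtain Q where Q: "poly_in F Q" "y = poly Q x" by (rule adjoin_poly_in[OF assms(3)])
  then have "poly_in (adjoin F x) Q" using adjoin_base[of F x] by (auto simp: poly_in_def)
  then show ?thesis
    using conjugate_poly[OF Q(1) assms(1)] Q(2) poly_in_mem[OF adjoin_subfield _ assms(2)] by simp
qed

end

section \<open>Exponentials of power series\<close>

abbreviation fps_Exp :: "'b::field_char_0 fps \<Rightarrow> 'b fps" where
  "fps_Exp g \<equiv> fps_exp 1 oo g"

text \<open>In characteristic 0 the equation determines each coefficient from the earlier ones.
  Exponentials are compared through the equations that they solve.\<close>

lemma fps_linear_ODE_unique:
  fixes A B h :: "'b::field_char_0 fps"
  assumes A: "fps_deriv A = A * h" and B: "fps_deriv B = B * h" and "fps_nth A 0 = fps_nth B 0"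
  shows "A = B"
proof (rule fps_ext)
  fix n show "fps_nth A n = fps_nth B n"
  proof (induction n rule: less_induct)
    case (less n)
    show ?case
    proof (cases n)
      case 0
      then show ?thesis using assms(3) by simp
    next
      case (Suc m)
      have "of_nat (Suc m) * fps_nth A (Suc m) = (\<Sum>i=0..m. fps_nth A i * fps_nth h (m - i))"
        using arg_cong[OF A, of "\<lambda>f. fps_nth f m"] by (simp add: fps_mult_nth)
      also have "\<dots> = (\<Sum>i=0..m. fps_nth B i * fps_nth h (m - i))"
        using less Suc by (intro sum.cong) auto
      also have "\<dots> = of_nat (Suc m) * fps_nth B (Suc m)"
        using arg_cong[OF B, of "\<lambda>f. fps_nth f m"] by (simp add: fps_mult_nth)
      finally show ?thesis
        using Suc by (simp del: of_nat_Suc)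
    qed
  qed
qed

lemma fps_deriv_Exp: "fps_nth g 0 = 0 \<Longrightarrow> fps_deriv (fps_Exp g) = fps_Exp g * fps_deriv g"
  by (simp add: fps_compose_deriv)

lemma fps_Exp_nth_0 [simp]: "fps_nth (fps_Exp g) 0 = 1"
  by simp

lemma fps_Exp_nth_1:
  assumes "fps_nth g 0 = 0"
  shows "fps_nth (fps_Exp g) 1 = fps_nth g 1"
  using arg_cong[OF fps_deriv_Exp[OF assms], of "\<lambda>f. fps_nth f 0"] by simp

lemma fps_Exp_add:
  assumes "fps_nth f 0 = 0" "fps_nth g 0 = 0"
  shows "fps_Exp (f + g) = fps_Exp f * fps_Exp g"
proof (rule fps_linear_ODE_unique[where h = "fps_deriv f + fps_deriv g"])
  show "fps_deriv (fps_Exp (f + g)) = fps_Exp (f + g) * (fps_deriv f + fps_deriv g)"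
    using fps_deriv_Exp[of "f + g"] assms by simp
  show "fps_deriv (fps_Exp f * fps_Exp g) = fps_Exp f * fps_Exp g * (fps_deriv f + fps_deriv g)"
    by (simp only: fps_deriv_mult fps_deriv_Exp[OF assms(1)] fps_deriv_Exp[OF assms(2)])
      (simp add: algebra_simps)
qed simp

lemma fps_Exp_power:
  assumes "fps_nth f 0 = 0"
  shows "fps_Exp f ^ n = fps_Exp (of_nat n * f)"
proof (induction n)
  case (Suc n)
  have "fps_Exp (of_nat (Suc n) * f) = fps_Exp (f + of_nat n * f)"
    by (simp add: algebra_simps)
  also have "\<dots> = fps_Exp f * fps_Exp (of_nat n * f)"
    using assms by (intro fps_Exp_add) simp_all
  finally show ?case using Suc by simp
qed simp

lemma fps_Exp_linear: "fps_Exp (fps_const c * fps_X) = fps_exp c"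
  using fps_exp_compose_linear[of 1 c] by simp

lemma fps_compose_X_power_nth:
  fixes f :: "'b::comm_ring_1 fps"
  assumes "0 < k"
  shows "fps_nth (f oo fps_X ^ k) n = (if k dvd n then fps_nth f (n div k) else 0)"
proof -
  have eq: "fps_nth ((fps_X ^ k :: 'b fps) ^ i) n = (if n = k * i then 1 else 0)" for i
    by (simp add: power_mult[symmetric])
  have nth: "fps_nth (f oo fps_X ^ k) n = (\<Sum>i=0..n. fps_nth f i * (if n = k * i then 1 else 0))"
    by (simp only: fps_compose_nth eq)
  show ?thesis
  proof (cases "k dvd n")
    case True
    then obtain m where m: "n = k * m" ..
    have "fps_nth (f oo fps_X ^ k) n = (\<Sum>i=0..n. if i = m then fps_nth f i else 0)"
      unfolding nth using assms by (intro sum.cong) (auto simp: m)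
    also have "\<dots> = fps_nth f m"
      using assms by (simp add: m)
    finally show ?thesis using True m assms by simp
  next
    case False
    then show ?thesis unfolding nth by (auto intro!: sum.neutral)
  qed
qed

definition fps_in :: "'b::zero set \<Rightarrow> 'b fps \<Rightarrow> bool" where
  "fps_in F f \<longleftrightarrow> (\<forall>n. fps_nth f n \<in> F)"

lemma fps_in_mult:
  assumes "subfield F ambient" "fps_in F f" "fps_in F g"
  shows "fps_in F (f * g)"
  using assms by (auto simp: fps_in_def fps_mult_nth intro!: subfield_sum subfield_mult)

lemma fps_in_Exp:
  fixes g :: "'b::field_char_0 fps"
  assumes F: "subfield F ambient" and g: "fps_in F g"
  shows "fps_in F (fps_Exp g)"
proof -
  have "fps_in F (g ^ m)" for m
  proof (induction m)
    case 0
    then show ?case by (simp add: fps_in_def subfield_0[OF F] subfield_1[OF F])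
  next
    case (Suc m)
    then show ?case using fps_in_mult[OF F g] by simp
  qed
  moreover have "fps_nth (fps_exp 1) i \<in> F" for i
    using subfield_divide[OF F subfield_1[OF F] subfield_of_nat[OF F, of "fact i"]] by simp
  ultimately show ?thesis
    unfolding fps_in_def fps_compose_nth by (blast intro: subfield_sum[OF F] subfield_mult[OF F])
qed

section \<open>Series with geometrically bounded coefficients\<close>

context ultrametric_field
begin

text \<open>For 0 < r < 1 this means convergence on a disc larger than the unit disc; values are
  always taken at 1.\<close>

definition fps_bounded :: "real \<Rightarrow> real \<Rightarrow> 'a fps \<Rightarrow> bool" where
  "fps_bounded C r f \<longleftrightarrow> (\<forall>n. absval (fps_nth f n) \<le> C * r ^ n)"

lemma fps_bounded_mult:
  assumes "fps_bounded C r f" "fps_bounded D r g" "0 \<le> C" "0 \<le> D" "0 \<le> r"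
  shows "fps_bounded (C * D) r (f * g)"
  unfolding fps_bounded_def fps_mult_nth
proof (intro allI absval_sum_le)
  fix n i :: nat assume "i \<in> {0..n}"
  then have "r ^ n = r ^ i * r ^ (n - i)" by (simp add: power_add[symmetric])
  then have "C * D * r ^ n = (C * r ^ i) * (D * r ^ (n - i))" by simp
  moreover have "absval (fps_nth f i) * absval (fps_nth g (n - i)) \<le> (C * r ^ i) * (D * r ^ (n - i))"
    using assms by (intro mult_mono) (auto simp: fps_bounded_def)
  ultimately show "absval (fps_nth f i * fps_nth g (n - i)) \<le> C * D * r ^ n"
    by (simp only: absval_mult)
qed (use assms in simp)

lemma fps_bounded_1: "0 \<le> r \<Longrightarrow> fps_bounded 1 r 1"
  by (auto simp: fps_bounded_def)

lemma fps_bounded_power: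
  assumes "fps_bounded C r f" "0 \<le> C" "0 \<le> r"
  shows "fps_bounded (C ^ m) r (f ^ m)"
proof (induction m)
  case (Suc m)
  then show ?case using fps_bounded_mult[OF assms(1) Suc] assms by simp
qed (simp add: fps_bounded_1 assms)

lemma fps_bounded_tendsto_0:
  assumes "fps_bounded C r f" "0 \<le> r" "r < 1"
  shows "fps_nth f \<longlonglongrightarrow> 0"
proof -
  have "(\<lambda>n. C * r ^ n) \<longlonglongrightarrow> C * 0"
    using assms by (intro tendsto_mult tendsto_const LIMSEQ_realpow_zero)
  then have lim: "(\<lambda>n. C * r ^ n) \<longlonglongrightarrow> 0" by simp
  show ?thesis
    unfolding tendsto_iff_absval[of "fps_nth f"]
    by (rule tendsto_sandwich[OF always_eventually always_eventually tendsto_const lim])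
      (use assms in \<open>auto simp: fps_bounded_def\<close>)
qed

text \<open>The product of the partial sums and the partial sum of the product differ by terms of
  total degree at least N, each at most C D r^N.\<close>

lemma fps_sums_mult:
  assumes f: "fps_bounded C r f" "fps_nth f sums a" and g: "fps_bounded D r g" "fps_nth g sums b"
    and "0 \<le> C" "0 \<le> D" "0 \<le> r" "r < 1"
  shows "fps_nth (f * g) sums (a * b)"
proof -
  define d where "d N = (\<Sum>n<N. fps_nth (f * g) n) - (\<Sum>n<N. fps_nth f n) * (\<Sum>n<N. fps_nth g n)" for N
  have d: "absval (d N) \<le> C * D * r ^ N" for N
  proof -
    define T where "T = {(i, j). i + j < N}"
    define R where "R = {..<N} \<times> {..<N} - T"
    have "T \<subseteq> {..<N} \<times> {..<N}" by (auto simp: T_def)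
    have "(\<Sum>n<N. fps_nth (f * g) n) = (\<Sum>(i, j)\<in>T. fps_nth f i * fps_nth g j)"
      unfolding T_def sum.triangle_reindex fps_mult_nth by (simp add: atLeast0AtMost)
    moreover have "(\<Sum>n<N. fps_nth f n) * (\<Sum>n<N. fps_nth g n)
        = (\<Sum>(i, j)\<in>{..<N} \<times> {..<N}. fps_nth f i * fps_nth g j)"
      by (simp add: sum_product sum.cartesian_product)
    moreover have "\<dots> = (\<Sum>(i, j)\<in>R. fps_nth f i * fps_nth g j) + (\<Sum>(i, j)\<in>T. fps_nth f i * fps_nth g j)"
      unfolding R_def using \<open>T \<subseteq> _\<close> by (intro sum.subset_diff) auto
    ultimately have "d N = - (\<Sum>(i, j)\<in>R. fps_nth f i * fps_nth g j)"
      by (simp add: d_def)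
    moreover have "absval (\<Sum>(i, j)\<in>R. fps_nth f i * fps_nth g j) \<le> C * D * r ^ N"
    proof (rule absval_sum_le)
      fix z assume "z \<in> R"
      then obtain i j where z: "z = (i, j)" "N \<le> i + j" by (auto simp: R_def T_def)
      have "absval (fps_nth f i * fps_nth g j) \<le> (C * r ^ i) * (D * r ^ j)"
        unfolding absval_mult using assms by (intro mult_mono) (auto simp: fps_bounded_def)
      also have "\<dots> = C * D * r ^ (i + j)" by (simp add: power_add mult_ac)
      also have "\<dots> \<le> C * D * r ^ N"
        using assms z by (intro mult_left_mono power_decreasing) auto
      finally show "absval (case z of (i, j) \<Rightarrow> fps_nth f i * fps_nth g j) \<le> C * D * r ^ N"
        by (simp add: z)
    qed (use assms in simp)
    ultimately show ?thesis by simp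
  qed
  have "(\<lambda>n. C * D * r ^ n) \<longlonglongrightarrow> C * D * 0"
    using assms by (intro tendsto_mult tendsto_const LIMSEQ_realpow_zero)
  then have lim: "(\<lambda>n. C * D * r ^ n) \<longlonglongrightarrow> 0" by simp
  have "(\<lambda>N. absval (d N - 0)) \<longlonglongrightarrow> 0"
    by (rule tendsto_sandwich[OF always_eventually always_eventually tendsto_const lim]) (use d in auto)
  then have "d \<longlonglongrightarrow> 0"
    unfolding tendsto_iff_absval[of d] .
  moreover have "(\<lambda>N. (\<Sum>n<N. fps_nth f n) * (\<Sum>n<N. fps_nth g n)) \<longlonglongrightarrow> a * b"
    using f(2) g(2) unfolding sums_def by (rule tendsto_mult_ultra)
  ultimately have "(\<lambda>N. d N + (\<Sum>n<N. fps_nth f n) * (\<Sum>n<N. fps_nth g n)) \<longlonglongrightarrow> 0 + a * b"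
    by (rule tendsto_add_ultra)
  then show ?thesis by (simp add: d_def sums_def)
qed

lemma fps_sums_1: "fps_nth (1 :: 'a fps) sums 1"
proof -
  have "fps_nth (1 :: 'a fps) = (\<lambda>n. if n \<in> {0} then 1 else 0)"
    by (simp add: fun_eq_iff)
  then show ?thesis
    using sums_If_finite_set[of "{0::nat}" "\<lambda>_. 1 :: 'a"] by simp
qed

lemma fps_sums_power:
  assumes f: "fps_bounded 1 r f" "fps_nth f sums a" and "0 \<le> r" "r < 1"
  shows "fps_nth (f ^ n) sums (a ^ n)"
proof (induction n)
  case 0
  show ?case unfolding power_0 by (rule fps_sums_1)
next
  case (Suc n)
  have "fps_bounded 1 r (f ^ n)"
    using fps_bounded_power[OF f(1), of n] assms by simp
  from fps_sums_mult[OF f this Suc] show ?case using assms by simp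
qed

text \<open>Substituting X^k only spreads the coefficients, so the value at 1 stays. This lets exp(a
  X) and exp(-a X^p) cancel at 1.\<close>

lemma fps_sums_compose_X_power:
  assumes "0 < k"
  shows "fps_nth (f oo fps_X ^ k) sums s \<longleftrightarrow> fps_nth (f :: 'a fps) sums s"
proof -
  have "(\<lambda>n. fps_nth (f oo fps_X ^ k) (k * n)) sums s \<longleftrightarrow> fps_nth (f oo fps_X ^ k) sums s"
    using assms by (intro sums_mono_reindex) (auto simp: strict_mono_def fps_compose_X_power_nth)
  then show ?thesis using assms by (simp add: fps_compose_X_power_nth)
qed

end

section \<open>Factorials and convergence of the exponential\<close>

context padic_closed_field
begin

lemma absval_of_nat_eq_1: "\<not> p dvd n \<Longrightarrow> absval (of_nat n :: 'a) = 1"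
  using absval_of_int_eq_1[of "int n"] by simp

text \<open>Only the multiples p, 2p, ..., jp contribute to the size, and their product is p^j
  j!.\<close>

lemma absval_fact_mult: "k < p \<Longrightarrow> absval (fact (p * j + k) :: 'a) = (1 / real p) ^ j * absval (fact j :: 'a)"
proof (induction j arbitrary: k)
  case 0
  then show ?case
  proof (induction k)
    case (Suc k)
    then show ?case using absval_of_nat_less_p_eq_1[of "Suc k"]
      by (simp add: absval_mult del: of_nat_Suc)
  qed simp
next
  case (Suc j)
  show ?case using Suc.prems
  proof (induction k)
    case 0
    have "p * Suc j = Suc (p * j + (p - 1))" using p_pos by simp
    then have "(fact (p * Suc j) :: 'a) = of_nat (p * Suc j) * fact (p * j + (p - 1))"
      by (metis fact_Suc)
    also have "absval \<dots> = 1 / real p * absval (of_nat (Suc j) :: 'a) * absval (fact (p * j + (p - 1)) :: 'a)"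
      by (simp only: absval_mult of_nat_mult absval_p)
    also have "\<dots> = (1 / real p) ^ Suc j * (absval (of_nat (Suc j) :: 'a) * absval (fact j :: 'a))"
      using Suc.IH[of "p - 1"] p_pos by simp
    also have "\<dots> = (1 / real p) ^ Suc j * absval (fact (Suc j) :: 'a)"
      by (simp only: absval_mult[symmetric] fact_Suc)
    finally show ?case by simp
  next
    case (Suc k)
    have "\<not> p dvd p * j' + Suc k" for j'
      using Suc.prems nat_dvd_not_less[of "Suc k" p] dvd_add_right_iff[of p "p * j'" "Suc k"] by simp
    then have "absval (of_nat (p * j' + Suc k) :: 'a) = 1" for j'
      by (rule absval_of_nat_eq_1)
    then show ?case using Suc
      by (simp only: add_Suc_right fact_Suc absval_mult)
  qed
qed

text \<open>Legendre's bound n/(p-1) for the order of n!, raised to the power p - 1 to avoid roots;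
  the recursion passes from \<open>n\<close> to \<open>n div p\<close>.\<close>

lemma absval_fact_ge: "(1 / real p) ^ n \<le> absval (fact n :: 'a) ^ (p - 1)"
proof (induction n rule: less_induct)
  case (less n)
  show ?case
  proof (cases "n < p")
    case True
    then have "absval (fact n :: 'a) = 1" using absval_fact_mult[of n 0] by simp
    then show ?thesis using p_pos by (simp add: power_le_one)
  next
    case False
    define j where "j = n div p"
    have n: "n = p * j + n mod p" by (simp add: j_def)
    have "j < n" using False p_gt_1 by (simp add: j_def)
    have "(1 / real p) ^ n \<le> (1 / real p) ^ (p * j)"
      using n p_pos by (intro power_decreasing) auto
    also have "p * j = j * (p - 1) + j" using p_pos by (cases p) auto
    also have "(1 / real p) ^ (j * (p - 1) + j) = ((1 / real p) ^ j) ^ (p - 1) * (1 / real p) ^ j"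
      by (simp only: power_add power_mult)
    also have "\<dots> \<le> ((1 / real p) ^ j) ^ (p - 1) * absval (fact j :: 'a) ^ (p - 1)"
      using less[OF \<open>j < n\<close>] by (intro mult_left_mono) auto
    also have "\<dots> = absval (fact n :: 'a) ^ (p - 1)"
      using absval_fact_mult[of "n mod p" j] p_pos n by (simp add: power_mult_distrib)
    finally show ?thesis .
  qed
qed

lemma power_le_absval_fact:
  assumes "0 \<le> \<mu>" "\<mu> ^ (p - 1) = 1 / real p"
  shows "\<mu> ^ n \<le> absval (fact n :: 'a)"
proof -
  have "(\<mu> ^ n) ^ (p - 1) = (1 / real p) ^ n"
    by (metis assms(2) power_mult mult.commute)
  then have "(\<mu> ^ n) ^ (p - 1) \<le> absval (fact n :: 'a) ^ (p - 1)"
    using absval_fact_ge by simp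
  then show ?thesis
    using p_gt_1 assms(1) power_mono_iff[of "\<mu> ^ n" "absval (fact n :: 'a)" "p - 1"] by simp
qed

text \<open>Powers of the radius \<open>\<mu>\<close> compensate the denominators m!. The spare
  factor \<open>t\<close> survives in all coefficients but the constant one, which the second claim
  records.\<close>

lemma fps_Exp_bounded:
  assumes \<mu>: "0 < \<mu>" "\<mu> ^ (p - 1) = 1 / real p" and "0 \<le> t" "t \<le> 1" "0 \<le> r"
    and H: "fps_bounded (\<mu> * t) r H"
  shows "fps_bounded 1 r (fps_Exp H)"
    and "0 < n \<Longrightarrow> absval (fps_nth (fps_Exp H) n) \<le> t * r ^ n"
proof -
  have *: "absval (1 / fact m * fps_nth (H ^ m) n) \<le> t ^ m * r ^ n" for m n
  proof -
    have "absval (fps_nth (H ^ m) n) \<le> (\<mu> * t) ^ m * r ^ n"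
      using fps_bounded_power[OF H] assms by (simp add: fps_bounded_def)
    also have "\<dots> = \<mu> ^ m * (t ^ m * r ^ n)" by (simp add: power_mult_distrib)
    also have "\<dots> \<le> absval (fact m :: 'a) * (t ^ m * r ^ n)"
      using power_le_absval_fact[OF _ \<mu>(2), of m] assms by (intro mult_right_mono) auto
    finally show ?thesis
      by (simp add: absval_mult absval_divide divide_simps mult.commute)
  qed
  have nth: "fps_nth (fps_Exp H) n = (\<Sum>m=0..n. 1 / fact m * fps_nth (H ^ m) n)" for n
    by (simp add: fps_compose_nth)
  show "fps_bounded 1 r (fps_Exp H)"
    unfolding fps_bounded_def nth
  proof (intro allI absval_sum_le)
    fix m n :: nat
    have "t ^ m * r ^ n \<le> 1 * r ^ n"
      using assms by (intro mult_right_mono power_le_one) auto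
    then show "absval (1 / fact m * fps_nth (H ^ m) n) \<le> 1 * r ^ n"
      using *[of m n] by linarith
  qed (use assms in simp)
  assume "0 < n"
  show "absval (fps_nth (fps_Exp H) n) \<le> t * r ^ n"
    unfolding nth
  proof (rule absval_sum_le)
    fix m :: nat
    show "absval (1 / fact m * fps_nth (H ^ m) n) \<le> t * r ^ n"
    proof (cases m)
      case 0
      then show ?thesis using \<open>0 < n\<close> assms by simp
    next
      case (Suc k)
      have "t ^ m \<le> t ^ 1" unfolding Suc using assms by (intro power_decreasing) auto
      then have "t ^ m * r ^ n \<le> t * r ^ n" using assms by (intro mult_right_mono) auto
      then show ?thesis using *[of m n] by linarith
    qed
  qed (use assms in simp)
qed

end

section \<open>The Artin--Hasse series\<close>

text \<open>As the constant terms are 1, the n-th coefficient enters the m-th power linearly with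
  factor \<open>m\<close>. This isolates the one coefficient not yet known to be integral.\<close>

lemma fps_power_nth_cong:
  fixes A B :: "'b::comm_ring_1 fps"
  assumes "0 < n" "fps_nth A 0 = 1" "fps_nth B 0 = 1" "\<And>i. i < n \<Longrightarrow> fps_nth A i = fps_nth B i"
  shows "fps_nth (A ^ m) n = fps_nth (B ^ m) n + of_nat m * (fps_nth A n - fps_nth B n)"
proof -
  have zero: "fps_nth (A ^ m) 0 = 1" "fps_nth (B ^ m) 0 = 1" for m
    using assms by (induction m) auto
  have less: "fps_nth (A ^ m) i = fps_nth (B ^ m) i" if "i < n" for m i
    using that
  proof (induction m arbitrary: i)
    case (Suc m)
    then show ?case by (auto simp: fps_mult_nth assms(4) intro!: sum.cong)
  qed simp
  show ?thesis
  proof (induction m)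
    case (Suc m)
    have set: "{0..n} = insert 0 (insert n {1..<n})" using assms(1) by auto
    have split: "fps_nth (C * D) n = fps_nth C 0 * fps_nth D n + (fps_nth C n * fps_nth D 0 +
        (\<Sum>i=1..<n. fps_nth C i * fps_nth D (n - i)))" for C D :: "'b fps"
      unfolding fps_mult_nth set using assms(1) by (subst sum.insert; simp)+
    have "(\<Sum>i=1..<n. fps_nth A i * fps_nth (A ^ m) (n - i)) = (\<Sum>i=1..<n. fps_nth B i * fps_nth (B ^ m) (n - i))"
      by (intro sum.cong) (auto simp: less assms(4))
    then show ?case
      by (simp add: split zero Suc assms algebra_simps)
  qed simp
qed

context padic_closed_field
begin

definition fps_small :: "'a fps \<Rightarrow> bool" where
  "fps_small f \<longleftrightarrow> (\<forall>n. absval (fps_nth f n) < 1)"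

definition fps_integral :: "'a fps \<Rightarrow> bool" where
  "fps_integral f \<longleftrightarrow> (\<forall>n. absval (fps_nth f n) \<le> 1)"

lemma fps_integral_power: "fps_integral f \<Longrightarrow> fps_integral (f ^ n)"
  using fps_bounded_power[of 1 1 f n] by (simp add: fps_bounded_def fps_integral_def)

lemma fps_small_mult:
  assumes "fps_small f" "fps_integral g"
  shows "fps_small (f * g)"
  unfolding fps_small_def fps_mult_nth
proof (intro allI absval_sum_less)
  fix n i :: nat
  have "absval (fps_nth f i) < 1" "absval (fps_nth g (n - i)) \<le> 1"
    using assms by (simp_all add: fps_small_def fps_integral_def)
  then show "absval (fps_nth f i * fps_nth g (n - i)) < 1"
    unfolding absval_mult by (metis mult_right_le_one_le order_le_less_trans zero_le_dist)
qed simp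

lemma fps_small_add: "fps_small f \<Longrightarrow> fps_small g \<Longrightarrow> fps_small (f + g)"
  by (simp add: fps_small_def absval_add_lessI)

lemma fps_small_sum: "(\<And>i. i \<in> A \<Longrightarrow> fps_small (f i)) \<Longrightarrow> fps_small (sum f A)"
  by (induction A rule: infinite_finite_induct) (simp_all add: fps_small_def absval_add_lessI)

lemma fps_freshman:
  assumes "fps_integral f" "fps_integral g"
  shows "fps_small ((f + g) ^ p - f ^ p - g ^ p)"
  unfolding freshman_sum[OF p_pos]
proof (rule fps_small_sum)
  fix k assume "k \<in> {1..<p}"
  then have "absval (of_nat (p choose k) :: 'a) \<le> 1 / real p"
    by (intro absval_p_choose) auto
  also have "\<dots> < 1" using real_p_gt_1 by simp
  finally have "absval (of_nat (p choose k) :: 'a) < 1" .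
  then have "fps_small (of_nat (p choose k) :: 'a fps)"
    by (simp add: fps_small_def fps_of_nat[symmetric] del: fps_of_nat)
  then show "fps_small (of_nat (p choose k) * f ^ k * g ^ (p - k))"
    by (intro fps_small_mult fps_integral_power assms)
qed

text \<open>The residue of an integral rational lies in the prime field, where Frobenius is the
  identity.\<close>

lemma rat_fermat:
  assumes "a \<in> \<rat>" "absval (a::'a) \<le> 1"
  shows "absval (a ^ p - a) < 1"
proof -
  obtain k where k: "absval (a - of_nat k) < 1"
    using Qp_residue[of a] assms closure_subset[of \<rat>] unfolding Qp_def by blast
  have "absval (a ^ p - of_nat k ^ p) < 1"
    using absval_prod_diff_less[of "{..<p}" "\<lambda>_. a" "\<lambda>_. of_nat k"] k assms(2)
    by (simp add: absval_of_nat_le_1)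
  moreover have "int p dvd int (k ^ p) - int k"
  proof (cases "p dvd k")
    case True
    then have "p dvd k ^ p" using p_pos dvd_power[of p k] dvd_trans by blast
    then have "int p dvd int (k ^ p)" "int p dvd int k"
      using True by (simp_all only: int_dvd_int_iff)
    then show ?thesis by (rule dvd_diff)
  next
    case False
    then have "[k ^ (p - 1) = 1] (mod p)"
      by (rule fermat_theorem[OF prime_p])
    then have "[k ^ (p - 1) * k = 1 * k] (mod p)" by (rule cong_scalar_right)
    then have "[k ^ p = k] (mod p)" using p_pos by (metis power_minus_mult mult_1)
    then have "[int (k ^ p) = int k] (mod int p)" by (simp only: cong_int_iff)
    then show ?thesis by (simp only: cong_iff_dvd_diff)
  qed
  then have "absval (of_int (int (k ^ p) - int k) :: 'a) < 1"
    by (simp only: absval_of_int_less_1_iff)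
  then have "absval (of_nat k ^ p - of_nat k :: 'a) < 1" by simp
  ultimately have "absval (a ^ p - of_nat k) < 1" by (rule absval_diff_trans_less)
  then show ?thesis
    using absval_diff_trans_less[of "a ^ p" "of_nat k" 1 a] k by (simp add: absval_diff_commute)
qed

definition AH_log :: "'a fps" where
  "AH_log = Abs_fps (\<lambda>n. if \<exists>i. n = p ^ i then 1 / of_nat n else 0)"

definition AH :: "'a fps" where "AH = fps_Exp AH_log"

lemma AH_log_nth_0 [simp]: "fps_nth AH_log 0 = 0"
  using p_pos by (simp add: AH_log_def)

lemma AH_nth_0 [simp]: "fps_nth AH 0 = 1"
  by (simp add: AH_def)

text \<open>Substituting X^p shifts the sum of X^(p^i) / p^i by one index, which costs a factor
  \<open>p\<close>; the first term is left over.\<close>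

lemma AH_log_Frobenius: "of_nat p * AH_log = (AH_log oo fps_X ^ p) + fps_const (of_nat p) * fps_X"
proof (rule fps_ext)
  fix n
  have lhs: "fps_nth (of_nat p * AH_log) n = of_nat p * fps_nth AH_log n"
    by (simp add: fps_of_nat[symmetric] del: fps_of_nat)
  have rhs: "fps_nth ((AH_log oo fps_X ^ p) + fps_const (of_nat p) * fps_X) n
      = (if p dvd n then fps_nth AH_log (n div p) else 0) + (if n = 1 then of_nat p else 0)"
    using p_pos by (simp add: fps_compose_X_power_nth)
  consider "n = 1" | m where "n = p * m" | "n \<noteq> 1" "\<not> p dvd n" by blast
  then show "fps_nth (of_nat p * AH_log) n = fps_nth ((AH_log oo fps_X ^ p) + fps_const (of_nat p) * fps_X) n"
  proof cases
    case 1
    have "\<exists>i. Suc 0 = p ^ i" by (metis power_0 One_nat_def)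
    then show ?thesis unfolding lhs rhs using 1 p_gt_1 by (auto simp: AH_log_def)
  next
    case (2 m)
    have "p * m \<noteq> 1" using p_gt_1 by auto
    have "(\<exists>i. p * m = p ^ i) \<longleftrightarrow> (\<exists>i. m = p ^ i)"
    proof
      assume "\<exists>i. p * m = p ^ i"
      then obtain i where i: "p * m = p ^ i" ..
      then obtain j where "i = Suc j" using \<open>p * m \<noteq> 1\<close> by (cases i) auto
      then show "\<exists>i. m = p ^ i" using i p_pos by auto
    qed (metis power_Suc)
    then show ?thesis unfolding lhs rhs using 2 p_pos \<open>p * m \<noteq> 1\<close> by (auto simp: AH_log_def)
  next
    case 3
    have "n \<noteq> p ^ i" for i using 3 by (cases i) auto
    then show ?thesis unfolding lhs rhs using 3 by (simp add: AH_log_def)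
  qed
qed

lemma AH_Frobenius: "AH ^ p = (AH oo fps_X ^ p) * fps_exp (of_nat p)"
proof -
  have X0: "fps_nth (fps_X ^ p :: 'a fps) 0 = 0" using p_pos by simp
  have L0: "fps_nth (AH_log oo fps_X ^ p) 0 = 0" by simp
  have "AH ^ p = fps_Exp (of_nat p * AH_log)"
    unfolding AH_def by (rule fps_Exp_power) simp
  also have "\<dots> = fps_Exp (AH_log oo fps_X ^ p) * fps_Exp (fps_const (of_nat p) * fps_X)"
    unfolding AH_log_Frobenius by (rule fps_Exp_add) (simp_all add: L0)
  also have "fps_Exp (AH_log oo fps_X ^ p) = AH oo fps_X ^ p"
    unfolding AH_def by (rule fps_compose_assoc[OF X0 AH_log_nth_0])
  finally show ?thesis by (simp only: fps_Exp_linear)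
qed

lemma subfield_Rats: "subfield (\<rat> :: 'a set) ambient"
  by (rule subfield_ambientI) auto

lemma AH_rational: "fps_nth AH n \<in> \<rat>"
proof -
  have "fps_in \<rat> AH_log" by (auto simp: fps_in_def AH_log_def)
  then have "fps_in \<rat> AH" unfolding AH_def by (rule fps_in_Exp[OF subfield_Rats])
  then show ?thesis by (simp add: fps_in_def)
qed

text \<open>The order of n! is at most n/(p-1), which is below n since \<open>p\<close> is at least
  3.\<close>

lemma absval_exp_p_nth:
  assumes "0 < n"
  shows "absval (of_nat p ^ n / fact n :: 'a) < 1"
proof -
  define m where "m = absval (of_nat p ^ n / fact n :: 'a)"
  have "m ^ (p - 1) * absval (fact n :: 'a) ^ (p - 1) = ((1 / real p) ^ n) ^ (p - 1)"
    unfolding m_def power_mult_distrib[symmetric] absval_mult[symmetric] by (simp add: absval_p)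
  also have "\<dots> = (1 / real p) ^ (n * (p - 2)) * (1 / real p) ^ n"
  proof -
    have "n * (p - 1) = n * (p - 2) + n" using p_ge_3 by (simp add: algebra_simps diff_mult_distrib2)
    then show ?thesis by (simp only: power_mult[symmetric] power_add[symmetric])
  qed
  also have "\<dots> \<le> (1 / real p) ^ (n * (p - 2)) * absval (fact n :: 'a) ^ (p - 1)"
    by (intro mult_left_mono absval_fact_ge) auto
  finally have "m ^ (p - 1) \<le> (1 / real p) ^ (n * (p - 2))"
    by simp
  also have "\<dots> < 1"
    using assms p_ge_3 real_p_gt_1 by (intro power_less_one_iff[THEN iffD2]) auto
  finally show ?thesis
    unfolding m_def[symmetric] using one_le_power[of m "p - 1"] by (meson not_le)
qed

text \<open>Dwork's criterion: comparing coefficients in \<open>AH(X)^p = AH(X^p) exp(pX)\<close> modulo \<open>p\<close>.\<close>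

lemma AH_integral: "absval (fps_nth AH n) \<le> 1"
proof (induction n rule: less_induct)
  case (less n)
  show ?case
  proof (cases "n = 0")
    case False
    \<comment> \<open>\<open>B\<close> is the part known to be integral; \<open>D\<close> is its
      p-th power without the mixed terms, which vanish modulo the maximal ideal.\<close>
    define B where "B m = fps_cutoff m AH" for m
    define D where "D m = (\<Sum>i<m. fps_const (fps_nth AH i ^ p) * fps_X ^ (i * p))" for m
    have intB: "fps_integral (B m)" if "m \<le> n" for m
      using less that by (auto simp: fps_integral_def B_def)
    have small: "fps_small (B m ^ p - D m)" if "m \<le> n" for m
      using that
    proof (induction m)
      case 0
      then show ?case using p_pos by (simp add: B_def D_def fps_small_def power_0_left)
    next
      case (Suc m)
      define T where "T = fps_const (fps_nth AH m) * fps_X ^ m"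
      have "fps_integral T"
        using less[of m] Suc.prems by (auto simp: T_def fps_integral_def)
      then have "fps_small ((B m + T) ^ p - B m ^ p - T ^ p)"
        using intB[of m] Suc.prems by (intro fps_freshman) auto
      moreover have "B (Suc m) = B m + T"
        by (rule fps_ext) (auto simp: B_def T_def less_Suc_eq)
      moreover have "T ^ p = fps_const (fps_nth AH m ^ p) * fps_X ^ (m * p)"
        by (simp add: T_def power_mult_distrib power_mult fps_const_power)
      ultimately have "fps_small ((B (Suc m) ^ p - B m ^ p - (D (Suc m) - D m)) + (B m ^ p - D m))"
        using Suc by (intro fps_small_add) (simp_all add: D_def)
      then show ?case by (simp add: algebra_simps)
    qed
    \<comment> \<open>The n-th coefficient of AH(X^p). Those of \<open>AH ^ p\<close> and
      \<open>B n ^ p\<close> are both congruent to it, which leaves \<open>p\<close> times the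
      unknown coefficient.\<close>
    define r where "r = (if p dvd n then fps_nth AH (n div p) else 0)"
    have Dn: "absval (fps_nth (D n) n - r) < 1"
    proof (cases "p dvd n")
      case True
      then obtain k where k: "n = k * p" by (metis dvd_def mult.commute)
      then have "k < n" using False p_gt_1 by simp
      have "fps_nth (D n) n = (\<Sum>i<n. if i = k then fps_nth AH i ^ p else 0)"
        unfolding D_def fps_sum_nth using p_pos by (intro sum.cong) (auto simp: k)
      then have "fps_nth (D n) n = fps_nth AH k ^ p" using \<open>k < n\<close> by simp
      moreover have "r = fps_nth AH k" using k p_pos by (simp add: r_def)
      ultimately show ?thesis
        using rat_fermat[OF AH_rational less[OF \<open>k < n\<close>]] by simp
    next
      case False
      then have "fps_nth (D n) n = 0"
        unfolding D_def fps_sum_nth by (intro sum.neutral) auto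
      then show ?thesis using False by (simp add: r_def)
    qed
    have "fps_nth (AH ^ p) n = fps_nth (B n ^ p) n + of_nat p * fps_nth AH n"
      using fps_power_nth_cong[of n AH "B n" p] False by (simp add: B_def)
    moreover have "absval (fps_nth (AH ^ p) n - r) < 1"
    proof -
      have "fps_nth (AH ^ p) n = (\<Sum>i=0..n. fps_nth (AH oo fps_X ^ p) i * (of_nat p ^ (n - i) / fact (n - i)))"
        unfolding AH_Frobenius fps_mult_nth by simp
      also have "\<dots> = (\<Sum>i<n. fps_nth (AH oo fps_X ^ p) i * (of_nat p ^ (n - i) / fact (n - i))) + r"
        using p_pos by (simp add: atLeast0AtMost lessThan_Suc_atMost[symmetric] fps_compose_X_power_nth r_def)
      finally have "fps_nth (AH ^ p) n - r = (\<Sum>i<n. fps_nth (AH oo fps_X ^ p) i * (of_nat p ^ (n - i) / fact (n - i)))"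
        by simp
      moreover have "absval \<dots> < 1"
      proof (rule absval_sum_less)
        fix i assume i: "i \<in> {..<n}"
        have le: "absval (fps_nth (AH oo fps_X ^ p) i) \<le> 1"
        proof (cases "p dvd i")
          case True
          have "i div p < n" by (rule le_less_trans[OF div_le_dividend]) (use i in simp)
          then show ?thesis using True p_pos less by (simp add: fps_compose_X_power_nth)
        next
          case False
          then show ?thesis using p_pos by (simp add: fps_compose_X_power_nth)
        qed
        have lt: "absval (of_nat p ^ (n - i) / fact (n - i) :: 'a) < 1"
          using i by (intro absval_exp_p_nth) simp
        show "absval (fps_nth (AH oo fps_X ^ p) i * (of_nat p ^ (n - i) / fact (n - i))) < 1"
          unfolding absval_mult[of "fps_nth (AH oo fps_X ^ p) i"]
          by (rule le_less_trans[OF mult_left_le_one_le[OF zero_le_dist zero_le_dist le] lt])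
      qed simp
      ultimately show ?thesis by simp
    qed
    moreover have "absval (fps_nth (B n ^ p) n - fps_nth (D n) n) < 1"
      using small[of n] by (simp add: fps_small_def)
    then have "absval (fps_nth (B n ^ p) n - r) < 1"
      using Dn by (rule absval_diff_trans_less)
    ultimately have "absval (of_nat p * fps_nth AH n) < 1"
      using absval_diff_lessI[of "fps_nth (AH ^ p) n - r" 1 "fps_nth (B n ^ p) n - r"] by simp
    then have lt: "absval (fps_nth AH n) < real p"
      using p_pos by (simp add: absval_mult absval_p divide_simps)
    \<comment> \<open>The estimate gives only a size below \<open>p\<close>; since a rational has an
      integral power of \<open>p\<close> as its size, this improves to at most 1.\<close>
    show ?thesis
    proof (cases "fps_nth AH n = 0")
      case False
      obtain k :: int where k: "absval (fps_nth AH n) = real p powi k"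
        using rat_absval[OF AH_rational False] by blast
      have "k \<le> 0"
      proof (rule ccontr)
        assume "\<not> k \<le> 0"
        then have "real p powi 1 \<le> real p powi k"
          using real_p_gt_1 by (intro power_int_increasing) auto
        then show False using lt k by simp
      qed
      then have "real p powi k \<le> real p powi 0"
        using real_p_gt_1 by (intro power_int_increasing) auto
      then show ?thesis using k by simp
    qed simp
  qed simp
qed

end

section \<open>The value of the series\<close>

text \<open>
  Put \<open>y = \<omega> v\<close> and \<open>c = \<gamma> v^p\<close>. Then \<open>y^p + p y = c\<close> and \<open>c^p = - p \<gamma> v^(p\<^sup>2)\<close>, so that at \<open>X = v T\<close> the
  argument of the exponential is \<open>y T + (y T)^p / p + c^p T^(p\<^sup>2) / p\<^sup>2\<close>, the series \<open>G\<close> below. It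
  differs from the Artin--Hasse logarithm of \<open>y T\<close> by the series \<open>H\<close>, which is so small that its
  exponential converges.
\<close>

locale kummer_data = padic_closed_field type p
  for type :: "'a::{alg_closed_field, field_char_0, metric_space} itself" and p +
  fixes \<gamma> \<omega> u v :: 'a
  assumes gamma: "\<gamma> ^ (p - 1) = - of_nat p" and absval_v: "absval v = 1" and u: "u * v ^ p = v"
    and omega: "\<omega> ^ p + u * of_nat p * \<omega> = \<gamma>"
begin

definition y :: 'a where "y = \<omega> * v"
definition c :: 'a where "c = \<gamma> * v ^ p"
text \<open>The unit of all estimates: |\<gamma>| = w^p and |p| = w^(p(p-1)).\<close>

definition w :: real where "w = absval \<omega>"

lemma absval_u: "absval u = 1"
  using arg_cong[OF u, of absval] by (simp add: absval_mult absval_v)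

lemma absval_gamma: "absval \<gamma> ^ (p - 1) = 1 / real p"
  using arg_cong[OF gamma, of absval] by (simp add: absval_p)

lemma absval_gamma_pos: "0 < absval \<gamma>"
  using absval_gamma p_gt_1 by (cases "\<gamma> = 0") (auto simp: power_0_left)

text \<open>Newton polygon: if the linear term were at least as large as \<omega>^p, then |\<omega>|
  would be at most |\<gamma>|, and both terms would be smaller than their sum \<gamma>.\<close>

lemma w_power_p: "w ^ p = absval \<gamma>"
proof -
  have "\<omega> \<noteq> 0" using omega absval_gamma_pos p_pos by auto
  then have w0: "0 < w" by (simp add: w_def)
  have lin: "absval (u * of_nat p * \<omega>) = w / real p"
    by (simp add: absval_mult absval_u absval_p w_def)
  have "w / real p < w ^ p"
  proof (rule ccontr)
    assume "\<not> w / real p < w ^ p"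
    then have le: "w ^ p \<le> w / real p" by simp
    then have "w ^ (p - 1) * w \<le> 1 / real p * w"
      using power_minus_mult[OF p_pos, of w] by simp
    then have "w ^ (p - 1) \<le> absval \<gamma> ^ (p - 1)"
      unfolding absval_gamma by (rule mult_right_le_imp_le[OF _ w0])
    then have "w \<le> absval \<gamma>"
      using p_gt_1 w0 power_mono_iff[of w "absval \<gamma>" "p - 1"] by simp
    have "absval \<gamma> \<le> w / real p"
      unfolding omega[symmetric] by (rule absval_add_leI) (use le lin w_def in simp_all)
    also have "\<dots> \<le> absval \<gamma> / real p" using \<open>w \<le> absval \<gamma>\<close> by (simp add: divide_right_mono)
    also have "\<dots> < absval \<gamma>" using absval_gamma_pos real_p_gt_1 by (simp add: divide_less_eq)
    finally show False by simp
  qed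
  then have "absval (\<omega> ^ p + u * of_nat p * \<omega>) = absval (\<omega> ^ p)"
    by (intro absval_add_eq_left) (simp only: lin, simp add: w_def)
  then show ?thesis by (simp add: omega w_def)
qed

lemma w_pos: "0 < w"
proof -
  have "w \<noteq> 0" using w_power_p absval_gamma_pos p_pos by (auto simp: power_0_left)
  moreover have "0 \<le> w" by (simp add: w_def)
  ultimately show ?thesis by simp
qed

lemma w_power: "w ^ (p * (p - 1)) = 1 / real p"
  unfolding power_mult w_power_p by (rule absval_gamma)

lemma w_less_1: "w < 1"
proof (rule ccontr)
  assume "\<not> w < 1"
  then have "1 \<le> w ^ (p * (p - 1))" by (intro one_le_power) simp
  then show False using w_power real_p_gt_1 by simp
qed

lemma absval_p_w: "absval (of_nat p :: 'a) = w ^ (p * (p - 1))"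
  by (simp only: w_power absval_p)

lemma absval_y: "absval y = w"
  by (simp add: y_def absval_mult absval_v w_def)

lemma y_eq: "y ^ p + of_nat p * y = c"
proof -
  have "y ^ p + of_nat p * y = (\<omega> ^ p + u * of_nat p * \<omega>) * v ^ p"
    using u by (simp add: y_def power_mult_distrib algebra_simps)
  then show ?thesis by (simp only: omega c_def)
qed

lemma gamma_p: "\<gamma> ^ p = - of_nat p * \<gamma>"
  using power_minus_mult[OF p_pos, of \<gamma>] unfolding gamma by simp

lemma c_power: "c ^ p = - of_nat p * \<gamma> * v ^ (p ^ 2)"
  by (simp add: c_def power_mult_distrib gamma_p power_mult[symmetric] power2_eq_square)

definition G :: "'a fps" where
  "G = fps_const y * fps_X + fps_const (y ^ p / of_nat p) * fps_X ^ p +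
       fps_const (c ^ p / of_nat p ^ 2) * fps_X ^ (p ^ 2)"

lemma p_power_neq: "p ^ 2 \<noteq> p" "p \<noteq> p ^ 2" "p ^ 2 \<noteq> Suc 0" "Suc 0 \<noteq> p ^ 2"
    "p \<noteq> Suc 0" "Suc 0 \<noteq> p"
  using p_gt_1 by (auto simp: power2_eq_square)

lemma fps_three_terms_nth:
  "fps_nth (fps_const a * fps_X + fps_const b * fps_X ^ p + fps_const d * fps_X ^ (p ^ 2) :: 'a fps) n
    = (if n = 1 then a else if n = p then b else if n = p ^ 2 then d else 0)"
  using p_power_neq by simp

text \<open>Substituting v T for the variable moves the point of evaluation to 1.\<close>

lemma E2_rescaled: "E2_series p u \<gamma> \<omega> oo (fps_const v * fps_X) = fps_Exp G"
proof -
  define B where "B = fps_const \<omega> * fps_X - fps_const (u * \<omega>) * fps_X ^ p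
      + fps_const (1 / of_nat p) * (fps_const \<gamma> * fps_X ^ p - fps_const \<gamma> * fps_X ^ (p ^ 2))"
  have B0: "fps_nth B 0 = 0" using p_pos by (simp add: B_def)
  have B': "B = fps_const \<omega> * fps_X + fps_const (\<gamma> / of_nat p - u * \<omega>) * fps_X ^ p
      + fps_const (- \<gamma> / of_nat p) * fps_X ^ (p ^ 2)"
    unfolding B_def by (rule fps_ext) (simp add: algebra_simps)
  have "B oo (fps_const v * fps_X) = G"
  proof (rule fps_ext)
    fix n
    \<comment> \<open>The coefficient of T^p: as u v^p = v it is (c - p y)/p, and
      \<open>y_eq\<close> applies.\<close>
    have "v ^ p * (\<gamma> / of_nat p - u * \<omega>) = y ^ p / of_nat p"
    proof -
      have "of_nat p * (v ^ p * (\<gamma> / of_nat p - u * \<omega>))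
          = v ^ p * (of_nat p * (\<gamma> / of_nat p)) - of_nat p * (\<omega> * (u * v ^ p))"
        by (simp only: algebra_simps)
      also have "v ^ p * (of_nat p * (\<gamma> / of_nat p)) = c"
        using p_pos by (simp add: c_def)
      also have "c - of_nat p * (\<omega> * (u * v ^ p)) = y ^ p" unfolding u y_def[symmetric] using y_eq by (simp add: algebra_simps)
      finally show ?thesis using p_pos by (metis nonzero_mult_div_cancel_left of_nat_0_eq_iff less_irrefl)
    qed
    moreover have "v ^ (p ^ 2) * (- \<gamma> / of_nat p) = c ^ p / of_nat p ^ 2"
      unfolding c_power using p_pos by (simp add: field_simps power2_eq_square)
    ultimately show "fps_nth (B oo (fps_const v * fps_X)) n = fps_nth G n"
      unfolding fps_nth_compose_linear B' G_def fps_three_terms_nth by (simp add: y_def)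
  qed
  then show ?thesis
    unfolding E2_series_def B_def[symmetric] using B0 fps_compose_assoc[of "fps_const v * fps_X" B "fps_exp 1"]
    by simp
qed

text \<open>The radius \<open>r = w^(1/p\<^sup>2)\<close> leaves room for \<open>H\<close> and makes all coefficients decay geometrically.\<close>

definition r :: real where "r = root (p ^ 2) w"

lemma r_power: "r ^ (p ^ 2) = w"
  unfolding r_def using w_pos p_pos by (intro real_root_pow_pos2) auto

lemma r_pos: "0 < r" and r_less_1: "r < 1"
  using w_pos w_less_1 p_pos by (simp_all add: r_def)

lemma w_le_r: "w \<le> r"
proof -
  have "r ^ (p ^ 2) \<le> r ^ 1"
    using r_pos r_less_1 p_pos by (intro power_decreasing) auto
  then show ?thesis by (simp add: r_power)
qed

lemma w_le_r_power_p: "w \<le> r ^ p"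
proof -
  have "r ^ (p ^ 2) \<le> r ^ p"
    using r_pos r_less_1 p_pos by (intro power_decreasing) (auto simp: power2_eq_square)
  then show ?thesis by (simp add: r_power)
qed

definition H :: "'a fps" where "H = G - (AH_log oo (fps_const y * fps_X))"

text \<open>In the expansion of c^p = (y^p + p y)^p the mixed terms are bounded by |p| |y|^(p(p-1))
  |p y| = w^(3P+1) with P = p(p-1), and the pure power of p y is no larger.\<close>

lemma absval_c_diff: "absval (c ^ p - y ^ (p ^ 2)) \<le> w ^ (3 * (p * (p - 1)) + 1)"
proof -
  define P where "P = p * (p - 1)"
  have py: "absval (of_nat p * y) = w ^ (P + 1)"
    by (simp add: absval_mult absval_p_w absval_y P_def)
  have "p \<le> P" using p_ge_3 by (simp add: P_def)
  then have "w ^ (P + 1) \<le> w ^ p"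
    using w_pos w_less_1 by (intro power_decreasing) auto
  then have "absval ((y ^ p + of_nat p * y) ^ p - (y ^ p) ^ p - (of_nat p * y) ^ p)
      \<le> absval (y ^ p) ^ (p - 1) * absval (of_nat p * y) / real p"
    by (intro absval_freshman_le) (simp add: py, simp add: absval_y)
  also have "\<dots> = w ^ P * w ^ (P + 1) * w ^ P"
    by (simp only: py absval_power absval_y power_mult[symmetric] P_def w_power divide_inverse mult_1)
  also have "\<dots> = w ^ (P + (P + 1) + P)"
    by (simp only: power_add)
  also have "P + (P + 1) + P = 3 * P + 1" by simp
  finally have 1: "absval (c ^ p - y ^ (p ^ 2) - (of_nat p * y) ^ p) \<le> w ^ (3 * P + 1)"
    by (simp add: y_eq power_mult[symmetric] power2_eq_square)
  have "3 * P + 1 \<le> (P + 1) * p"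
    using p_pos mult_le_mono2[OF p_ge_3, of P] unfolding add_mult_distrib by linarith
  then have "w ^ ((P + 1) * p) \<le> w ^ (3 * P + 1)"
    using w_pos w_less_1 by (intro power_decreasing) auto
  then have 2: "absval ((of_nat p * y) ^ p) \<le> w ^ (3 * P + 1)"
    by (simp only: absval_power py power_mult)
  show ?thesis
    using absval_add_leI[OF 1 2] by (simp add: P_def)
qed

text \<open>For n = p^(j+3) the term y^n/n has size w^(n - p(p-1)(j+3)); this compares it with
  w^(p+2) r^n, where r^n = w^(p^(j+1)).\<close>

lemma exponent_bound: "p + 2 + p ^ (j + 1) + p * (p - 1) * (j + 3) \<le> p ^ (j + 3)"
proof (induction j)
  case 0
  obtain k where p: "p = k + 3" using p_ge_3 by (metis le_add_diff_inverse2)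
  show ?case by (simp add: p power3_eq_cube numeral_eq_Suc algebra_simps)
next
  case (Suc j)
  \<comment> \<open>Comparison of the increments of both sides, with the negative terms moved
    across.\<close>
  have "p ^ (j + 2) + p * (p - 1) + p ^ (j + 3) \<le> p ^ (j + 4) + p ^ (j + 1)"
  proof -
    obtain k where p: "p = k + 3" using p_ge_3 by (metis le_add_diff_inverse2)
    define m where "m = p ^ (j + 1)"
    have "1 \<le> p ^ j" using p_pos by simp
    then have "p \<le> m" by (simp add: m_def)
    then have "(p - 1) * p \<le> (p - 1) * m" by (rule mult_le_mono2)
    then have "p * (p - 1) + m * p + m * p ^ 2 \<le> (p - 1) * m + m * p + m * p ^ 2" by simp
    also have "\<dots> \<le> m * p ^ 3 + m"
      by (simp add: p power2_eq_square power3_eq_cube algebra_simps)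
    finally show ?thesis by (simp add: m_def power_add power2_eq_square power3_eq_cube eval_nat_numeral algebra_simps)
  qed
  moreover have "p * (p - 1) * (j + 4) = p * (p - 1) * (j + 3) + p * (p - 1)"
    using mult_Suc_right[of "p * (p - 1)" "j + 3"] by (simp add: eval_nat_numeral)
  moreover have "Suc j + 1 = j + 2" "Suc j + 3 = j + 4" by simp_all
  ultimately show ?case using Suc by (simp only:)
qed

text \<open>The terms at 1 and p cancel, \<open>absval_c_diff\<close> treats p^2, and beyond it only
  Artin--Hasse terms remain. In the bound |\<gamma>| is the radius of the exponential, while w^2
  keeps the exponential of \<open>H\<close> within w^2 of 1.\<close>

lemma fps_bounded_H: "fps_bounded (absval \<gamma> * w ^ 2) r H"
  unfolding fps_bounded_def
proof
  fix n
  define P where "P = p * (p - 1)"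
  have log: "fps_nth (AH_log oo (fps_const y * fps_X)) n = (if \<exists>i. n = p ^ i then y ^ n / of_nat n else 0)"
    unfolding fps_nth_compose_linear by (simp add: AH_log_def)
  have G: "fps_nth G n = (if n = 1 then y else if n = p then y ^ p / of_nat p
      else if n = p ^ 2 then c ^ p / of_nat p ^ 2 else 0)"
    unfolding G_def by (rule fps_three_terms_nth)
  have Hn: "fps_nth H n = (if n = 1 then y else if n = p then y ^ p / of_nat p
      else if n = p ^ 2 then c ^ p / of_nat p ^ 2 else 0) - (if \<exists>i. n = p ^ i then y ^ n / of_nat n else 0)"
    by (simp only: H_def fps_sub_nth log G)
  have bound: "absval \<gamma> * w ^ 2 = w ^ (p + 2)" by (simp only: w_power_p power_add)
  have rr: "r ^ (p ^ (i + 2)) = w ^ (p ^ i)" for i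
  proof -
    have "p ^ (i + 2) = p ^ 2 * p ^ i" by (simp only: power_add mult.commute)
    then show ?thesis by (simp only: power_mult r_power)
  qed
  have nonneg: "0 \<le> w ^ (p + 2) * r ^ n" using w_pos r_pos by simp
  show "absval (fps_nth H n) \<le> absval \<gamma> * w ^ 2 * r ^ n"
    unfolding bound
  proof (cases "\<exists>i. n = p ^ i")
    case False
    have "n \<noteq> 1" using False by (metis power_0)
    moreover have "n \<noteq> p" using False by (metis power_one_right)
    moreover have "n \<noteq> p ^ 2" using False by blast
    ultimately have "fps_nth H n = 0" unfolding Hn using False by simp
    then show "absval (fps_nth H n) \<le> w ^ (p + 2) * r ^ n" using nonneg by simp
  next
    case True
    then obtain i where i: "n = p ^ i" ..
    consider "i = 0" | "i = 1" | "i = 2" | j where "i = j + 3"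
      by (metis One_nat_def Suc_1 add.commute le_Suc_ex less_2_cases linorder_not_less numeral_3_eq_3 order_le_less less_Suc_eq)
    then show "absval (fps_nth H n) \<le> w ^ (p + 2) * r ^ n"
    proof cases
      case 1
      then have "fps_nth H n = 0" unfolding Hn using p_power_neq i True by simp
      then show ?thesis using nonneg by simp
    next
      case 2
      then have "fps_nth H n = 0" unfolding Hn using p_power_neq i True by simp
      then show ?thesis using nonneg by simp
    next
      case 3
      have "fps_nth H n = (c ^ p - y ^ (p ^ 2)) / of_nat p ^ 2"
        unfolding Hn using p_power_neq i 3 True by (simp add: diff_divide_distrib)
      then have "absval (fps_nth H n) = absval (c ^ p - y ^ (p ^ 2)) / (w ^ P) ^ 2"
        by (simp add: absval_divide absval_p_w P_def)
      also have "\<dots> \<le> w ^ (3 * P + 1) / (w ^ P) ^ 2"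
        using absval_c_diff by (intro divide_right_mono) (simp_all add: P_def)
      also have "w ^ (3 * P + 1) = w ^ (P + 1) * (w ^ P) ^ 2"
        by (simp add: power_add[symmetric] power_mult[symmetric] algebra_simps)
      also have "\<dots> / (w ^ P) ^ 2 = w ^ (P + 1)" using w_pos by simp
      \<comment> \<open>The additional 1 in the exponent pays for r^n, which is w at n =
        p^2.\<close>
      also have "\<dots> \<le> w ^ (p + 2 + 1)"
      proof (intro power_decreasing)
        obtain k where p: "p = k + 3" using p_ge_3 by (metis le_add_diff_inverse2)
        show "p + 2 + 1 \<le> P + 1" by (simp add: P_def p algebra_simps)
      qed (use w_pos w_less_1 in auto)
      also have "\<dots> = w ^ (p + 2) * r ^ n"
        using rr[of 0] by (simp only: i 3 power_add) simp
      finally show ?thesis .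
    next
      case (4 j)
      have "n \<noteq> 1" "n \<noteq> p" "n \<noteq> p ^ 2"
        using power_inject_exp[OF p_gt_1, of i 0] power_inject_exp[OF p_gt_1, of i 1] power_inject_exp[OF p_gt_1, of i 2] 4
        by (simp_all add: i)
      then have "fps_nth H n = - (y ^ n / of_nat n)" unfolding Hn using True by simp
      then have "absval (fps_nth H n) = w ^ (p ^ i) / (w ^ P) ^ i"
        by (simp add: absval_divide absval_y absval_p_w i P_def)
      also have "\<dots> \<le> w ^ (p + 2 + p ^ (j + 1) + P * i) / (w ^ P) ^ i"
        using exponent_bound[of j] w_pos w_less_1
        by (intro divide_right_mono power_decreasing) (auto simp: 4 P_def)
      also have "w ^ (p + 2 + p ^ (j + 1) + P * i) = w ^ (p + 2) * w ^ (p ^ (j + 1)) * (w ^ P) ^ i"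
        by (simp only: power_add power_mult)
      also have "\<dots> / (w ^ P) ^ i = w ^ (p + 2) * w ^ (p ^ (j + 1))" using w_pos by simp
      also have "w ^ (p ^ (j + 1)) = r ^ n"
      proof -
        have "j + 1 + 2 = i" using 4 by simp
        then show ?thesis using rr[of "j + 1"] by (simp only: i)
      qed
      finally show ?thesis .
    qed
  qed
qed

definition S :: "'a fps" where "S = fps_Exp G"

lemma G_nth_0 [simp]: "fps_nth G 0 = 0"
  unfolding G_def fps_three_terms_nth using p_pos by simp

lemma S_factor: "S = (AH oo (fps_const y * fps_X)) * fps_Exp H"
proof -
  have lin: "fps_nth (fps_const y * fps_X) 0 = 0" by simp
  have "G = (AH_log oo (fps_const y * fps_X)) + H" by (simp add: H_def)
  then have "S = fps_Exp (AH_log oo (fps_const y * fps_X)) * fps_Exp H"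
    unfolding S_def using G_nth_0 by (simp only:) (rule fps_Exp_add, simp_all add: H_def)
  also have "fps_Exp (AH_log oo (fps_const y * fps_X)) = AH oo (fps_const y * fps_X)"
    unfolding AH_def by (rule fps_compose_assoc[OF lin AH_log_nth_0])
  finally show ?thesis .
qed

lemma w2: "0 \<le> w ^ 2" "w ^ 2 \<le> 1"
  using w_pos w_less_1 by (simp_all add: power_le_one)

lemmas Exp_H = fps_Exp_bounded[OF absval_gamma_pos absval_gamma w2 less_imp_le[OF r_pos] fps_bounded_H]

lemma AH_y_nth: "absval (fps_nth (AH oo (fps_const y * fps_X)) n) \<le> w ^ n"
proof -
  have "w ^ n * absval (fps_nth AH n) \<le> w ^ n * 1"
    using w_pos AH_integral[of n] by (intro mult_left_mono) auto
  then show ?thesis unfolding fps_nth_compose_linear by (simp add: absval_mult absval_y)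
qed

lemma fps_bounded_S: "fps_bounded 1 r S"
proof -
  have "fps_bounded 1 r (AH oo (fps_const y * fps_X))"
    unfolding fps_bounded_def
    using order_trans[OF AH_y_nth power_mono[OF w_le_r less_imp_le[OF w_pos]]]
    by (simp del: fps_nth_compose_linear)
  from fps_bounded_mult[OF this Exp_H(1)] show ?thesis
    unfolding S_factor using r_pos by simp
qed

lemma S_nth_0: "fps_nth S 0 = 1"
  by (simp add: S_def)

lemma S_nth_1: "fps_nth S 1 = y"
  unfolding S_def fps_Exp_nth_1[OF G_nth_0] unfolding G_def fps_three_terms_nth by simp

text \<open>In each product either the Artin--Hasse factor has degree n >= 2, or a nonconstant
  coefficient of the exponential of \<open>H\<close> brings w^2.\<close>

lemma S_nth_le:
  assumes "2 \<le> n"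
  shows "absval (fps_nth S n) \<le> w ^ 2"
  unfolding S_factor fps_mult_nth
proof (rule absval_sum_le)
  fix i assume i: "i \<in> {0..n}"
  have "absval (fps_nth (AH oo (fps_const y * fps_X)) i) * absval (fps_nth (fps_Exp H) (n - i)) \<le> w ^ 2"
  proof (cases "i = n")
    case True
    have "w ^ n \<le> w ^ 2" using assms w_pos w_less_1 by (intro power_decreasing) auto
    then show ?thesis using True AH_y_nth[of n] by simp
  next
    case False
    have "absval (fps_nth (fps_Exp H) (n - i)) \<le> w ^ 2 * r ^ (n - i)"
      using False i by (intro Exp_H(2)) auto
    also have "\<dots> \<le> w ^ 2 * 1"
      using r_pos r_less_1 by (intro mult_left_mono power_le_one) auto
    finally have 1: "absval (fps_nth (fps_Exp H) (n - i)) \<le> w ^ 2" by simp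
    have "w ^ i \<le> 1" using w_pos w_less_1 by (intro power_le_one) auto
    then have 2: "absval (fps_nth (AH oo (fps_const y * fps_X)) i) \<le> 1"
      using AH_y_nth[of i] by linarith
    have "absval (fps_nth (AH oo (fps_const y * fps_X)) i) * absval (fps_nth (fps_Exp H) (n - i)) \<le> 1 * w ^ 2"
      using 1 2 by (intro mult_mono) auto
    then show ?thesis by simp
  qed
  then show "absval (fps_nth (AH oo (fps_const y * fps_X)) i * fps_nth (fps_Exp H) (n - i)) \<le> w ^ 2"
    by (simp only: absval_mult)
qed simp

text \<open>The value is 1 + y up to an error of size w^2, which is below |y| = w.\<close>

lemma absval_value:
  assumes "fps_nth S sums e"
  shows "absval (e - 1) = w"
proof -
  have "(\<lambda>n. \<Sum>i<n. fps_nth S i) \<longlonglongrightarrow> e" using assms by (simp add: sums_def)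
  then have "(\<lambda>n. (\<Sum>i<n. fps_nth S i) + (- 1 - y)) \<longlonglongrightarrow> e + (- 1 - y)"
    by (intro tendsto_add_ultra tendsto_const)
  then have lim: "(\<lambda>n. absval ((\<Sum>i<n. fps_nth S i) + (- 1 - y))) \<longlonglongrightarrow> absval (e + (- 1 - y))"
    by (rule tendsto_absval)
  have "absval (e + (- 1 - y)) \<le> w ^ 2"
  proof (rule LIMSEQ_le_const2[OF lim], intro exI allI impI)
    fix n :: nat assume n: "2 \<le> n"
    have "{..<n} = insert 0 (insert 1 {2..<n})" using n by auto
    then have "(\<Sum>i<n. fps_nth S i) = fps_nth S 0 + (fps_nth S 1 + (\<Sum>i=2..<n. fps_nth S i))"
      by simp
    then have "(\<Sum>i<n. fps_nth S i) + (- 1 - y) = (\<Sum>i=2..<n. fps_nth S i)"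
      by (simp only: S_nth_0 S_nth_1) (simp add: algebra_simps)
    then show "absval ((\<Sum>i<n. fps_nth S i) + (- 1 - y)) \<le> w ^ 2"
      using S_nth_le by (auto intro!: absval_sum_le)
  qed
  also have "w ^ 2 < w"
    using w_pos w_less_1 by (simp add: power2_eq_square)
  finally have "absval (y + (e + (- 1 - y))) = absval y"
    by (intro absval_add_eq_left) (simp add: absval_y)
  then show ?thesis by (simp add: absval_y algebra_simps)
qed

text \<open>With Z = (v X)^p this is Dwork's exponential exp(\<gamma> (Z - Z^p)).\<close>

definition \<Theta> :: "'a fps" where
  "\<Theta> = fps_Exp (fps_const c * fps_X ^ p - fps_const (\<gamma> * v ^ (p ^ 2)) * fps_X ^ (p ^ 2))"

text \<open>
  The two exponentials on the right cancel when evaluated at \<open>T = 1\<close>, and \<open>\<Theta>\<close> has coefficients in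
  \<open>K'\<close>: this is why the \<open>p\<close>-th power of the value lies in \<open>K'\<close>.
\<close>

lemma S_power: "S ^ p = \<Theta> * (fps_exp (of_nat p * y) * (fps_exp (- of_nat p * y) oo fps_X ^ p))"
proof -
  define A B D :: "'a fps" where "A = fps_const c * fps_X ^ p - fps_const (\<gamma> * v ^ (p ^ 2)) * fps_X ^ (p ^ 2)"
    and "B = fps_const (of_nat p * y) * fps_X" and "D = fps_const (- of_nat p * y) * fps_X ^ p"
  have nth0: "fps_nth A 0 = 0" "fps_nth B 0 = 0" "fps_nth D 0 = 0"
    using p_pos by (simp_all add: A_def B_def D_def)
  have "of_nat p * G = A + (B + D)"
  proof (rule fps_ext)
    fix n
    have ABD: "A + (B + D) = fps_const (of_nat p * y) * fps_X + fps_const (c - of_nat p * y) * fps_X ^ p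
        + fps_const (- (\<gamma> * v ^ (p ^ 2))) * fps_X ^ (p ^ 2)"
      unfolding A_def B_def D_def by (rule fps_ext) (simp add: algebra_simps)
    have mult: "fps_nth (of_nat p * G) n = of_nat p * fps_nth G n"
      by (simp add: fps_of_nat[symmetric] del: fps_of_nat)
    have 1: "of_nat p * (c ^ p / of_nat p ^ 2) = - (\<gamma> * v ^ (p ^ 2))"
      unfolding c_power using p_pos by (simp add: power2_eq_square)
    \<comment> \<open>The equation of \<open>y\<close> splits y^p into \<open>c\<close>, which
      belongs to \<open>A\<close>, and -p y, which produces \<open>D\<close>.\<close>
    have 2: "of_nat p * (y ^ p / of_nat p) = c - of_nat p * y"
      using p_pos y_eq by (simp add: algebra_simps)
    show "fps_nth (of_nat p * G) n = fps_nth (A + (B + D)) n"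
      unfolding mult ABD unfolding G_def fps_three_terms_nth
      by (simp only: 1 2 mult_zero_right split: if_split) simp
  qed
  then have "S ^ p = fps_Exp (A + (B + D))"
    unfolding S_def fps_Exp_power[OF G_nth_0] by simp
  also have "\<dots> = fps_Exp A * fps_Exp (B + D)"
    using nth0 by (intro fps_Exp_add) simp_all
  also have "fps_Exp (B + D) = fps_Exp B * fps_Exp D"
    using nth0 by (intro fps_Exp_add) simp_all
  also have "fps_Exp B = fps_exp (of_nat p * y)"
    unfolding B_def by (rule fps_Exp_linear)
  also have "fps_Exp D = fps_exp (- of_nat p * y) oo fps_X ^ p"
  proof -
    have "D = (fps_const (- of_nat p * y) * fps_X) oo fps_X ^ p"
      unfolding D_def using p_pos by (simp add: fps_compose_mult_distrib)
    then have "fps_Exp D = fps_Exp (fps_const (- of_nat p * y) * fps_X) oo fps_X ^ p"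
      using p_pos by (simp only:) (rule fps_compose_assoc, simp_all)
    then show ?thesis by (simp only: fps_Exp_linear)
  qed
  finally show ?thesis by (simp only: \<Theta>_def A_def)
qed

text \<open>|p y| = w^(p(p-1)+1) is at most w^(p+1) = |\<gamma>| w, and |\<gamma>|^n pays for
  n!.\<close>

lemma exp_py_nth:
  assumes "absval (a::'a) = absval (of_nat p * y)"
  shows "absval (fps_nth (fps_exp a) n) \<le> w ^ n"
proof -
  have "w ^ (p + 1) \<ge> w ^ (p * (p - 1) + 1)"
    using w_pos w_less_1 p_ge_3 by (intro power_decreasing) auto
  then have "absval a \<le> absval \<gamma> * w"
    by (simp only: assms absval_mult absval_p_w absval_y w_power_p[symmetric] power_add power_one_right)
  then have "absval a ^ n \<le> (absval \<gamma> * w) ^ n"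
    by (intro power_mono) auto
  also have "\<dots> = absval \<gamma> ^ n * w ^ n" by (rule power_mult_distrib)
  also have "\<dots> \<le> absval (fact n :: 'a) * w ^ n"
    using w_pos by (intro mult_right_mono power_le_absval_fact absval_gamma) auto
  finally have "absval a ^ n / absval (fact n :: 'a) \<le> w ^ n"
    by (simp add: divide_le_eq mult.commute)
  then show ?thesis
    by (simp add: absval_divide[of "a ^ n"])
qed

lemma fps_bounded_exp_py:
  assumes "absval (a::'a) = absval (of_nat p * y)"
  shows "fps_bounded 1 r (fps_exp a)" "fps_bounded 1 r (fps_exp a oo fps_X ^ p)"
proof -
  show "fps_bounded 1 r (fps_exp a)"
    unfolding fps_bounded_def
    using power_mono[OF w_le_r less_imp_le[OF w_pos]] order_trans[OF exp_py_nth[OF assms]]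
    by (simp del: fps_exp_nth)
  show "fps_bounded 1 r (fps_exp a oo fps_X ^ p)"
    unfolding fps_bounded_def
  proof
    fix n
    show "absval (fps_nth (fps_exp a oo fps_X ^ p) n) \<le> 1 * r ^ n"
    proof (cases "p dvd n")
      case True
      then obtain m where m: "n = p * m" ..
      have "absval (fps_nth (fps_exp a) m) \<le> w ^ m" by (rule exp_py_nth[OF assms])
      also have "\<dots> \<le> (r ^ p) ^ m"
        using w_le_r_power_p w_pos by (intro power_mono) auto
      finally show ?thesis
        using p_pos by (simp add: fps_compose_X_power_nth m power_mult del: fps_exp_nth)
    next
      case False
      then show ?thesis using r_pos p_pos by (simp add: fps_compose_X_power_nth)
    qed
  qed
qed

text \<open>The series converges in \<open>L\<close>. Its p-th power is the value of
  \<open>\<Theta>\<close>, because the other factor has value 1, and that value is a limit in the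
  complete field \<open>F\<close>.\<close>

theorem value_exists:
  assumes L: "subfield L ambient" "complete L" "\<omega> \<in> L" "\<gamma> \<in> L" "v \<in> L"
    and F: "subfield F ambient" "complete F" "\<gamma> \<in> F" "v \<in> F"
  shows "\<exists>e\<in>L. fps_nth S sums e \<and> e ^ p \<in> F"
proof -
  have ex: "\<exists>s\<in>E. fps_nth f sums s"
    if "subfield E ambient" "complete E" "fps_in E f" "fps_bounded 1 r f" for E f
    using that r_pos r_less_1 subfield_0[OF that(1)] subfield_add[OF that(1)] fps_bounded_tendsto_0[of 1 r f]
    by (intro summable_in_complete) (auto simp: fps_in_def)
  have cl: "y \<in> L" "c \<in> L" "c \<in> F" "\<gamma> * v ^ (p ^ 2) \<in> F"
    using L F subfield_mult subfield_power unfolding y_def c_def by blast+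
  have "fps_in L G"
    unfolding fps_in_def G_def fps_three_terms_nth
    using cl by (auto intro!: subfield_closed[OF L(1)])
  then have "fps_in L S" unfolding S_def by (rule fps_in_Exp[OF L(1)])
  then obtain e where e: "e \<in> L" "fps_nth S sums e" using ex[OF L(1,2)] fps_bounded_S by blast
  let ?a = "of_nat p * y"
  have abs: "absval ?a = absval (of_nat p * y)" "absval (- ?a) = absval (of_nat p * y)"
    by simp_all
  have "fps_in L (fps_exp a)" if "a \<in> L" for a
  proof -
    have "fps_in L (fps_const a * fps_X)"
      using that subfield_0[OF L(1)] by (auto simp: fps_in_def)
    then show ?thesis using fps_in_Exp[OF L(1)] by (metis fps_Exp_linear)
  qed
  moreover have pyL: "?a \<in> L" "- ?a \<in> L"
    using cl by (auto intro!: subfield_closed[OF L(1)])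
  ultimately obtain x1 x2 where x: "fps_nth (fps_exp ?a) sums x1" "fps_nth (fps_exp (- ?a)) sums x2"
    using ex[OF L(1,2)] fps_bounded_exp_py[OF abs(1)] fps_bounded_exp_py[OF abs(2)] by meson
  have x': "fps_nth (fps_exp ?a oo fps_X ^ p) sums x1" "fps_nth (fps_exp (- ?a) oo fps_X ^ p) sums x2"
    using x fps_sums_compose_X_power[OF p_pos] by blast+
  have r: "0 \<le> (1::real)" "0 \<le> r" "r < 1" using r_pos r_less_1 by simp_all
  note bd = fps_bounded_exp_py[OF abs(1)] fps_bounded_exp_py[OF abs(2)]
  have "fps_exp ?a * fps_exp (- ?a) = 1"
    by (simp add: fps_exp_add_mult[symmetric])
  then have x12: "x1 * x2 = 1"
    using fps_sums_mult[OF bd(1) x(1) bd(3) x(2)] r fps_sums_1 sums_unique2 by fastforce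
  define Z where "Z = fps_exp ?a * (fps_exp (- ?a) oo fps_X ^ p)"
  \<comment> \<open>The exponent of \<open>\<Theta>\<close> has coefficients of size |\<gamma>|,
    where the exponential bound gives no decay. Decay is obtained from
    \<open>\<Theta> = S ^ p * Z'\<close> instead, with \<open>Z'\<close> inverse to
    \<open>Z\<close>.\<close>
  define Z' where "Z' = fps_exp (- ?a) * (fps_exp ?a oo fps_X ^ p)"
  have Z: "fps_bounded 1 r Z" "fps_nth Z sums 1"
    using fps_bounded_mult[OF bd(1) bd(4)] fps_sums_mult[OF bd(1) x(1) bd(4) x'(2)] r x12
    unfolding Z_def by simp_all
  have Z': "fps_bounded 1 r Z'"
    using fps_bounded_mult[OF bd(3) bd(2)] r unfolding Z'_def by simp
  have "Z * Z' = (fps_exp ?a * fps_exp (- ?a)) * ((fps_exp ?a * fps_exp (- ?a)) oo fps_X ^ p)"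
    using p_pos by (simp add: Z_def Z'_def fps_compose_mult_distrib mult_ac)
  also have "\<dots> = 1"
    by (simp only: \<open>fps_exp ?a * fps_exp (- ?a) = 1\<close> fps_compose_1 mult_1)
  finally have ZZ': "Z * Z' = 1" .
  have Sp: "S ^ p = \<Theta> * Z" by (simp add: S_power Z_def)
  then have "\<Theta> = S ^ p * Z'" using ZZ' by (simp add: mult.assoc)
  moreover have bS: "fps_bounded 1 r (S ^ p)"
    using fps_bounded_power[OF fps_bounded_S, of p] r by simp
  ultimately have b\<Theta>: "fps_bounded 1 r \<Theta>"
    using fps_bounded_mult[OF bS Z'] r by simp
  have "fps_in F \<Theta>"
    unfolding \<Theta>_def
    using cl F by (intro fps_in_Exp[OF F(1)]) (auto simp: fps_in_def intro!: subfield_closed[OF F(1)])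
  then obtain \<theta> where \<theta>: "\<theta> \<in> F" "fps_nth \<Theta> sums \<theta>"
    using ex[OF F(1,2)] b\<Theta> by blast
  have "fps_nth (S ^ p) sums (\<theta> * 1)"
    unfolding Sp using fps_sums_mult[OF b\<Theta> \<theta>(2) Z] r by simp
  moreover have "fps_nth (S ^ p) sums (e ^ p)"
    using fps_sums_power[OF fps_bounded_S e(2)] r by simp
  ultimately have "e ^ p = \<theta>" using sums_unique2 by fastforce
  then show ?thesis using e \<theta>(1) by blast
qed

lemma E2_terms: "fps_nth (E2_series p u \<gamma> \<omega>) n * v ^ n = fps_nth S n"
  unfolding S_def E2_rescaled[symmetric] fps_nth_compose_linear by (rule mult.commute)

end

section \<open>Cyclic extensions\<close>

lemma mem_galois_group:
  "\<tau> \<in> carrier (galois_group L K) \<longleftrightarrow> \<tau> \<in> extensional L \<and> bij_betw \<tau> L L \<and>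
     (\<forall>x\<in>L. \<forall>y\<in>L. \<tau> (x + y) = \<tau> x + \<tau> y) \<and> (\<forall>x\<in>L. \<forall>y\<in>L. \<tau> (x * y) = \<tau> x * \<tau> y) \<and>
     \<tau> 1 = 1 \<and> (\<forall>x\<in>K. \<tau> x = x)"
  by (auto simp: galois_group_def ring_hom_def Bij_def bij_betw_apply)

lemma galois_group_mult:
  "f \<in> carrier (galois_group L K) \<Longrightarrow> g \<in> carrier (galois_group L K) \<Longrightarrow>
     f \<otimes>\<^bsub>galois_group L K\<^esub> g = compose L f g"
  by (simp add: galois_group_def BijGroup_def)

lemma galois_group_is_group:
  assumes L: "subfield L ambient" and "K \<subseteq> L"
  shows "group (galois_group L K)"
proof -
  interpret B: group "BijGroup L" by (rule group_BijGroup)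
  have Bij: "\<tau> \<in> Bij L" if "\<tau> \<in> carrier (galois_group L K)" for \<tau>
    using that by (simp add: galois_group_def)
  have inv_mem: "restrict (inv_into L \<tau>) L \<in> carrier (galois_group L K)"
    if \<tau>: "\<tau> \<in> carrier (galois_group L K)" for \<tau>
  proof -
    have b: "bij_betw \<tau> L L" "\<And>x. x \<in> K \<Longrightarrow> \<tau> x = x" "\<tau> 1 = 1"
      using \<tau> by (auto simp: mem_galois_group)
    have inv: "inv_into L \<tau> (\<tau> x) = x" if "x \<in> L" for x
      using b that by (simp add: bij_betw_inv_into_left)
    have "inv_into L \<tau> x = x" if "x \<in> K" for x
      using inv[of x] b(2)[OF that] assms(2) that by auto
    moreover have "inv_into L \<tau> 1 = 1"
      using inv[of 1] b(3) subfield_1[OF L] by simp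
    moreover have "inv_into L \<tau> (x + y) = inv_into L \<tau> x + inv_into L \<tau> y" if "x \<in> L" "y \<in> L" for x y
      using \<tau> that subfield_add[OF L]
      by (intro Bij_inv_into_lemma[OF _ Bij[OF \<tau>]]) (auto simp: mem_galois_group)
    moreover have "inv_into L \<tau> (x * y) = inv_into L \<tau> x * inv_into L \<tau> y" if "x \<in> L" "y \<in> L" for x y
      using \<tau> that subfield_mult[OF L]
      by (intro Bij_inv_into_lemma[OF _ Bij[OF \<tau>]]) (auto simp: mem_galois_group)
    ultimately show ?thesis
      unfolding mem_galois_group
      using bij_betw_inv_into[OF b(1)] subfield_add[OF L] subfield_mult[OF L] subfield_1[OF L] assms(2)
      by (auto cong: bij_betw_cong)
  qed
  have "subgroup (carrier (galois_group L K)) (BijGroup L)"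
  proof (rule B.subgroupI)
    show "carrier (galois_group L K) \<subseteq> carrier (BijGroup L)"
      using Bij by (auto simp: BijGroup_def)
    have "restrict id L \<in> carrier (galois_group L K)"
      unfolding mem_galois_group
      using subfield_add[OF L] subfield_mult[OF L] subfield_1[OF L] assms(2) by (auto simp: bij_betw_def inj_on_def)
    then show "carrier (galois_group L K) \<noteq> {}" by blast
    fix \<tau> assume \<tau>: "\<tau> \<in> carrier (galois_group L K)"
    show "inv\<^bsub>BijGroup L\<^esub> \<tau> \<in> carrier (galois_group L K)"
      using inv_mem[OF \<tau>] inv_BijGroup[OF Bij[OF \<tau>]] by simp
    fix \<sigma> assume \<sigma>: "\<sigma> \<in> carrier (galois_group L K)"
    have "compose L \<tau> \<sigma> \<in> carrier (galois_group L K)"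
    proof -
      have "bij_betw (compose L \<tau> \<sigma>) L L"
        using compose_Bij[OF Bij[OF \<tau>] Bij[OF \<sigma>]] by (simp add: Bij_def)
      moreover have "\<sigma> x \<in> L" if "x \<in> L" for x
        using \<sigma> that by (auto simp: mem_galois_group bij_betw_apply)
      ultimately show ?thesis
        using \<sigma> \<tau> subfield_add[OF L] subfield_mult[OF L] subfield_1[OF L] assms(2)
        by (auto simp: mem_galois_group compose_def)
    qed
    then show "\<tau> \<otimes>\<^bsub>BijGroup L\<^esub> \<sigma> \<in> carrier (galois_group L K)"
      using Bij[OF \<tau>] Bij[OF \<sigma>] by (simp add: BijGroup_def)
  qed
  then have "group (BijGroup L\<lparr>carrier := carrier (galois_group L K)\<rparr>)"
    by (rule B.subgroup_imp_group)
  then show ?thesis by (simp add: galois_group_def)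
qed

lemma funpow_galois_group:
  assumes L: "subfield L ambient" "K \<subseteq> L" and f: "f \<in> carrier (galois_group L K)" and "x \<in> L"
  shows "(f [^]\<^bsub>galois_group L K\<^esub> n) x = (f ^^ n) x"
proof -
  interpret G: group "galois_group L K" by (rule galois_group_is_group[OF L])
  show ?thesis
    using assms(4)
  proof (induction n arbitrary: x)
    case 0
    then show ?case by (simp add: galois_group_def BijGroup_def)
  next
    case (Suc n)
    have "f x \<in> L" using f Suc.prems by (auto simp: mem_galois_group bij_betw_apply)
    then have "(f [^]\<^bsub>galois_group L K\<^esub> n) (f x) = (f ^^ n) (f x)" by (rule Suc.IH)
    then show ?case
      using Suc.prems G.nat_pow_closed[OF f, of n] f
      by (simp add: galois_group_mult compose_def funpow_swap1)
  qed
qed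

section \<open>Cyclicity from a single conjugation\<close>

context ramified_extension
begin

text \<open>\<open>conjugate_poly\<close> treats the generator \<open>x\<close>; iterating the map
  requires the same at its images.\<close>

lemma conjugate_poly_comp:
  assumes "poly P z = 0" "z \<in> adjoin F x" "poly_in F Q" "y \<in> adjoin F x"
  shows "conjugate z (poly Q y) = poly Q (conjugate z y)"
  using assms(3)
proof (induction Q)
  case 0
  then show ?case using conjugate_base[OF assms(1) subfield_0[OF F]] by simp
next
  case (pCons a Q)
  have a: "a \<in> F" and Q: "poly_in F Q"
    using pCons.prems unfolding poly_in_def by (metis coeff_pCons_0, metis coeff_pCons_Suc)
  then have "poly_in (adjoin F x) Q" using adjoin_base[of F x] by (auto simp: poly_in_def)
  then have mem: "poly Q y \<in> adjoin F x" by (rule poly_in_mem[OF adjoin_subfield _ assms(4)])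
  then have prod: "y * poly Q y \<in> adjoin F x"
    by (rule subfield_mult[OF adjoin_subfield assms(4)])
  have "a \<in> adjoin F x" using a adjoin_base[of F x] by blast
  then have "conjugate z (a + y * poly Q y) = a + conjugate z y * conjugate z (poly Q y)"
    using conjugate_add[OF assms(1) _ prod] conjugate_mult[OF assms(1,4) mem] conjugate_base[OF assms(1) a] by simp
  then show ?case using pCons.IH[OF Q] by simp
qed

text \<open>The first \<open>M\<close> iterates of \<open>x\<close> are distinct roots of
  \<open>P\<close>, hence all its roots. An automorphism is determined by the image of
  \<open>x\<close>, which is one of them, so it is a power of the conjugation.\<close>

lemma cyclic_of_conjugate:
  assumes z: "poly P z = 0" "z \<in> adjoin F x" "absval z = absval x"
    and order: "\<And>k. (conjugate z ^^ k) x = x \<Longrightarrow> M dvd k"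
  shows "cyclic_extension (adjoin F x) F"
proof -
  define L where "L = adjoin F x"
  define \<sigma> where "\<sigma> = conjugate z"
  have L: "subfield L ambient" "F \<subseteq> L" "x \<in> L"
    by (simp_all add: L_def adjoin_subfield adjoin_base adjoin_generator)
  have \<sigma>L: "\<sigma> y \<in> L" if "y \<in> L" for y
    using conjugate_mem[OF z(1,2)] that by (simp add: L_def \<sigma>_def)
  have \<sigma>_add: "\<sigma> (y + t) = \<sigma> y + \<sigma> t" and \<sigma>_mult: "\<sigma> (y * t) = \<sigma> y * \<sigma> t" if "y \<in> L" "t \<in> L" for y t
    using conjugate_add[OF z(1)] conjugate_mult[OF z(1)] that by (simp_all add: L_def \<sigma>_def)
  have \<sigma>_base: "\<sigma> a = a" if "a \<in> F" for a
    using conjugate_base[OF z(1) that] by (simp add: \<sigma>_def)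
  have pow_L: "(\<sigma> ^^ k) y \<in> L" if "y \<in> L" for k y
    using that by (induction k) (auto simp: \<sigma>L)
  have pow_poly: "(\<sigma> ^^ k) (poly Q y) = poly Q ((\<sigma> ^^ k) y)" if "poly_in F Q" "y \<in> L" for k Q y
  proof (induction k)
    case (Suc k)
    then show ?case
      using conjugate_poly_comp[OF z(1,2) that(1), of "(\<sigma> ^^ k) y"] pow_L[OF that(2), of k]
      by (simp add: \<sigma>_def L_def)
  qed simp
  have \<sigma>_inj: "inj_on \<sigma> L"
  proof (rule inj_onI)
    fix y t assume yt: "y \<in> L" "t \<in> L" "\<sigma> y = \<sigma> t"
    have "\<sigma> (y - t) + \<sigma> t = \<sigma> y" using \<sigma>_add[of "y - t" t] yt subfield_diff[OF L(1)] by simp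
    then have "\<sigma> (y - t) = 0" using yt(3) by simp
    then have "absval (y - t) = 0"
      using absval_conjugate[OF z(1,3), of "y - t"] yt subfield_diff[OF L(1)] by (simp add: \<sigma>_def L_def)
    then show "y = t" by simp
  qed
  have pow_inj: "y = t" if "(\<sigma> ^^ k) y = (\<sigma> ^^ k) t" "y \<in> L" "t \<in> L" for k y t
    using that
  proof (induction k)
    case (Suc k)
    then show ?case using inj_onD[OF \<sigma>_inj] pow_L by simp
  qed simp
  define orb where "orb k = (\<sigma> ^^ k) x" for k
  have orb_root: "poly P (orb k) = 0" for k
  proof -
    have "(\<sigma> ^^ k) (0::'a) = 0" by (induction k) (simp_all add: \<sigma>_base subfield_0[OF F])
    then show ?thesis using pow_poly[OF P(1) L(3), of k] P(4) by (simp add: orb_def)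
  qed
  have orb_eq: "M dvd j - i" if "orb i = orb j" "i \<le> j" for i j
  proof -
    have "(\<sigma> ^^ i) ((\<sigma> ^^ (j - i)) x) = (\<sigma> ^^ i) x"
      using that by (simp add: orb_def funpow_add[symmetric, unfolded comp_def, THEN fun_cong])
    then have "(\<sigma> ^^ (j - i)) x = x" using pow_inj pow_L L(3) by blast
    then show ?thesis using order by (simp add: \<sigma>_def)
  qed
  have "inj_on orb {..<M}"
  proof (rule linorder_inj_onI')
    fix i j assume ij: "i \<in> {..<M}" "j \<in> {..<M}" "i < j"
    then show "orb i \<noteq> orb j" using orb_eq[of i j] nat_dvd_not_less[of "j - i" M] by force
  qed
  then have card: "card (orb ` {..<M}) = M" by (simp add: card_image)
  have "P \<noteq> 0" using P(3) by auto
  have roots: "{t. poly P t = 0} = orb ` {..<M}"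
  proof (rule sym, rule card_seteq)
    show "finite {t. poly P t = 0}" by (rule poly_roots_finite[OF \<open>P \<noteq> 0\<close>])
    show "orb ` {..<M} \<subseteq> {t. poly P t = 0}" using orb_root by auto
    show "card {t. poly P t = 0} \<le> card (orb ` {..<M})"
      using card_poly_roots_bound[OF \<open>P \<noteq> 0\<close>] P(2) card by simp
  qed
  \<comment> \<open>As a root, \<open>orb M\<close> is some \<open>orb k\<close> with k < M; then M
    divides M - k, which forces k = 0.\<close>
  have "orb M = x"
  proof -
    have "orb M \<in> orb ` {..<M}" using roots orb_root by blast
    then obtain k where k: "k < M" "orb k = orb M" by auto
    then have "M dvd M - k" by (intro orb_eq) auto
    then have "k = 0" using k(1) by (cases k) (auto dest: dvd_imp_le)
    then show ?thesis using k(2) by (simp add: orb_def)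
  qed
  have pow_M: "(\<sigma> ^^ M) y = y" if yL: "y \<in> L" for y
  proof -
    obtain Q where Q: "poly_in F Q" "y = poly Q x" using adjoin_poly_in yL unfolding L_def by blast
    then show ?thesis using pow_poly[OF Q(1) L(3), of M] \<open>orb M = x\<close> by (simp add: orb_def)
  qed
  have "\<sigma> ` L = L"
  proof
    show "L \<subseteq> \<sigma> ` L"
    proof
      fix y assume y: "y \<in> L"
      have "y = \<sigma> ((\<sigma> ^^ (M - 1)) y)"
        using pow_M[OF y] M by (cases M) auto
      then show "y \<in> \<sigma> ` L" using pow_L[OF y] by blast
    qed
  qed (use \<sigma>L in auto)
  then have bij: "bij_betw \<sigma> L L" using \<sigma>_inj by (simp add: bij_betw_def)
  define \<rho> where "\<rho> = restrict \<sigma> L"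
  have \<rho>: "\<rho> \<in> carrier (galois_group L F)"
    unfolding mem_galois_group
    using bij \<sigma>_add \<sigma>_mult \<sigma>_base subfield_1[OF F] subfield_1[OF L(1)] subfield_add[OF L(1)] subfield_mult[OF L(1)] L(2)
    by (auto simp: \<rho>_def cong: bij_betw_cong)
  have \<rho>_pow: "(\<rho> ^^ k) y = (\<sigma> ^^ k) y" if "y \<in> L" for k y
    using that pow_L by (induction k) (simp_all add: \<rho>_def)
  interpret G: group "galois_group L F" by (rule galois_group_is_group[OF L(1,2)])
  have gal_pow: "\<exists>k::nat. \<tau> = \<rho> [^]\<^bsub>galois_group L F\<^esub> k" if \<tau>: "\<tau> \<in> carrier (galois_group L F)" for \<tau>
  proof -
    have \<tau>L: "\<tau> y \<in> L" if "y \<in> L" for y using \<tau> that by (auto simp: mem_galois_group bij_betw_apply)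
    have \<tau>_poly: "\<tau> (poly Q x) = poly Q (\<tau> x)" if "poly_in F Q" for Q
      using that
    proof (induction Q)
      case 0
      then show ?case using \<tau> subfield_0[OF F] by (auto simp: mem_galois_group)
    next
      case (pCons a Q)
      have a: "a \<in> F" and Q: "poly_in F Q"
        using pCons.prems unfolding poly_in_def by (metis coeff_pCons_0, metis coeff_pCons_Suc)
      then have "poly_in L Q" using L(2) by (auto simp: poly_in_def)
      then have "poly Q x \<in> L" by (rule poly_in_mem[OF L(1) _ L(3)])
      then show ?case
        using a Q pCons.IH \<tau> L subfield_mult[OF L(1)] by (auto simp: mem_galois_group)
    qed
    have "poly P (\<tau> x) = 0"
      using \<tau>_poly[OF P(1)] P(4) \<tau> subfield_0[OF F] by (auto simp: mem_galois_group)
    then obtain k where k: "\<tau> x = orb k" using roots by blast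
    have "\<tau> y = (\<rho> [^]\<^bsub>galois_group L F\<^esub> k) y" if y: "y \<in> L" for y
    proof -
      obtain Q where Q: "poly_in F Q" "y = poly Q x" using adjoin_poly_in y unfolding L_def by blast
      have "\<tau> y = poly Q (orb k)" using \<tau>_poly[OF Q(1)] by (simp add: Q(2) k)
      also have "\<dots> = (\<sigma> ^^ k) y" using pow_poly[OF Q(1) L(3), of k] by (simp add: Q(2) orb_def)
      finally show ?thesis using funpow_galois_group[OF L(1,2) \<rho> y] \<rho>_pow[OF y] by simp
    qed
    moreover have "\<tau> \<in> extensional L" "\<rho> [^]\<^bsub>galois_group L F\<^esub> k \<in> extensional L"
      using \<tau> G.nat_pow_closed[OF \<rho>, of k] by (simp_all add: mem_galois_group)
    ultimately show ?thesis by (intro exI[of _ k] extensionalityI) auto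
  qed
  have fixed: "{y \<in> L. \<forall>\<tau>\<in>carrier (galois_group L F). \<tau> y = y} = F"
  proof (intro equalityI subsetI)
    fix y assume "y \<in> {y \<in> L. \<forall>\<tau>\<in>carrier (galois_group L F). \<tau> y = y}"
    then have y: "y \<in> L" "\<sigma> y = y" using \<rho> by (auto simp: \<rho>_def)
    then have fixk: "(\<sigma> ^^ k) y = y" for k by (induction k) auto
    obtain Q where Q: "Q \<in> poly_below F M" "y = poly Q x" using adjoin_poly y(1) unfolding L_def by blast
    then have Qk: "poly Q (orb k) = y" for k
      using pow_poly[of Q x k] L(3) fixk[of k] by (simp add: orb_def poly_below_def)
    \<comment> \<open>For a fixed \<open>y\<close> the polynomial \<open>Q\<close> takes the value
      \<open>y\<close> at \<open>M\<close> points, too many for its degree unless it is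
      constant.\<close>
    have "Q - [:y:] = 0"
    proof (rule ccontr)
      assume nz: "Q - [:y:] \<noteq> 0"
      have "orb ` {..<M} \<subseteq> {t. poly (Q - [:y:]) t = 0}" using Qk by auto
      then have "M \<le> card {t. poly (Q - [:y:]) t = 0}"
        using card card_mono[OF poly_roots_finite[OF nz]] by metis
      also have "\<dots> \<le> Polynomial.degree (Q - [:y:])" by (rule card_poly_roots_bound[OF nz])
      also have "\<dots> < M"
      proof -
        have "Polynomial.coeff (Q - [:y:]) i = 0" if "M \<le> i" for i
          using that Q(1) M by (cases i) (auto simp: poly_below_def)
        moreover have "Polynomial.coeff (Q - [:y:]) (Polynomial.degree (Q - [:y:])) \<noteq> 0"
          using nz leading_coeff_0_iff[of "Q - [:y:]"] by blast
        ultimately show ?thesis by (meson not_le)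
      qed
      finally show False by simp
    qed
    then have "Polynomial.coeff Q 0 = y" by simp
    then show "y \<in> F" using Q(1) unfolding poly_below_def poly_in_def by blast
  next
    fix y assume "y \<in> F"
    then show "y \<in> {y \<in> L. \<forall>\<tau>\<in>carrier (galois_group L F). \<tau> y = y}"
      using L(2) by (auto simp: mem_galois_group)
  qed
  have "cyclic_group (galois_group L F)"
    unfolding G.cyclic_group
  proof (rule bexI[OF _ \<rho>], intro equalityI subsetI)
    fix \<tau> assume "\<tau> \<in> carrier (galois_group L F)"
    then obtain k :: nat where "\<tau> = \<rho> [^]\<^bsub>galois_group L F\<^esub> k" using gal_pow by blast
    then have "\<tau> = \<rho> [^]\<^bsub>galois_group L F\<^esub> int k" by (simp add: int_pow_int)
    then show "\<tau> \<in> range (\<lambda>n::int. \<rho> [^]\<^bsub>galois_group L F\<^esub> n)" by blast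
  qed (use G.int_pow_closed[OF \<rho>] in auto)
  moreover have "finite_galois_extension L F"
    unfolding finite_galois_extension_def using F L fixed degree_adjoin[folded L_def] by blast
  ultimately show ?thesis by (simp add: cyclic_extension_def L_def)
qed

end

section \<open>Artin--Schreier form and a second root\<close>

context kummer_data
begin

text \<open>
  With \<open>x = \<omega> v / \<gamma>\<close>, so that \<open>absval x ^ p = p\<close>, the number \<open>\<omega> + (\<gamma>/v) s\<close> is another root
  iff \<open>(x + s)^p - x^p = s\<close>. The left-hand side is a contraction near \<open>s = 1\<close>.
\<close>

lemma second_root:
  assumes L: "subfield L ambient" "complete L" "\<omega> \<in> L" "\<gamma> \<in> L" "v \<in> L"
  shows "\<exists>s\<in>L. absval (s - 1) < 1 \<and>
    (\<omega> + \<gamma> / v * s) ^ p + u * of_nat p * (\<omega> + \<gamma> / v * s) = \<gamma>"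
proof -
  define x where "x = \<omega> * v / \<gamma>"
  define R where "R = absval x"
  have v0: "v \<noteq> 0" using absval_v by auto
  have \<gamma>0: "\<gamma> \<noteq> 0" using absval_gamma_pos by auto
  have xL: "x \<in> L" unfolding x_def using L by (intro subfield_closed[OF L(1)])
  have Rp: "R ^ p = real p"
  proof -
    have "R = w / absval \<gamma>" by (simp add: R_def x_def absval_divide absval_mult absval_v w_def)
    then have "R ^ p = absval \<gamma> / absval \<gamma> ^ p"
      by (simp only: power_divide w_power_p)
    also have "absval \<gamma> ^ p = absval \<gamma> ^ (p - 1) * absval \<gamma>"
      using power_minus_mult[OF p_pos] by metis
    finally show ?thesis unfolding absval_gamma using absval_gamma_pos p_pos by simp
  qed
  have R0: "0 < R"
  proof -
    have "R \<noteq> 0" using Rp p_pos by (auto simp: power_0_left)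
    then show ?thesis by (simp add: R_def)
  qed
  have R1: "1 < R"
  proof (rule ccontr)
    assume "\<not> 1 < R"
    then have "R ^ p \<le> 1" using R0 by (intro power_le_one) auto
    then show False using Rp real_p_gt_1 by simp
  qed
  have Rq: "R ^ (p - 1) / real p = 1 / R"
    using power_minus_mult[OF p_pos, of R] R0 p_pos Rp by (simp add: field_simps)
  define \<phi> where "\<phi> s = (x + s) ^ p - x ^ p" for s
  \<comment> \<open>The radius 1/R bounds the distance of \<open>\<phi> 1\<close> from 1 and is also
    the Lipschitz constant. Cutting the ball down to \<open>L\<close> makes it complete.\<close>
  define C where "C = L \<inter> cball 1 (1 / R)"
  have memC: "s \<in> C \<longleftrightarrow> s \<in> L \<and> absval (s - 1) \<le> 1 / R" for s
    unfolding C_def Int_iff mem_cball dist_commute[of 1] dist_absval[of s] ..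
  have lip: "absval (\<phi> s - \<phi> t) \<le> 1 / R * absval (s - t)" if st: "s \<in> C" "t \<in> C" for s t
  proof -
    have h: "absval (s - t) \<le> 1 / R"
      using absval_diff_leI[of "s - 1" "1 / R" "t - 1"] st by (simp add: memC)
    have "1 / R \<le> 1" using R1 by simp
    then have "absval (t - 1) \<le> 1" using st(2) unfolding memC by linarith
    then have "absval t \<le> 1" using absval_add_leI[of "t - 1" 1 1] by simp
    then have "absval t < absval x" using R1 by (simp add: R_def)
    then have a: "absval (x + t) = R" unfolding R_def by (rule absval_add_eq_left)
    have "absval (s - t) \<le> absval (x + t)"
      using h R1 unfolding a by (smt (verit) divide_le_eq_1)
    then have "absval (((x + t) + (s - t)) ^ p - (x + t) ^ p - (s - t) ^ p)
        \<le> R ^ (p - 1) * absval (s - t) / real p"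
      using absval_freshman_le[of "s - t" "x + t"] unfolding a by simp
    also have "\<dots> = R ^ (p - 1) / real p * absval (s - t)" by simp
    finally have 1: "absval (\<phi> s - \<phi> t - (s - t) ^ p) \<le> 1 / R * absval (s - t)"
      unfolding Rq by (simp add: \<phi>_def algebra_simps)
    have "absval (s - t) ^ p = absval (s - t) ^ (p - 1) * absval (s - t)"
      using power_minus_mult[OF p_pos] by metis
    also have "\<dots> \<le> absval (s - t) ^ 1 * absval (s - t)"
      using h R1 p_ge_3 by (intro mult_right_mono power_decreasing) (auto intro: order_trans)
    also have "\<dots> \<le> 1 / R * absval (s - t)"
      using h by (simp only: power_one_right) (rule mult_right_mono, simp_all)
    finally have 2: "absval ((s - t) ^ p) \<le> 1 / R * absval (s - t)" by simp
    from absval_add_leI[OF 1 2] show ?thesis by simp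
  qed
  have "\<phi> ` C \<subseteq> C"
  proof
    fix t assume "t \<in> \<phi> ` C"
    then obtain s where s: "s \<in> C" "t = \<phi> s" by blast
    have 1: "1 \<in> C" using R0 subfield_1[OF L(1)] by (simp add: memC)
    have "absval ((x + 1) ^ p - x ^ p - 1 ^ p) \<le> absval x ^ (p - 1) * absval (1::'a) / real p"
      using R1 by (intro absval_freshman_le) (simp add: R_def)
    then have "absval (\<phi> 1 - 1) \<le> 1 / R"
      unfolding R_def[symmetric] absval_1 mult_1_right Rq by (simp add: \<phi>_def)
    moreover have "absval (\<phi> s - \<phi> 1) \<le> 1 / R"
    proof -
      have "1 / R * absval (s - 1) \<le> 1 * (1 / R)"
        using s(1) R1 by (intro mult_mono) (auto simp: memC)
      then show ?thesis using lip[OF s(1) 1] by linarith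
    qed
    ultimately have "absval (t - 1) \<le> 1 / R" unfolding s(2) using absval_diff_trans_le by blast
    moreover have "t \<in> L"
      unfolding s(2) \<phi>_def using s(1) xL by (intro subfield_closed[OF L(1)]) (auto simp: memC)
    ultimately show "t \<in> C" by (simp add: memC)
  qed
  moreover have "complete C" "C \<noteq> {}"
  proof -
    show "complete C" unfolding C_def by (rule complete_Int_closed[OF L(2) closed_cball])
    have "1 \<in> C" using R0 subfield_1[OF L(1)] by (simp add: memC)
    then show "C \<noteq> {}" by blast
  qed
  moreover have "dist (\<phi> s) (\<phi> t) \<le> 1 / R * dist s t" if "s \<in> C" "t \<in> C" for s t
    using lip[OF that] by (simp only: dist_absval[of s] dist_absval[of "\<phi> s"])
  moreover have "0 \<le> 1 / R" "1 / R < 1" using R1 by simp_all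
  ultimately have "\<exists>!s\<in>C. \<phi> s = s" by (intro Banach_fix)
  then obtain s where s: "s \<in> C" "\<phi> s = s" by blast
  \<comment> \<open>Since \<kappa>^(p-1) = -u p, the value of the polynomial at \<kappa> t is
    \<kappa>^p (t^p - t).\<close>
  define \<kappa> where "\<kappa> = \<gamma> / v"
  have \<kappa>x: "\<kappa> * x = \<omega>" using v0 \<gamma>0 by (simp add: \<kappa>_def x_def)
  have \<kappa>p: "u * of_nat p * \<kappa> = - (\<kappa> ^ p)"
  proof -
    have "u = v / v ^ p" using u v0 by (simp add: field_simps)
    then show ?thesis using v0 by (simp add: \<kappa>_def power_divide gamma_p)
  qed
  have factor: "(\<kappa> * t) ^ p + u * of_nat p * (\<kappa> * t) = \<kappa> ^ p * (t ^ p - t)" for t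
  proof -
    have "u * of_nat p * (\<kappa> * t) = (u * of_nat p * \<kappa>) * t" by (simp add: mult.assoc)
    then show ?thesis unfolding \<kappa>p by (simp add: power_mult_distrib algebra_simps)
  qed
  have "(x + s) ^ p - (x + s) = x ^ p - x" using s(2) by (simp add: \<phi>_def algebra_simps)
  then have "(\<kappa> * (x + s)) ^ p + u * of_nat p * (\<kappa> * (x + s)) = (\<kappa> * x) ^ p + u * of_nat p * (\<kappa> * x)"
    unfolding factor by simp
  also have "\<kappa> * (x + s) = \<omega> + \<gamma> / v * s" using \<kappa>x by (simp add: distrib_left \<kappa>_def)
  finally have "(\<omega> + \<gamma> / v * s) ^ p + u * of_nat p * (\<omega> + \<gamma> / v * s) = \<gamma>"
    by (simp only: \<kappa>x omega)
  moreover have "absval (s - 1) < 1"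
  proof -
    have "1 / R < 1" using R1 by simp
    then show ?thesis using s(1) unfolding memC by linarith
  qed
  ultimately show ?thesis using s(1) memC by blast
qed

end

section \<open>The extensions generated by the roots\<close>

lemma monic_add_lower:
  fixes A B :: "'b::comm_ring_1 poly"
  assumes "Polynomial.degree A = n" "Polynomial.coeff A n = 1" "Polynomial.degree B < n"
  shows "Polynomial.degree (A + B) = n" "Polynomial.coeff (A + B) n = 1"
  using assms by (simp_all add: degree_add_eq_left coeff_eq_0)

lemma monic_diff_lower:
  fixes A B :: "'b::comm_ring_1 poly"
  assumes "Polynomial.degree A = n" "Polynomial.coeff A n = 1" "Polynomial.degree B < n"
  shows "Polynomial.degree (A - B) = n" "Polynomial.coeff (A - B) n = 1"
  using monic_add_lower[of A n "- B"] assms by simp_all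

text \<open>For n = p this puts the (p - 1)-th roots of unity among those that lie in
  \<open>K\<close>.\<close>

lemma minus_1_dvd_power_minus_1: "(n - 1 :: nat) dvd n ^ d - 1"
proof (cases "n = 0")
  case False
  have "int n - 1 dvd int n ^ d - 1"
    by (metis dvd_triv_left power_diff_1_eq)
  then have "int (n - 1) dvd int (n ^ d - 1)"
    using False by (simp add: of_nat_diff)
  then show ?thesis by (simp only: int_dvd_int_iff)
qed (cases d, auto)

context kummer_data
begin

lemma f_poly_monic:
  "Polynomial.degree (f_poly p u) = p" "Polynomial.coeff (f_poly p u) p = 1"
proof -
  have "Polynomial.degree (Polynomial.monom (u * of_nat p) 1 :: 'a poly) < p"
    using degree_monom_le[of "u * of_nat p" 1] p_gt_1 by linarith
  moreover have "Polynomial.degree (Polynomial.monom 1 p :: 'a poly) = p" "Polynomial.coeff (Polynomial.monom 1 p :: 'a poly) p = 1"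
    by (simp_all add: degree_monom_eq)
  ultimately show "Polynomial.degree (f_poly p u) = p" "Polynomial.coeff (f_poly p u) p = 1"
    unfolding f_poly_def using monic_add_lower by blast+
qed

lemma poly_f_poly: "poly (f_poly p u) x = x ^ p + u * of_nat p * x"
  by (simp add: f_poly_def poly_monom)

lemma poly_in_f_poly: "subfield F ambient \<Longrightarrow> u \<in> F \<Longrightarrow> poly_in F (f_poly p u)"
  unfolding f_poly_def
  by (intro poly_in_add poly_in_monom subfield_mult subfield_1 subfield_of_nat)

lemma u_in:
  assumes "subfield F ambient" "v \<in> F"
  shows "u \<in> F"
proof -
  have "v \<noteq> 0" using absval_v by auto
  then have "u = v / v ^ p" using u by (simp add: field_simps)
  then show ?thesis
    using assms subfield_divide[OF assms(1) assms(2) subfield_power[OF assms(1,2)]] by simp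
qed

lemma ramified_gamma:
  assumes K: "subfield K ambient" "values_in 1 K"
  shows "ramified_extension p K \<gamma> 1 (p - 1) (Polynomial.monom 1 (p - 1) + [:of_nat p:])"
proof (intro ramified_extension.intro ramified_extension_axioms.intro padic_closed_field_axioms)
  have "Polynomial.degree (Polynomial.monom 1 (p - 1) :: 'a poly) = p - 1"
      "Polynomial.coeff (Polynomial.monom 1 (p - 1) :: 'a poly) (p - 1) = 1" "Polynomial.degree [:of_nat p :: 'a:] < p - 1"
    using p_gt_1 by (simp_all add: degree_monom_eq)
  then show "Polynomial.degree (Polynomial.monom 1 (p - 1) + [:of_nat p:] :: 'a poly) = p - 1"
      "Polynomial.coeff (Polynomial.monom 1 (p - 1) + [:of_nat p:] :: 'a poly) (p - 1) = 1"
    by (rule monic_add_lower)+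
  show "poly_in K (Polynomial.monom 1 (p - 1) + [:of_nat p:])"
    by (intro poly_in_add poly_in_monom poly_in_const subfield_1 subfield_of_nat K(1))
  show "poly (Polynomial.monom 1 (p - 1) + [:of_nat p:]) \<gamma> = 0"
    using gamma by (simp add: poly_monom)
qed (use K p_gt_1 absval_gamma in auto)

lemma ramified_omega_gamma:
  assumes F: "subfield F ambient" "values_in (p - 1) F" "\<gamma> \<in> F" "v \<in> F"
  shows "ramified_extension p F \<omega> (p - 1) p (f_poly p u - [:\<gamma>:])"
proof (intro ramified_extension.intro ramified_extension_axioms.intro padic_closed_field_axioms)
  have "Polynomial.degree [:\<gamma>:] < p" using p_pos by simp
  then show "Polynomial.degree (f_poly p u - [:\<gamma>:]) = p" "Polynomial.coeff (f_poly p u - [:\<gamma>:]) p = 1"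
    by (rule monic_diff_lower[OF f_poly_monic])+
  show "poly_in F (f_poly p u - [:\<gamma>:])"
    by (intro poly_in_diff poly_in_f_poly poly_in_const u_in F)
  show "poly (f_poly p u - [:\<gamma>:]) \<omega> = 0"
    by (simp add: poly_f_poly omega)
  show "absval \<omega> ^ (p * (p - 1)) = 1 / real p"
    using w_power by (simp only: w_def)
qed (use F p_gt_1 in auto)

text \<open>The value \<open>e\<close> is a unit, so its own size says nothing; \<open>e - 1\<close>
  has size \<open>w\<close> and is a root of (X + 1)^p - e^p.\<close>

lemma ramified_kummer:
  assumes F: "subfield F ambient" "values_in (p - 1) F" and e: "e ^ p \<in> F" "absval (e - 1) = w"
  shows "ramified_extension p F (e - 1) (p - 1) p ([:1, 1:] ^ p - [:e ^ p:])"
proof (intro ramified_extension.intro ramified_extension_axioms.intro padic_closed_field_axioms)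
  have deg: "Polynomial.degree ([:1, 1:] ^ p :: 'a poly) = p"
    by (simp add: degree_power_eq)
  moreover have "Polynomial.coeff ([:1, 1:] ^ p :: 'a poly) p = 1"
    using lead_coeff_power[of "[:1, 1 :: 'a:]" p] deg by simp
  moreover have "Polynomial.degree [:e ^ p:] < p" using p_pos by simp
  ultimately show "Polynomial.degree ([:1, 1:] ^ p - [:e ^ p:]) = p" "Polynomial.coeff ([:1, 1:] ^ p - [:e ^ p:]) p = 1"
    by (rule monic_diff_lower)+
  have "poly_in F [:1, 1:]"
    using subfield_0[OF F(1)] subfield_1[OF F(1)] by (auto simp: poly_in_def coeff_pCons split: nat.splits)
  then show "poly_in F ([:1, 1:] ^ p - [:e ^ p:])"
    by (intro poly_in_diff poly_in_power poly_in_const F(1) e(1))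
  show "absval (e - 1) ^ (p * (p - 1)) = 1 / real p"
    unfolding e(2) by (rule w_power)
qed (use F p_gt_1 in auto)

text \<open>Eliminating \<gamma> from f_u(\<omega>) = \<gamma> and \<gamma>^(p-1) = -p gives an
  equation over \<open>K\<close>, so the whole extension is a single ramified step.\<close>

lemma ramified_omega:
  assumes K: "subfield K ambient" "values_in 1 K" "v \<in> K"
  shows "ramified_extension p K \<omega> 1 (p * (p - 1)) (f_poly p u ^ (p - 1) + [:of_nat p:])"
proof (intro ramified_extension.intro ramified_extension_axioms.intro padic_closed_field_axioms)
  have "f_poly p u \<noteq> 0" using f_poly_monic(2) by (metis coeff_0 zero_neq_one)
  then have deg: "Polynomial.degree (f_poly p u ^ (p - 1)) = p * (p - 1)"
    by (simp add: degree_power_eq f_poly_monic(1))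
  moreover have "Polynomial.coeff (f_poly p u ^ (p - 1)) (p * (p - 1)) = 1"
    using lead_coeff_power[of "f_poly p u" "p - 1"] deg f_poly_monic by simp
  moreover have "Polynomial.degree [:of_nat p :: 'a:] < p * (p - 1)" using p_gt_1 by simp
  ultimately show "Polynomial.degree (f_poly p u ^ (p - 1) + [:of_nat p:]) = p * (p - 1)"
      "Polynomial.coeff (f_poly p u ^ (p - 1) + [:of_nat p:]) (p * (p - 1)) = 1"
    by (rule monic_add_lower)+
  show "poly_in K (f_poly p u ^ (p - 1) + [:of_nat p:])"
    by (intro poly_in_add poly_in_power poly_in_f_poly poly_in_const subfield_of_nat u_in K)
  show "poly (f_poly p u ^ (p - 1) + [:of_nat p:]) \<omega> = 0"
    using gamma by (simp add: poly_f_poly omega)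
  show "absval \<omega> ^ (p * (p - 1) * 1) = 1 / real p"
    using w_power by (simp only: w_def mult_1_right)
qed (use K p_gt_1 in auto)

text \<open>The conjugation \<open>\<omega> \<mapsto> \<eta> (\<omega> + (\<gamma>/v) s)\<close> has full order: up to terms smaller than
  \<open>\<gamma>\<close>, its \<open>k\<close>-th iterate sends \<open>\<omega>\<close> to \<open>\<eta>^k (\<omega> + k \<gamma>/v)\<close>.\<close>

lemma cyclic_omega:
  assumes K: "subfield K ambient" "values_in 1 K" "v \<in> K"
    and roots: "\<And>\<eta>. \<eta> ^ (p - 1) = 1 \<Longrightarrow> \<eta> \<in> K"
    and complete: "complete (adjoin K \<omega>)"
  shows "cyclic_extension (adjoin K \<omega>) K"
proof -
  interpret R: ramified_extension type p K \<omega> 1 "p * (p - 1)" "f_poly p u ^ (p - 1) + [:of_nat p:]"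
    by (rule ramified_omega[OF K])
  define L where "L = adjoin K \<omega>"
  have L: "subfield L ambient" "K \<subseteq> L" "\<omega> \<in> L"
    by (simp_all add: L_def adjoin_subfield adjoin_base adjoin_generator)
  have vL: "v \<in> L" and uL: "u \<in> L" using L(2) K(3) u_in[OF K(1,3)] by auto
  have \<gamma>L: "\<gamma> \<in> L"
    unfolding omega[symmetric] using uL L(3) by (intro subfield_closed[OF L(1)])
  have v0: "v \<noteq> 0" using absval_v by auto
  obtain s where s: "s \<in> L" "absval (s - 1) < 1"
      "(\<omega> + \<gamma> / v * s) ^ p + u * of_nat p * (\<omega> + \<gamma> / v * s) = \<gamma>"
    using second_root[OF L(1) _ L(3) \<gamma>L vL] complete by (auto simp: L_def)
  obtain \<eta> :: 'a where \<eta>: "\<eta> ^ (p - 1) = 1" "\<And>k. \<eta> ^ k = 1 \<Longrightarrow> (p - 1) dvd k"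
    using primitive_root_of_unity by blast
  have \<eta>K: "\<eta> \<in> K" using roots[OF \<eta>(1)] .
  have absval_\<eta>: "absval \<eta> = 1" using absval_root_of_unity[OF \<eta>(1)] p_gt_1 by simp
  have \<eta>0: "\<eta> \<noteq> 0" using absval_\<eta> by auto
  \<comment> \<open>The translation alone would fix \<gamma>; the factor \<open>\<eta>\<close> turns
    \<gamma> into \<eta> \<gamma>, which has the same (p - 1)-th power.\<close>
  define z where "z = \<eta> * (\<omega> + \<gamma> / v * s)"
  have f_z: "poly (f_poly p u) z = \<eta> * \<gamma>"
  proof -
    have "\<eta> ^ p = \<eta>" using power_minus_mult[OF p_pos, of \<eta>] \<eta>(1) by simp
    then have "(\<eta> * A) ^ p + u * of_nat p * (\<eta> * A) = \<eta> * (A ^ p + u * of_nat p * A)" for A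
      by (simp add: power_mult_distrib algebra_simps)
    then have "poly (f_poly p u) z = \<eta> * ((\<omega> + \<gamma> / v * s) ^ p + u * of_nat p * (\<omega> + \<gamma> / v * s))"
      unfolding poly_f_poly z_def .
    then show ?thesis unfolding s(3) .
  qed
  have z: "poly (f_poly p u ^ (p - 1) + [:of_nat p:]) z = 0"
    using gamma \<eta>(1) by (simp add: f_z power_mult_distrib)
  have zL: "z \<in> adjoin K \<omega>"
    unfolding L_def[symmetric] z_def using \<eta>K L(2,3) \<gamma>L vL s(1)
    by (intro subfield_mult[OF L(1)] subfield_add[OF L(1)] subfield_divide[OF L(1)]) auto
  have absval_s: "absval s = 1" using absval_eq_of_near[of s 1] s(2) by simp
  have z_absval: "absval z = absval \<omega>"
  proof -
    have "absval (\<gamma> / v * s) = w ^ p"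
      by (simp add: absval_mult absval_divide absval_v absval_s w_power_p)
    also have "w ^ p < w ^ 1" using w_pos w_less_1 p_gt_1 by (intro power_strict_decreasing) auto
    finally have "absval (\<omega> + \<gamma> / v * s) = absval \<omega>"
      by (intro absval_add_eq_left) (simp add: w_def)
    then show ?thesis by (simp add: z_def absval_mult absval_\<eta>)
  qed
  define \<sigma> where "\<sigma> = R.conjugate z"
  have \<sigma>L: "\<sigma> y \<in> L" if "y \<in> L" for y
    using R.conjugate_mem[OF z zL] that by (simp add: \<sigma>_def L_def)
  have \<sigma>_add: "\<sigma> (a + b) = \<sigma> a + \<sigma> b" and \<sigma>_mult: "\<sigma> (a * b) = \<sigma> a * \<sigma> b" if "a \<in> L" "b \<in> L" for a b
    using R.conjugate_add[OF z] R.conjugate_mult[OF z] that by (simp_all add: \<sigma>_def L_def)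
  have \<sigma>K: "\<sigma> a = a" if "a \<in> K" for a
    using R.conjugate_base[OF z that] by (simp add: \<sigma>_def)
  have \<sigma>_omega: "\<sigma> \<omega> = z" using R.conjugate_generator[OF z] by (simp add: \<sigma>_def)
  have \<sigma>_gamma: "\<sigma> \<gamma> = \<eta> * \<gamma>"
  proof -
    have "\<sigma> (poly (f_poly p u) \<omega>) = poly (f_poly p u) z"
      unfolding \<sigma>_def by (rule R.conjugate_poly[OF poly_in_f_poly[OF K(1) u_in[OF K(1,3)]] z])
    then show ?thesis by (simp only: f_z) (simp add: poly_f_poly omega)
  qed
  have \<sigma>_absval: "absval (\<sigma> y) = absval y" if "y \<in> L" for y
    using R.absval_conjugate[OF z z_absval] that by (simp add: \<sigma>_def L_def)
  \<comment> \<open>Only the residue of \<open>t\<close> is controlled: each application adds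
    \<open>s\<close>, close to 1, and replaces \<open>t\<close> by its image, which stays close to
    the same integer.\<close>
  have iter: "\<exists>t\<in>L. absval (t - of_nat k) < 1 \<and> (\<sigma> ^^ k) \<omega> = \<eta> ^ k * (\<omega> + \<gamma> / v * t)" for k
  proof (induction k)
    case 0
    show ?case using subfield_0[OF L(1)] by (intro bexI[of _ 0]) auto
  next
    case (Suc k)
    then obtain t where t: "t \<in> L" "absval (t - of_nat k) < 1" "(\<sigma> ^^ k) \<omega> = \<eta> ^ k * (\<omega> + \<gamma> / v * t)" by blast
    have K': "\<eta> ^ k \<in> K" "inverse v \<in> K"
      using \<eta>K K by (auto intro: subfield_power subfield_inverse)
    have m1: "inverse v * (\<gamma> * t) \<in> L" "\<gamma> * t \<in> L" "\<omega> + inverse v * (\<gamma> * t) \<in> L"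
      using K' L \<gamma>L t(1) by (auto intro!: subfield_mult[OF L(1)] subfield_add[OF L(1)])
    have "\<sigma> ((\<sigma> ^^ k) \<omega>) = \<sigma> (\<eta> ^ k * (\<omega> + inverse v * (\<gamma> * t)))"
      by (simp add: t(3) divide_inverse mult_ac)
    also have "\<dots> = \<eta> ^ k * (z + inverse v * (\<eta> * \<gamma> * \<sigma> t))"
      using K' L m1 \<gamma>L t(1) by (simp add: \<sigma>_mult \<sigma>_add \<sigma>K \<sigma>_omega \<sigma>_gamma subset_iff)
    also have "\<dots> = \<eta> ^ Suc k * (\<omega> + \<gamma> / v * (s + \<sigma> t))"
      by (simp add: z_def divide_inverse algebra_simps)
    finally have "(\<sigma> ^^ Suc k) \<omega> = \<eta> ^ Suc k * (\<omega> + \<gamma> / v * (s + \<sigma> t))" by simp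
    moreover have "absval (\<sigma> t - of_nat k) < 1"
    proof -
      have kL: "- of_nat k \<in> L" "t + - of_nat k \<in> L"
        using t(1) by (auto intro!: subfield_closed[OF L(1)])
      have kK: "- of_nat k \<in> K" by (intro subfield_closed[OF K(1)])
      have "\<sigma> (t + - of_nat k) = \<sigma> t - of_nat k"
        using \<sigma>_add[OF t(1) kL(1)] \<sigma>K[OF kK] by simp
      then show ?thesis using \<sigma>_absval[OF kL(2)] t(2) by simp
    qed
    then have "absval (s + \<sigma> t - of_nat (Suc k)) < 1"
      using absval_add_lessI[OF s(2), of "\<sigma> t - of_nat k"] by (simp add: algebra_simps)
    moreover have "s + \<sigma> t \<in> L" using s(1) \<sigma>L[OF t(1)] subfield_add[OF L(1)] by blast
    ultimately show ?case by blast
  qed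
  have "p * (p - 1) dvd k" if k: "(\<sigma> ^^ k) \<omega> = \<omega>" for k
  proof -
    obtain t where t: "absval (t - of_nat k) < 1" "(\<sigma> ^^ k) \<omega> = \<eta> ^ k * (\<omega> + \<gamma> / v * t)" using iter by blast
    \<comment> \<open>The order is read off twice: the action on \<gamma> gives p - 1, then the
      translation of \<omega> gives \<open>p\<close>.\<close>
    have "(\<sigma> ^^ n) \<gamma> = \<eta> ^ n * \<gamma>" for n
    proof (induction n)
      case (Suc n)
      have "\<eta> ^ n \<in> K" by (rule subfield_power[OF K(1) \<eta>K])
      then show ?case using Suc \<sigma>_mult[of "\<eta> ^ n" \<gamma>] L(2) \<gamma>L \<sigma>K \<sigma>_gamma by auto
    qed simp
    moreover have "(\<sigma> ^^ k) \<gamma> = \<gamma>"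
    proof -
      have "(\<sigma> ^^ n) (poly (f_poly p u) \<omega>) = poly (f_poly p u) ((\<sigma> ^^ n) \<omega>) \<and> (\<sigma> ^^ n) \<omega> \<in> L" for n
      proof (induction n)
        case (Suc n)
        then show ?case
          using R.conjugate_poly_comp[OF z zL poly_in_f_poly[OF K(1) u_in[OF K(1,3)]], of "(\<sigma> ^^ n) \<omega>"] \<sigma>L
          by (simp add: \<sigma>_def L_def)
      qed (use L(3) in simp)
      then show ?thesis using k by (metis poly_f_poly omega)
    qed
    ultimately have "\<eta> ^ k = 1" using absval_gamma_pos by auto
    then have "(p - 1) dvd k" by (rule \<eta>(2))
    moreover have "t = 0"
      using t(2) \<open>\<eta> ^ k = 1\<close> k absval_gamma_pos v0 by auto
    then have "absval (of_int (int k) :: 'a) < 1" using t(1) by simp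
    then have "p dvd k" by (simp only: absval_of_int_less_1_iff int_dvd_int_iff)
    moreover have "coprime p (p - 1)"
      using p_pos by (metis coprime_commute coprime_diff_one_left_nat)
    ultimately show ?thesis by (simp add: divides_mult)
  qed
  then show ?thesis
    by (intro R.cyclic_of_conjugate[OF z zL z_absval]) (simp add: \<sigma>_def)
qed

end

theorem theorem2p3:
  fixes p d q :: nat
    and K K' L :: "'a::{alg_closed_field, field_char_0, metric_space} set"
    and \<gamma> \<omega> u v :: 'a
  assumes p: "Factorial_Ring.prime p" "odd p"
    and closure: "padic_algebraic_closure p TYPE('a)"
    and K: "subfield K ambient" "Qp \<subseteq> K" "has_degree K Qp d" "unramified_over_Qp K"
    and q: "q = p ^ d"
    and \<gamma>: "poly (Polynomial.monom 1 (p - 1) + [:of_nat p:]) \<gamma> = 0"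
    and K': "K' = adjoin K \<gamma>"
    and v: "v ^ (q - 1) = 1"
    and u: "u = v powi (1 - int p)"
    and \<omega>: "poly (f_poly p u - [:\<gamma>:]) \<omega> = 0"
    and L: "L = adjoin K' \<omega>"
  shows "fps_converges_at (E2_series p u \<gamma> \<omega>) v \<and>
         kummer_generator p (fps_value (E2_series p u \<gamma> \<omega>) v) L K' \<and>
         cyclic_extension L K \<and>
         has_degree L K (p * (p - 1))"
proof -
  interpret P: padic_closed_field "TYPE('a)" p
    using p closure unfolding padic_algebraic_closure_def by unfold_locales auto
  have values_K: "P.values_in 1 K"
    unfolding P.values_in_def
  proof (intro ballI impI)
    fix a assume "a \<in> K" "a \<noteq> 0"
    then have "absval a \<in> absval ` (Qp - {0 :: 'a})"
      using K(4) unfolding unramified_over_Qp_def by blast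
    then obtain b :: 'a where "b \<in> Qp" "b \<noteq> 0" "absval a = absval b" by auto
    then show "\<exists>k::int. absval a ^ 1 = real p powi k"
      using P.Qp_absval by auto
  qed
  have roots_K: "x \<in> K" if "x ^ (p ^ d - 1) = 1" for x
    using P.roots_of_unity_unramified[OF K(1,3) _ that] values_K unfolding P.values_in_def by simp
  have "d \<noteq> 0"
  proof
    assume "d = 0"
    then have "K = {0}" using amb.dimension_zero[OF P.subfield_Qp] K(3) by simp
    then show False using subfield_1[OF K(1)] by simp
  qed
  then have q1: "0 < p ^ d - 1"
    using one_less_power[OF P.p_gt_1, of d] by simp
  have vK: "v \<in> K" using roots_K v q by simp
  have absval_v: "absval v = 1" using P.absval_root_of_unity[OF _ q1] v q by simp
  have v0: "v \<noteq> 0" using absval_v by auto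
  interpret kummer_data "TYPE('a)" p \<gamma> \<omega> u v
  proof unfold_locales
    show "\<gamma> ^ (p - 1) = - of_nat p"
      using \<gamma> by (simp add: poly_monom eq_neg_iff_add_eq_0)
    have "u * v powi int p = v powi (1 - int p + int p)"
      unfolding u using v0 by (intro power_int_add[symmetric]) simp
    then show "u * v ^ p = v" by simp
    show "\<omega> ^ p + u * of_nat p * \<omega> = \<gamma>"
      using \<omega> by (simp add: f_poly_def poly_monom)
  qed (rule absval_v)
  interpret R1: ramified_extension "TYPE('a)" p K \<gamma> 1 "p - 1" "Polynomial.monom 1 (p - 1) + [:of_nat p:]"
    by (rule ramified_gamma[OF K(1) values_K])
  have K'_sub: "subfield K' ambient" "K \<subseteq> K'" "\<gamma> \<in> K'"
    by (simp_all add: K' adjoin_subfield adjoin_base adjoin_generator)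
  have vK': "v \<in> K'" using vK K'_sub(2) by blast
  have values_K': "P.values_in (p - 1) K'" using R1.values_adjoin by (simp add: K')
  interpret R2: ramified_extension "TYPE('a)" p K' \<omega> "p - 1" p "f_poly p u - [:\<gamma>:]"
    by (rule ramified_omega_gamma[OF K'_sub(1) values_K' K'_sub(3) vK'])
  have L_sub: "subfield L ambient" "K' \<subseteq> L" "\<omega> \<in> L"
    by (simp_all add: L adjoin_subfield adjoin_base adjoin_generator)
  have "complete K" by (rule P.complete_of_dimension[OF P.subfield_Qp P.complete_Qp K(3)])
  then have complete_K': "complete K'"
    using P.complete_of_dimension[OF K(1) _ R1.degree_adjoin] by (simp add: K')
  then have complete_L: "complete L"
    using P.complete_of_dimension[OF K'_sub(1) _ R2.degree_adjoin] by (simp add: L)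
  obtain e where e: "e \<in> L" "fps_nth S sums e" "e ^ p \<in> K'"
    using value_exists[OF L_sub(1) complete_L L_sub(3) _ _ K'_sub(1) complete_K' K'_sub(3) vK'] K'_sub(3) vK' L_sub(2)
    by blast
  have sums: "(\<lambda>n. fps_nth (E2_series p u \<gamma> \<omega>) n * v ^ n) sums e"
    using e(2) by (simp add: E2_terms)
  then have conv: "fps_converges_at (E2_series p u \<gamma> \<omega>) v"
    and val: "fps_value (E2_series p u \<gamma> \<omega>) v = e"
    by (auto simp: fps_converges_at_def fps_value_def sums_iff)
  interpret R3: ramified_extension "TYPE('a)" p K' "e - 1" "p - 1" p "[:1, 1:] ^ p - [:e ^ p:]"
    by (rule ramified_kummer[OF K'_sub(1) values_K' e(3) absval_value[OF e(2)]])
  have one: "1 \<in> adjoin K' x" for x by (rule subfield_1[OF adjoin_subfield])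
  \<comment> \<open>Both fields have degree \<open>p\<close> over \<open>K'\<close>, as e - 1 and
    \<omega> have the same size, so one inclusion is enough.\<close>
  have "adjoin K' (e - 1) = L"
  proof (rule dimension_subset_eq[OF K'_sub(1) R3.degree_adjoin])
    show "has_degree L K' p" using R2.degree_adjoin by (simp add: L)
    show "adjoin K' (e - 1) \<subseteq> L"
      using L_sub e(1) subfield_1[OF L_sub(1)] by (intro adjoin_minimal subfield_diff) auto
  qed
  moreover have "adjoin K' (e - 1) \<subseteq> adjoin K' e"
    using adjoin_generator[of e K'] one by (intro adjoin_minimal adjoin_subfield adjoin_base subfield_diff) auto
  moreover have "adjoin K' e \<subseteq> L" by (rule adjoin_minimal[OF L_sub(1,2) e(1)])
  ultimately have "L = adjoin K' e" by blast
  then have kummer: "kummer_generator p e L K'"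
    using e(3) R2.degree_adjoin by (simp add: kummer_generator_def L)
  \<comment> \<open>\<gamma> = f_u(\<omega>) already lies in K(\<omega>), because \<open>u\<close>
    is in \<open>K\<close>.\<close>
  have LK: "L = adjoin K \<omega>"
  proof
    have sub: "subfield (adjoin K \<omega>) ambient" "K \<subseteq> adjoin K \<omega>" "\<omega> \<in> adjoin K \<omega>"
      by (simp_all add: adjoin_subfield adjoin_base adjoin_generator)
    have "u \<in> adjoin K \<omega>" using u_in[OF K(1) vK] sub(2) by blast
    then have "\<omega> ^ p + u * of_nat p * \<omega> \<in> adjoin K \<omega>"
      using sub(3) by (intro subfield_closed[OF sub(1)])
    then have "K' \<subseteq> adjoin K \<omega>"
      unfolding K' omega by (intro adjoin_minimal sub)
    then show "L \<subseteq> adjoin K \<omega>" unfolding L by (intro adjoin_minimal sub)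
    show "adjoin K \<omega> \<subseteq> L"
      using K'_sub(2) L_sub by (intro adjoin_minimal) auto
  qed
  have "x \<in> K" if "x ^ (p - 1) = 1" for x
  proof -
    obtain m where "p ^ d - 1 = (p - 1) * m" using minus_1_dvd_power_minus_1 ..
    then show ?thesis using roots_K[of x] that by (simp add: power_mult)
  qed
  then have "cyclic_extension L K"
    using cyclic_omega[OF K(1) values_K vK] complete_L unfolding LK by blast
  moreover have "has_degree L K (p * (p - 1))"
  proof -
    interpret R4: ramified_extension "TYPE('a)" p K \<omega> 1 "p * (p - 1)" "f_poly p u ^ (p - 1) + [:of_nat p:]"
      by (rule ramified_omega[OF K(1) values_K vK])
    show ?thesis unfolding LK by (rule R4.degree_adjoin)
  qed
  ultimately show ?thesis using conv val kummer by simp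
qed

end
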